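(* Suppose $X$ is a path connected metrizable space and $x\in X$. Then the shape kernel is a closed normal subgroup of $\pi_1(X, x)$. If in addition $X$ is locally path connected, then the shape kernel is equal to each of the following two subgroups: (1) $\bigcap_{f} \ker(f_* )$, where $f$ ranges over all continuous maps from $X$ to semilocally simply connected spaces; (2) $\bigcap G$, where $G$ ranges over all open normal subgroups of $\pi_1(X,x)$.
   Context: Open and closed subgroups: $L_x$ is the set of loops $[0,1]\to X$ based at $x$ with the sup metric for a compatible metric on $X$ (the topology does not depend on the choice). For $G\leq\pi_1(X,x)$, $\bigcup G\subseteq L_x$ is the set of all loops whose homotopy class lies in $G$; $G$ is open (closed) if $\bigcup G$ is open (closed) in $L_x$. A space $Z$ is semilocally simply connected if every $z\in Z$ has a neighborhood $U$ such that the inclusion-induced map $\pi_1(U,z)\to\pi_1(Z,z)$ is trivial. All spaces whose fundamental group is taken are assumed path connected. Shape kernel: for an open cover $\mathcal{U}$ of $X$, the nerve $N(\mathcal{U})$ is the geometric simplicial complex with a distinct vertex $v_U$ for each $U\in\mathcal{U}$, and with $[v_{U_0},\ldots,v_{U_n}]$ a simplex iff $U_0\cap\cdots\cap U_n\neq\emptyset$. Consider pairs $(\mathcal{U},U)$ with $\mathcal{U}$ an open cover and $U\in\mathcal{U}$ a distinguished element containing $x$. If $\mathcal{V}$ refines $\mathcal{U}$, with distinguished elements $V\subseteq U$, then a vertex assignment $v_{V'}\mapsto v_{U'}$ with $V'\subseteq U'$ and with $v_V\mapsto v_U$ extends to a simplicial map $p_{(\mathcal{V},V),(\mathcal{U},U)}:(N(\mathcal{V}),v_V)\to(N(\mathcal{U}),v_U)$,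 unique up to basepoint preserving homotopy. The shape group is the inverse limit $\check{\pi}_1(X,x)=\varprojlim(\pi_1(N(\mathcal{U}),v_U),p_{(\mathcal{V},V),(\mathcal{U},U)*})$ over the pairs directed by refinement. Since $X$ is paracompact Hausdorff, the pairs $(\mathcal{V},V)$ for which $V$ is the unique element of $\mathcal{V}$ containing $x$ are cofinal. For such a pair, a partition of unity $\{\rho_{V'}\}_{V'\in\mathcal{V}}$ subordinate to $\mathcal{V}$ gives a barycentric map $(X,x)\to(N(\mathcal{V}),v_V)$, $z\mapsto\sum_{V'}\rho_{V'}(z)v_{V'}$, unique up to based homotopy. The homomorphisms induced by these maps are compatible with the inverse system and define a homomorphism $\Psi:\pi_1(X,x)\to\check{\pi}_1(X,x)$. The shape kernel is $\ker(\Psi)$. *)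

theory Defs
  imports "HOL-Analysis.Analysis" "HOL-Algebra.Product_Groups"
begin

section \<open>Fundamental group of an abstract topological space\<close>

text \<open>Loops are extensional on the unit interval, so that a loop is determined by its values
  there and the set of loops really is the set of maps from the interval.\<close>

definition loops :: "'a topology \<Rightarrow> 'a \<Rightarrow> (real \<Rightarrow> 'a) set" where
  "loops X x = {\<gamma> \<in> extensional {0..1}. pathin X \<gamma> \<and> \<gamma> 0 = x \<and> \<gamma> 1 = x}"

definition loop_homotopic :: "'a topology \<Rightarrow> 'a \<Rightarrow> (real \<Rightarrow> 'a) \<Rightarrow> (real \<Rightarrow> 'a) \<Rightarrow> bool" where
  "loop_homotopic X x \<gamma> \<delta> \<longleftrightarrow>
     homotopic_with (\<lambda>r. r 0 = x \<and> r 1 = x) (top_of_set {0..1}) X \<gamma> \<delta>"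

definition loop_class :: "'a topology \<Rightarrow> 'a \<Rightarrow> (real \<Rightarrow> 'a) \<Rightarrow> (real \<Rightarrow> 'a) set" where
  "loop_class X x \<gamma> = {\<delta> \<in> loops X x. loop_homotopic X x \<gamma> \<delta>}"

text \<open>The library's concatenation of paths requires a topological space type class.\<close>

definition loop_join :: "(real \<Rightarrow> 'a) \<Rightarrow> (real \<Rightarrow> 'a) \<Rightarrow> real \<Rightarrow> 'a" where
  "loop_join \<gamma> \<delta> = (\<lambda>t\<in>{0..1}. if t \<le> 1/2 then \<gamma> (2 * t) else \<delta> (2 * t - 1))"

text \<open>Elements are homotopy classes, hence sets of loops. In the product, as in the induced map
  below, all members of the union coincide.\<close>

definition pi1 :: "'a topology \<Rightarrow> 'a \<Rightarrow> (real \<Rightarrow> 'a) set monoid" where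
  "pi1 X x =
     \<lparr>carrier = loop_class X x ` loops X x,
      monoid.mult = (\<lambda>A B. \<Union>\<gamma>\<in>A. \<Union>\<delta>\<in>B. loop_class X x (loop_join \<gamma> \<delta>)),
      one = loop_class X x (\<lambda>t\<in>{0..1}. x)\<rparr>"

text \<open>The map induced by a continuous \<open>f\<close> into \<open>Y\<close> taking the base point to \<open>y\<close>.\<close>

definition pi1_map :: "'b topology \<Rightarrow> 'b \<Rightarrow> ('a \<Rightarrow> 'b) \<Rightarrow> (real \<Rightarrow> 'a) set \<Rightarrow> (real \<Rightarrow> 'b) set" where
  "pi1_map Y y f A = (\<Union>\<gamma>\<in>A. loop_class Y y (restrict (f \<circ> \<gamma>) {0..1}))"

definition semilocally_simply_connected :: "'a topology \<Rightarrow> bool" where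
  "semilocally_simply_connected Z \<longleftrightarrow>
     (\<forall>z \<in> topspace Z. \<exists>U \<subseteq> topspace Z. z \<in> Z interior_of U \<and>
        (\<forall>a \<in> carrier (pi1 (subtopology Z U) z). pi1_map Z z (\<lambda>u. u) a = \<one>\<^bsub>pi1 Z z\<^esub>))"


section \<open>Open and closed subsets of the fundamental group\<close>

text \<open>The topology does not depend on which compatible metric is chosen.\<close>

definition loop_space :: "'a topology \<Rightarrow> 'a \<Rightarrow> (real \<Rightarrow> 'a) topology" where
  "loop_space X x =
     (let m = (SOME m. mtopology_of m = X)
      in mtopology_of (submetric (cfunspace (top_of_set {0..1}) m) (loops X x)))"

definition pi1_open :: "'a topology \<Rightarrow> 'a \<Rightarrow> (real \<Rightarrow> 'a) set set \<Rightarrow> bool" where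
  "pi1_open X x G \<longleftrightarrow> openin (loop_space X x) (\<Union>G)"

definition pi1_closed :: "'a topology \<Rightarrow> 'a \<Rightarrow> (real \<Rightarrow> 'a) set set \<Rightarrow> bool" where
  "pi1_closed X x G \<longleftrightarrow> closedin (loop_space X x) (\<Union>G)"


section \<open>Nerves\<close>

definition nerve_simplices :: "'a set set \<Rightarrow> 'a set set set" where
  "nerve_simplices \<U> = {\<sigma>. \<sigma> \<subseteq> \<U> \<and> finite \<sigma> \<and> \<sigma> \<noteq> {} \<and> \<Inter>\<sigma> \<noteq> {}}"

text \<open>Points of the realization are given by barycentric coordinates.\<close>

definition simplex_points :: "'a set set \<Rightarrow> ('a set \<Rightarrow> real) set" where
  "simplex_points \<sigma> = {t. (\<forall>U. 0 \<le> t U) \<and> (\<forall>U. U \<notin> \<sigma> \<longrightarrow> t U = 0) \<and> sum t \<sigma> = 1}"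

definition nerve_points :: "'a set set \<Rightarrow> ('a set \<Rightarrow> real) set" where
  "nerve_points \<U> = \<Union> (simplex_points ` nerve_simplices \<U>)"

text \<open>The weak topology: a set is open iff it meets every closed simplex in an open subset
  of that simplex.\<close>

definition nerve :: "'a set set \<Rightarrow> ('a set \<Rightarrow> real) topology" where
  "nerve \<U> = topology (\<lambda>S. S \<subseteq> nerve_points \<U> \<and>
     (\<forall>\<sigma> \<in> nerve_simplices \<U>.
        openin (subtopology (powertop_real UNIV) (simplex_points \<sigma>)) (S \<inter> simplex_points \<sigma>)))"

lemma openin_nerve:
  "openin (nerve \<U>) S \<longleftrightarrow> S \<subseteq> nerve_points \<U> \<and>
     (\<forall>\<sigma> \<in> nerve_simplices \<U>.
        openin (subtopology (powertop_real UNIV) (simplex_points \<sigma>)) (S \<inter> simplex_points \<sigma>))"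
proof -
  have "istopology (\<lambda>S. S \<subseteq> nerve_points \<U> \<and>
     (\<forall>\<sigma> \<in> nerve_simplices \<U>.
        openin (subtopology (powertop_real UNIV) (simplex_points \<sigma>)) (S \<inter> simplex_points \<sigma>)))"
    (is "istopology ?P")
    unfolding istopology_def
  proof (intro conjI allI impI)
    fix S T assume ST: "?P S" "?P T"
    have *: "S \<inter> T \<inter> A = (S \<inter> A) \<inter> (T \<inter> A)" for A
      by blast
    show "S \<inter> T \<subseteq> nerve_points \<U>"
      using ST by blast
    show "\<forall>\<sigma> \<in> nerve_simplices \<U>. openin (subtopology (powertop_real UNIV)
            (simplex_points \<sigma>)) (S \<inter> T \<inter> simplex_points \<sigma>)"
      unfolding * using ST by (blast intro: openin_Int)
  next
    fix \<K> assume K: "\<forall>S\<in>\<K>. ?P S"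
    have *: "\<Union>\<K> \<inter> A = (\<Union>S\<in>\<K>. S \<inter> A)" for A
      by blast
    show "\<Union>\<K> \<subseteq> nerve_points \<U>"
      using K by blast
    show "\<forall>\<sigma> \<in> nerve_simplices \<U>. openin (subtopology (powertop_real UNIV)
            (simplex_points \<sigma>)) (\<Union>\<K> \<inter> simplex_points \<sigma>)"
      unfolding * using K by (blast intro: openin_Union)
  qed
  then show ?thesis
    by (simp add: nerve_def)
qed

definition nerve_vertex :: "'a set \<Rightarrow> 'a set \<Rightarrow> real" where
  "nerve_vertex U = (\<lambda>U'. if U' = U then 1 else 0)"

text \<open>The linear extension of a vertex assignment \<open>\<phi>\<close>; points have finite support.\<close>

definition nerve_map :: "('a set \<Rightarrow> 'a set) \<Rightarrow> ('a set \<Rightarrow> real) \<Rightarrow> 'a set \<Rightarrow> real" where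
  "nerve_map \<phi> t = (\<lambda>U. sum t {V. t V \<noteq> 0 \<and> \<phi> V = U})"


section \<open>The shape group\<close>

definition pointed_covers :: "'a topology \<Rightarrow> 'a \<Rightarrow> ('a set set \<times> 'a set) set" where
  "pointed_covers X x =
     {(\<U>, U). (\<forall>W\<in>\<U>. openin X W) \<and> \<Union>\<U> = topspace X \<and> U \<in> \<U> \<and> x \<in> U}"

definition cover_refines :: "'a set set \<times> 'a set \<Rightarrow> 'a set set \<times> 'a set \<Rightarrow> bool" where
  "cover_refines = (\<lambda>(\<V>, V) (\<U>, U). (\<forall>V'\<in>\<V>. \<exists>U'\<in>\<U>. V' \<subseteq> U') \<and> V \<subseteq> U)"

definition vertex_assignment ::
    "'a set set \<times> 'a set \<Rightarrow> 'a set set \<times> 'a set \<Rightarrow> ('a set \<Rightarrow> 'a set) \<Rightarrow> bool" where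
  "vertex_assignment = (\<lambda>(\<V>, V) (\<U>, U) \<phi>. (\<forall>V'\<in>\<V>. \<phi> V' \<in> \<U> \<and> V' \<subseteq> \<phi> V') \<and> \<phi> V = U)"

definition nerve_pi1 :: "'a set set \<times> 'a set \<Rightarrow> (real \<Rightarrow> 'a set \<Rightarrow> real) set monoid" where
  "nerve_pi1 = (\<lambda>(\<U>, U). pi1 (nerve \<U>) (nerve_vertex U))"

text \<open>Vertex assignments between two given pairs induce based homotopic maps, so the choice
  is immaterial.\<close>

definition bonding ::
    "'a set set \<times> 'a set \<Rightarrow> 'a set set \<times> 'a set
      \<Rightarrow> (real \<Rightarrow> 'a set \<Rightarrow> real) set \<Rightarrow> (real \<Rightarrow> 'a set \<Rightarrow> real) set" where
  "bonding q p =
     pi1_map (nerve (fst p)) (nerve_vertex (snd p)) (nerve_map (SOME \<phi>. vertex_assignment q p \<phi>))"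

definition shape_group ::
    "'a topology \<Rightarrow> 'a
      \<Rightarrow> ('a set set \<times> 'a set \<Rightarrow> (real \<Rightarrow> 'a set \<Rightarrow> real) set) monoid" where
  "shape_group X x = (product_group (pointed_covers X x) nerve_pi1)
     \<lparr>carrier := {c \<in> (\<Pi>\<^sub>E p\<in>pointed_covers X x. carrier (nerve_pi1 p)).
        \<forall>p\<in>pointed_covers X x. \<forall>q\<in>pointed_covers X x.
          cover_refines q p \<longrightarrow> bonding q p (c q) = c p}\<rparr>"


section \<open>The shape kernel\<close>

definition partition_of_unity :: "'a topology \<Rightarrow> 'a set set \<Rightarrow> ('a set \<Rightarrow> 'a \<Rightarrow> real) \<Rightarrow> bool" where
  "partition_of_unity X \<V> \<rho> \<longleftrightarrow>
     (\<forall>V\<in>\<V>. continuous_map X euclideanreal (\<rho> V) \<and> (\<forall>z\<in>topspace X. 0 \<le> \<rho> V z) \<and>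
             X closure_of {z \<in> topspace X. \<rho> V z \<noteq> 0} \<subseteq> V) \<and>
     (\<forall>z\<in>topspace X. \<exists>W. openin X W \<and> z \<in> W \<and> finite {V \<in> \<V>. \<exists>w\<in>W. \<rho> V w \<noteq> 0}) \<and>
     (\<forall>z\<in>topspace X. (\<Sum>V\<in>{V \<in> \<V>. \<rho> V z \<noteq> 0}. \<rho> V z) = 1)"

definition barycentric_map ::
    "'a set set \<Rightarrow> ('a set \<Rightarrow> 'a \<Rightarrow> real) \<Rightarrow> 'a \<Rightarrow> 'a set \<Rightarrow> real" where
  "barycentric_map \<V> \<rho> z = (\<lambda>V. if V \<in> \<V> then \<rho> V z else 0)"

text \<open>The homomorphism induced by a barycentric map into the nerve of a cover in which the
  distinguished element is the only one containing the base point. Different partitions of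
  unity give based homotopic maps.\<close>

definition barycentric_pi1 ::
    "'a topology \<Rightarrow> 'a set set \<times> 'a set \<Rightarrow> (real \<Rightarrow> 'a) set \<Rightarrow> (real \<Rightarrow> 'a set \<Rightarrow> real) set" where
  "barycentric_pi1 X = (\<lambda>(\<V>, V).
     pi1_map (nerve \<V>) (nerve_vertex V)
       (barycentric_map \<V> (SOME \<rho>. partition_of_unity X \<V> \<rho>)))"

definition special_covers :: "'a topology \<Rightarrow> 'a \<Rightarrow> ('a set set \<times> 'a set) set" where
  "special_covers X x = {(\<V>, V) \<in> pointed_covers X x. \<forall>V'\<in>\<V>. x \<in> V' \<longrightarrow> V' = V}"

text \<open>For paracompact Hausdorff \<open>X\<close> the special covers are cofinal, so an element of the
  inverse limit is determined by its components there: the component at an arbitrary pair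
  is obtained by pushing forward along the bonding map from any special refinement. By
  compatibility of the barycentric homomorphisms, the choice of refinement is immaterial.\<close>

definition shape_hom ::
    "'a topology \<Rightarrow> 'a
      \<Rightarrow> (real \<Rightarrow> 'a) set \<Rightarrow> ('a set set \<times> 'a set \<Rightarrow> (real \<Rightarrow> 'a set \<Rightarrow> real) set)" where
  "shape_hom X x g = (\<lambda>p\<in>pointed_covers X x.
     let q = (SOME q. q \<in> special_covers X x \<and> cover_refines q p)
     in bonding q p (barycentric_pi1 X q g))"

definition shape_kernel :: "'a topology \<Rightarrow> 'a \<Rightarrow> (real \<Rightarrow> 'a) set set" where
  "shape_kernel X x = kernel (pi1 X x) (shape_group X x) (shape_hom X x)"

text \<open>Quantification over all target spaces: HOL cannot quantify over types inside a formula.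
  A family of maps into all spaces is therefore written with targets carried by
  \<open>('a set \<Rightarrow> real) + 'b\<close> for an arbitrary type \<open>'b\<close>. Every space on \<open>'b\<close> has a homeomorphic copy
  there, via \<open>Inr\<close>; the left summand only ensures that the universe is large enough to contain
  the nerves of covers, since over a type such as \<open>unit\<close> alone the family would be too small.\<close>

end

(* Fix a canonical map f_p from X to the nerve of each pointed cover p. The shape kernel is the
   intersection of the kernels of the induced homomorphisms. Any two paths in the open star of a
   vertex with common endpoints are homotopic in the nerve, so the class of a loop in the nerve is
   determined by the sequence of stars it passes through; hence nearby loops of X have the same
   image, and each kernel is clopen.

   For the converse inclusions let h be a homomorphism on pi_1(X) that kills, up to conjugation,
   the small loops at every point; this covers both the quotient by an open normal subgroup and
   the homomorphism induced by a map to a semilocally simply connected space. If X is locally path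
   connected, it has a cover by path connected open sets such that h is trivial on loops in the
   union of any two overlapping members. For such a cover h is computed by a cocycle on
   the nerve of the cover, and a null-homotopy in the nerve, subdivided into a fine grid, shows that
   h kills every loop that dies in the nerve. *)

theory Submission
  imports Defs
begin

section \<open>Homotopy of paths relative to endpoints\<close>

text \<open>A loop cannot be cut into pieces inside a fundamental group, and both halves of the
  argument need cutting. A homomorphism on \<open>pi1\<close> is therefore extended to all paths,
  that is, to the fundamental groupoid, by fixing a path from x to every point. Both halves then
  become one computation: on each set of a cover the extended map is a difference of potentials, and
  its value on a loop is the product of the changes of potential between consecutive sets. In the
  nerve the sets are the open stars and the homomorphism is the identity; in X they are small path
  connected sets and the homomorphism is h. A null-homotopy in the nerve can be used for X because
  changes of potential only refer to overlaps, and stars with a common point belong to sets with a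
  common point. Two obstacles shape the rest. A nerve may be infinite and far from locally finite,
  so continuity for its weak topology is always obtained from finiteness of supports. And the
  partitions of unity chosen in the shape homomorphism mean something only if they exist, so
  paracompactness of metrizable spaces is part of the proof.\<close>

definition path_homotopic :: "'a topology \<Rightarrow> (real \<Rightarrow> 'a) \<Rightarrow> (real \<Rightarrow> 'a) \<Rightarrow> bool" where
  "path_homotopic X a b \<longleftrightarrow>
     homotopic_with (\<lambda>r. r 0 = a 0 \<and> r 1 = a 1) (top_of_set {0..1}) X a b"

lemma path_homotopic_endpoints:
  assumes "path_homotopic X a b"
  shows "b 0 = a 0" "b 1 = a 1"
  using homotopic_with_imp_property[OF assms[unfolded path_homotopic_def]] by auto

lemma path_homotopic_imp_pathin:
  assumes "path_homotopic X a b"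
  shows "pathin X a" "pathin X b"
  using homotopic_with_imp_continuous_maps[OF assms[unfolded path_homotopic_def]]
  by (auto simp: pathin_def)

lemma path_homotopic_sym: "path_homotopic X a b \<Longrightarrow> path_homotopic X b a"
  using path_homotopic_endpoints[of X a b]
  by (simp add: path_homotopic_def homotopic_with_sym)

lemma path_homotopic_trans [trans]:
  "path_homotopic X a b \<Longrightarrow> path_homotopic X b c \<Longrightarrow> path_homotopic X a c"
  using path_homotopic_endpoints[of X a b] homotopic_with_trans
  unfolding path_homotopic_def by fastforce

lemma path_homotopic_eq:
  assumes "pathin X a" "\<And>t. t \<in> {0..1} \<Longrightarrow> a t = b t"
  shows "path_homotopic X a b"
  unfolding path_homotopic_def
  using assms by (intro homotopic_with_equal) (auto simp: pathin_def)

lemma path_homotopic_refl: "pathin X a \<Longrightarrow> path_homotopic X a a"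
  by (rule path_homotopic_eq) auto

lemma path_homotopic_map:
  assumes "path_homotopic X a b" "continuous_map X Y f"
  shows "path_homotopic Y (f \<circ> a) (f \<circ> b)"
  unfolding path_homotopic_def
  by (rule homotopic_with_compose_continuous_map_left[OF assms[unfolded path_homotopic_def]]) auto

text \<open>The straight-line homotopy takes place in the convex parameter set C and is then pushed
  into X by K, so X needs no linear structure. The interval as C gives reparametrization, the square
  as C gives the relation between the sides of a square.\<close>

lemma path_homotopic_straight:
  fixes C :: "'c::real_normed_vector set"
  assumes K: "continuous_map (top_of_set C) X K" and "convex C"
    and p: "continuous_on {0..1} p" "p ` {0..1} \<subseteq> C"
    and q: "continuous_on {0..1} q" "q ` {0..1} \<subseteq> C"
    and eq: "p 0 = q 0" "p 1 = q 1"
  shows "path_homotopic X (K \<circ> p) (K \<circ> q)"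
proof -
  define S where "S = (\<lambda>z::real \<times> real. (1 - fst z) *\<^sub>R p (snd z) + fst z *\<^sub>R q (snd z))"
  have S: "S z \<in> C" if "z \<in> {0..1} \<times> {0..1}" for z
    unfolding S_def using that p(2) q(2)
    by (intro convexD[OF \<open>convex C\<close>]) auto
  have cS: "continuous_on ({0..1} \<times> {0..1}) S"
    unfolding S_def
    by (intro continuous_intros continuous_on_compose2[OF p(1)] continuous_on_compose2[OF q(1)]) auto
  have mS: "continuous_map (prod_topology (top_of_set {0..1}) (top_of_set {0..1})) (top_of_set C) S"
    unfolding subtopology_Times[symmetric] euclidean_product_topology
    using cS S by (auto simp flip: subtopology_UNIV simp: continuous_map_in_subtopology subtopology_subtopology)
  show ?thesis
    unfolding path_homotopic_def homotopic_with_def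
  proof (intro exI conjI)
    show "continuous_map (prod_topology (top_of_set {0..1}) (top_of_set {0..1})) X (K \<circ> S)"
      by (rule continuous_map_compose[OF mS K])
  qed (auto simp: S_def eq simp flip: scaleR_left_distrib)
qed

lemma path_homotopic_reparam:
  assumes "pathin X a" "continuous_on {0..1} p" "p ` {0..1} \<subseteq> {0..1}"
    "continuous_on {0..1} q" "q ` {0..1} \<subseteq> {0..1}" "p 0 = q 0" "p 1 = q (1::real)"
  shows "path_homotopic X (a \<circ> p) (a \<circ> q)"
  using assms by (intro path_homotopic_straight[where C = "{0..1::real}"]) (auto simp: pathin_def)

lemma loop_join_0 [simp]: "loop_join a b 0 = a 0"
  and loop_join_1 [simp]: "loop_join a b 1 = b 1"
  by (auto simp: loop_join_def)

lemma loop_join_extensional: "loop_join a b \<in> extensional {0..1}"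
  by (simp add: loop_join_def)

lemma comp_loop_join:
  "t \<in> {0..1} \<Longrightarrow> (f \<circ> loop_join a b) t = loop_join (f \<circ> a) (f \<circ> b) t"
  by (auto simp: loop_join_def)

text \<open>The homotopies are glued along the path parameter, which is the second coordinate.
  Applied to maps that ignore the first coordinate, it also yields continuity of joined
  paths.\<close>

lemma continuous_map_join:
  assumes a: "continuous_map (prod_topology (top_of_set {0..1::real}) (top_of_set {0..1})) X H"
    and b: "continuous_map (prod_topology (top_of_set {0..1}) (top_of_set {0..1})) X K"
    and eq: "\<And>t. t \<in> {0..1} \<Longrightarrow> H (t, 1) = K (t, 0)"
  shows "continuous_map (prod_topology (top_of_set {0..1}) (top_of_set {0..1})) X
           (\<lambda>z. if snd z \<le> (1/2::real) then H (fst z, 2 * snd z) else K (fst z, 2 * snd z - 1))"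
proof -
  let ?T = "prod_topology (top_of_set {0..1::real}) (top_of_set {0..1::real})"
  have T: "?T = top_of_set ({0..1} \<times> {0..1})"
    by (simp add: subtopology_Times euclidean_product_topology)
  show ?thesis
  proof (rule continuous_map_cases_le)
    show "continuous_map ?T euclideanreal snd"
      by (metis continuous_map_snd continuous_map_in_subtopology)
    show "continuous_map ?T euclideanreal (\<lambda>x. 1/2)"
      by simp
    have *: "{y \<in> topspace ?T. snd y \<le> 1/2} = {0..1} \<times> {0..1/2}"
      "{y \<in> topspace ?T. 1/2 \<le> snd y} = {0..1} \<times> {1/2..1}"
      by auto
    have i: "({0..1} \<times> {0..1}) \<inter> ({0..1} \<times> {0..1 / 2}) = {0..1::real} \<times> {0..1 / 2::real}"
      "({0..1} \<times> {0..1}) \<inter> ({0..1} \<times> {1 / 2..1}) = {0..1::real} \<times> {1/2..1::real}"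
      by auto
    have "continuous_map (top_of_set ({0..1} \<times> {0..1/2})) ?T (\<lambda>z::real\<times>real. (fst z, 2 * snd z))"
      unfolding T by (auto simp: continuous_map_in_subtopology intro!: continuous_intros)
    from continuous_map_compose[OF this a]
    show "continuous_map (subtopology ?T {y \<in> topspace ?T. snd y \<le> 1/2}) X (\<lambda>z. H (fst z, 2 * snd z))"
      unfolding * unfolding T subtopology_subtopology i by (simp add: o_def)
    have "continuous_map (top_of_set ({0..1} \<times> {1/2..1})) ?T (\<lambda>z::real\<times>real. (fst z, 2 * snd z - 1))"
      unfolding T by (auto simp: continuous_map_in_subtopology intro!: continuous_intros)
    from continuous_map_compose[OF this b]
    show "continuous_map (subtopology ?T {y \<in> topspace ?T. 1/2 \<le> snd y}) X (\<lambda>z. K (fst z, 2 * snd z - 1))"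
      unfolding * unfolding T subtopology_subtopology i by (simp add: o_def)
    show "H (fst z, 2 * snd z) = K (fst z, 2 * snd z - 1)"
      if "z \<in> topspace ?T" "snd z = 1/2" for z
    proof -
      have "2 * snd z = 1" "fst z \<in> {0..1}"
        using that by auto
      then show ?thesis
        using eq[of "fst z"] by simp
    qed
  qed
qed

lemma pathin_loop_join:
  assumes "pathin X a" "pathin X b" "a 1 = b 0"
  shows "pathin X (loop_join a b)"
proof -
  have H: "continuous_map (prod_topology (top_of_set {0..1::real}) (top_of_set {0..1::real})) X (c \<circ> snd)"
    if "pathin X c" for c
    using that continuous_map_snd continuous_map_compose unfolding pathin_def by blast
  have "continuous_map (top_of_set {0..1}) (prod_topology (top_of_set {0..1::real}) (top_of_set {0..1::real})) (\<lambda>s. (0,s))"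
    by (intro continuous_intros) auto
  note * = continuous_map_compose[OF this continuous_map_join[OF H[OF assms(1)] H[OF assms(2)]]]
  show ?thesis
    unfolding pathin_def by (rule continuous_map_eq[OF *]) (use assms(3) in \<open>auto simp: loop_join_def\<close>)
qed

lemma path_homotopic_join:
  assumes "path_homotopic X a a'" "path_homotopic X b b'" "a 1 = b 0"
  shows "path_homotopic X (loop_join a b) (loop_join a' b')"
proof -
  obtain H where H: "continuous_map (prod_topology (top_of_set {0..1::real}) (top_of_set {0..1})) X H"
    "\<And>s. H (0, s) = a s" "\<And>s. H (1, s) = a' s"
    "\<And>t. t \<in> {0..1} \<Longrightarrow> H (t, 0) = a 0 \<and> H (t, 1) = a 1"
    using assms(1) unfolding path_homotopic_def homotopic_with_def by blast
  obtain K where K: "continuous_map (prod_topology (top_of_set {0..1::real}) (top_of_set {0..1})) X K"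
    "\<And>s. K (0, s) = b s" "\<And>s. K (1, s) = b' s"
    "\<And>t. t \<in> {0..1} \<Longrightarrow> K (t, 0) = b 0 \<and> K (t, 1) = b 1"
    using assms(2) unfolding path_homotopic_def homotopic_with_def by blast
  show ?thesis
    unfolding path_homotopic_def
    by (subst homotopic_with, fastforce)
      (rule exI[of _ "\<lambda>z. if snd z \<le> 1/2 then H (fst z, 2 * snd z) else K (fst z, 2 * snd z - 1)"],
        use H K assms(3) continuous_map_join[OF H(1) K(1)] in \<open>auto simp: loop_join_def\<close>)
qed

lemma pathin_reverse: "pathin X a \<Longrightarrow> pathin X (\<lambda>t. a (1 - t))"
proof -
  assume "pathin X a"
  moreover have "continuous_map (top_of_set {0..1}) (top_of_set {0..1::real}) (\<lambda>t. 1 - t)"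
    by (auto simp: continuous_map_subtopology_eu intro!: continuous_on_op_minus)
  ultimately have "continuous_map (top_of_set {0..1}) X (a \<circ> (\<lambda>t. 1 - t))"
    unfolding pathin_def by (rule continuous_map_compose[rotated])
  then show ?thesis
    by (simp add: pathin_def o_def)
qed

lemma path_homotopic_assoc:
  assumes "pathin X a" "pathin X b" "pathin X c" "a 1 = b 0" "b 1 = c 0"
  shows "path_homotopic X (loop_join (loop_join a b) c) (loop_join a (loop_join b c))"
proof -
  let ?d = "loop_join (loop_join a b) c"
  \<comment> \<open>Piecewise linear with slopes 1/2, 1 and 2; it sends the break points 1/2 and 3/4
    of the right-bracketed join to the break points 1/4 and 1/2 of the left-bracketed one.\<close>
  define p :: "real \<Rightarrow> real" where
    "p = (\<lambda>t. min (t/2) (1/4) + max 0 (min (t - 1/2) (1/4)) + max 0 (2 * (t - 3/4)))"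
  have p: "continuous_on {0..1} p"
    unfolding p_def by (intro continuous_intros) auto
  have d: "pathin X ?d"
    using assms by (intro pathin_loop_join) auto
  have "path_homotopic X (?d \<circ> id) (?d \<circ> p)"
    by (intro path_homotopic_reparam[OF d])
      (use p in \<open>auto simp: p_def min_def max_def\<close>)
  moreover have "path_homotopic X (?d \<circ> p) (loop_join a (loop_join b c))"
  proof (rule path_homotopic_eq)
    show "pathin X (?d \<circ> p)"
      using calculation path_homotopic_imp_pathin by blast
    fix t :: real assume t: "t \<in> {0..1}"
    consider "t \<le> 1/2" | "1/2 < t" "t \<le> 3/4" | "3/4 < t"
      by linarith
    then show "(?d \<circ> p) t = loop_join a (loop_join b c) t"
    proof cases
      case 1
      then have "p t = t / 2" by (auto simp: p_def min_def max_def)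
      then show ?thesis using 1 t by (simp only: loop_join_def o_def) simp
    next
      case 2
      then have "p t = t - 1/4" by (auto simp: p_def min_def max_def)
      then have "b (2 * (2 * p t) - 1) = b (2 * (2 * t - 1))"
        by (intro arg_cong[where f = b]) simp
      then show ?thesis using 2 t assms \<open>p t = t - 1/4\<close> by (simp add: loop_join_def)
    next
      case 3
      then have "p t = 2 * t - 1" by (auto simp: p_def min_def max_def)
      then have "c (2 * p t - 1) = c (2 * (2 * t - 1) - 1)"
        by (intro arg_cong[where f = c]) simp
      then show ?thesis using 3 t \<open>p t = 2 * t - 1\<close> by (simp add: loop_join_def)
    qed
  qed
  ultimately show ?thesis
    using path_homotopic_trans by (metis comp_id)
qed

lemma path_homotopic_const_join:
  assumes "pathin X a" "\<And>t. t \<in> {0..1} \<Longrightarrow> e t = a 0"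
  shows "path_homotopic X (loop_join e a) a"
proof -
  define p :: "real \<Rightarrow> real" where "p = (\<lambda>t. max 0 (2 * t - 1))"
  have p: "continuous_on {0..1} p"
    unfolding p_def by (intro continuous_intros)
  have "path_homotopic X (a \<circ> id) (a \<circ> p)"
    by (intro path_homotopic_reparam[OF assms(1)])
      (use p in \<open>auto simp: p_def min_def max_def\<close>)
  moreover have "path_homotopic X (a \<circ> p) (loop_join e a)"
  proof (rule path_homotopic_eq)
    show "pathin X (a \<circ> p)"
      using path_homotopic_imp_pathin[OF calculation] by blast
    show "(a \<circ> p) t = loop_join e a t" if "t \<in> {0..1}" for t
      using that assms(2) by (cases "t \<le> 1/2") (auto simp: p_def loop_join_def)
  qed
  ultimately show ?thesis
    using path_homotopic_trans path_homotopic_sym by (metis comp_id)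
qed

lemma path_homotopic_join_reverse:
  assumes "pathin X a"
  shows "path_homotopic X (loop_join a (\<lambda>t. a (1 - t))) (\<lambda>t. a 0)"
proof -
  \<comment> \<open>The tent map runs through the interval and back; inside the interval it
    contracts to the constant 0 with its endpoints fixed.\<close>
  define p :: "real \<Rightarrow> real" where "p = (\<lambda>t. min (2 * t) (2 - 2 * t))"
  have p: "continuous_on {0..1} p"
    unfolding p_def by (intro continuous_intros)
  have "path_homotopic X (a \<circ> p) (a \<circ> (\<lambda>t. 0))"
    by (intro path_homotopic_reparam[OF assms(1)])
      (use p in \<open>auto simp: p_def min_def max_def\<close>)
  moreover have "path_homotopic X (a \<circ> p) (loop_join a (\<lambda>t. a (1 - t)))"
    using path_homotopic_imp_pathin[OF calculation]
    by (intro path_homotopic_eq) (auto simp: p_def loop_join_def min_def)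
  ultimately show ?thesis
    using path_homotopic_trans path_homotopic_sym by (fastforce simp: o_def)
qed

section \<open>The fundamental group\<close>

lemma loop_homotopic_iff:
  "\<gamma> 0 = x \<Longrightarrow> \<gamma> 1 = x \<Longrightarrow> loop_homotopic X x \<gamma> \<delta> \<longleftrightarrow> path_homotopic X \<gamma> \<delta>"
  by (auto simp: loop_homotopic_def path_homotopic_def)

lemma loops_iff:
  "\<gamma> \<in> loops X x \<longleftrightarrow> \<gamma> \<in> extensional {0..1} \<and> pathin X \<gamma> \<and> \<gamma> 0 = x \<and> \<gamma> 1 = x"
  by (auto simp: loops_def)

text \<open>Only the members of a class have to be extensional, not the path that names it. Classes
  of composites such as \<open>f \<circ> \<gamma>\<close> can therefore be formed without
  restricting them to the interval.\<close>

lemma loop_class_iff: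
  assumes "\<gamma> 0 = x" "\<gamma> 1 = x"
  shows "\<delta> \<in> loop_class X x \<gamma> \<longleftrightarrow> \<delta> \<in> extensional {0..1} \<and> path_homotopic X \<gamma> \<delta>"
  using assms path_homotopic_endpoints[of X \<gamma> \<delta>] path_homotopic_imp_pathin[of X \<gamma> \<delta>]
  by (auto simp: loop_class_def loop_homotopic_iff loops_iff)

lemma loop_class_self: "\<gamma> \<in> loops X x \<Longrightarrow> \<gamma> \<in> loop_class X x \<gamma>"
  by (simp add: loop_class_iff loops_iff path_homotopic_refl)

lemma loop_class_eq:
  assumes "path_homotopic X \<gamma> \<delta>" "\<gamma> 0 = x" "\<gamma> 1 = x"
  shows "loop_class X x \<gamma> = loop_class X x \<delta>"
proof -
  have "\<delta> 0 = x" "\<delta> 1 = x"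
    using assms path_homotopic_endpoints[OF assms(1)] by auto
  then show ?thesis
    using assms path_homotopic_trans[OF assms(1)] path_homotopic_trans[OF path_homotopic_sym[OF assms(1)]]
    by (auto simp: loop_class_iff)
qed

lemma loop_class_eq_iff:
  assumes "\<gamma> \<in> loops X x" "\<delta> \<in> loops X x"
  shows "loop_class X x \<gamma> = loop_class X x \<delta> \<longleftrightarrow> path_homotopic X \<gamma> \<delta>"
proof
  assume "loop_class X x \<gamma> = loop_class X x \<delta>"
  then have "\<delta> \<in> loop_class X x \<gamma>"
    using loop_class_self[OF assms(2)] by simp
  then show "path_homotopic X \<gamma> \<delta>"
    using assms by (simp add: loop_class_iff loops_iff)
qed (use assms loop_class_eq in \<open>fastforce simp: loops_iff\<close>)

lemma path_homotopic_restrict: "pathin X a \<Longrightarrow> path_homotopic X a (restrict a {0..1})"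
  by (rule path_homotopic_eq) auto

lemma pathin_restrict: "pathin X (restrict a {0..1}) \<longleftrightarrow> pathin X a"
  unfolding pathin_def by (auto elim!: continuous_map_eq)

lemma restrict_in_loops:
  assumes "pathin X a" "a 0 = x" "a 1 = x"
  shows "restrict a {0..1} \<in> loops X x"
  using assms by (auto simp: loops_iff pathin_restrict)

lemma loop_class_restrict:
  assumes "pathin X a" "a 0 = x" "a 1 = x"
  shows "loop_class X x (restrict a {0..1}) = loop_class X x a"
  using loop_class_eq[OF path_homotopic_restrict[OF assms(1)] assms(2,3)] by simp

lemma loop_class_in_pi1:
  assumes "pathin X a" "a 0 = x" "a 1 = x"
  shows "loop_class X x a \<in> carrier (pi1 X x)"
  using restrict_in_loops[OF assms] loop_class_restrict[OF assms] by (auto simp: pi1_def)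

lemma pi1_carrierE:
  assumes "g \<in> carrier (pi1 X x)"
  obtains \<gamma> where "\<gamma> \<in> loops X x" "g = loop_class X x \<gamma>"
  using assms by (auto simp: pi1_def)

lemma UN_const_on: "A \<noteq> {} \<Longrightarrow> (\<And>a. a \<in> A \<Longrightarrow> f a = B) \<Longrightarrow> (\<Union>a\<in>A. f a) = B"
  by blast

lemma pi1_mult:
  assumes a: "pathin X a" "a 0 = x" "a 1 = x" and b: "pathin X b" "b 0 = x" "b 1 = x"
  shows "loop_class X x a \<otimes>\<^bsub>pi1 X x\<^esub> loop_class X x b = loop_class X x (loop_join a b)"
proof -
  have ne: "loop_class X x a \<noteq> {}" "loop_class X x b \<noteq> {}"
    using loop_class_self[OF restrict_in_loops[OF a]] loop_class_self[OF restrict_in_loops[OF b]]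
      loop_class_restrict[OF a] loop_class_restrict[OF b] by auto
  have eq: "loop_class X x (loop_join c d) = loop_class X x (loop_join a b)"
    if "c \<in> loop_class X x a" "d \<in> loop_class X x b" for c d
  proof -
    have "path_homotopic X (loop_join a b) (loop_join c d)"
      using that a b by (intro path_homotopic_join) (auto simp: loop_class_iff)
    then show ?thesis
      by (rule loop_class_eq[symmetric]) (use a b in auto)
  qed
  have "(\<Union>c\<in>loop_class X x a. \<Union>d\<in>loop_class X x b. loop_class X x (loop_join c d))
      = loop_class X x (loop_join a b)"
    by (intro UN_const_on ne eq)
  then show ?thesis
    by (simp add: pi1_def)
qed

lemma pi1_one: "\<one>\<^bsub>pi1 X x\<^esub> = loop_class X x (\<lambda>t\<in>{0..1}. x)"
  by (simp add: pi1_def)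

lemma pi1_one': "x \<in> topspace X \<Longrightarrow> \<one>\<^bsub>pi1 X x\<^esub> = loop_class X x (\<lambda>t. x)"
  using loop_class_restrict[of X "\<lambda>t. x" x] by (simp add: pi1_one)

lemma group_pi1:
  assumes x: "x \<in> topspace X"
  shows "group (pi1 X x)"
proof (rule groupI)
  show "\<one>\<^bsub>pi1 X x\<^esub> \<in> carrier (pi1 X x)"
    unfolding pi1_one'[OF x] using x by (intro loop_class_in_pi1) auto
next
  fix g h assume "g \<in> carrier (pi1 X x)" "h \<in> carrier (pi1 X x)"
  then obtain \<gamma> \<delta> where "\<gamma> \<in> loops X x" "\<delta> \<in> loops X x" "g = loop_class X x \<gamma>" "h = loop_class X x \<delta>"
    by (metis pi1_carrierE)
  then show "g \<otimes>\<^bsub>pi1 X x\<^esub> h \<in> carrier (pi1 X x)"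
    by (auto simp: pi1_mult loops_iff intro!: loop_class_in_pi1 pathin_loop_join)
next
  fix g h k assume "g \<in> carrier (pi1 X x)" "h \<in> carrier (pi1 X x)" "k \<in> carrier (pi1 X x)"
  then obtain a b c where *: "a \<in> loops X x" "b \<in> loops X x" "c \<in> loops X x"
    "g = loop_class X x a" "h = loop_class X x b" "k = loop_class X x c"
    by (metis pi1_carrierE)
  then have "path_homotopic X (loop_join (loop_join a b) c) (loop_join a (loop_join b c))"
    by (intro path_homotopic_assoc) (auto simp: loops_iff)
  then show "g \<otimes>\<^bsub>pi1 X x\<^esub> h \<otimes>\<^bsub>pi1 X x\<^esub> k = g \<otimes>\<^bsub>pi1 X x\<^esub> (h \<otimes>\<^bsub>pi1 X x\<^esub> k)"
    using * loop_class_eq[of X _ _ x] by (simp add: pi1_mult loops_iff pathin_loop_join)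
next
  fix g assume "g \<in> carrier (pi1 X x)"
  then obtain \<gamma> where g: "\<gamma> \<in> loops X x" "g = loop_class X x \<gamma>"
    by (metis pi1_carrierE)
  then have "path_homotopic X (loop_join (\<lambda>t. x) \<gamma>) \<gamma>"
    by (intro path_homotopic_const_join) (auto simp: loops_iff)
  then show "\<one>\<^bsub>pi1 X x\<^esub> \<otimes>\<^bsub>pi1 X x\<^esub> g = g"
    using g x loop_class_eq[of X _ _ x] by (simp add: pi1_mult pi1_one' loops_iff)
  define \<delta> where "\<delta> = (\<lambda>t. \<gamma> (1 - t))"
  have d: "pathin X \<delta>" "\<delta> 0 = x" "\<delta> 1 = x"
    using g pathin_reverse[of X \<gamma>] by (auto simp: loops_iff \<delta>_def)
  have "path_homotopic X (loop_join \<delta> \<gamma>) (\<lambda>t. x)"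
    using path_homotopic_join_reverse[OF d(1)] d(2) by (simp add: \<delta>_def)
  then have "loop_class X x \<delta> \<otimes>\<^bsub>pi1 X x\<^esub> g = \<one>\<^bsub>pi1 X x\<^esub>"
    using g x d loop_class_eq[of X _ _ x] by (simp add: pi1_mult pi1_one' loops_iff)
  then show "\<exists>h\<in>carrier (pi1 X x). h \<otimes>\<^bsub>pi1 X x\<^esub> g = \<one>\<^bsub>pi1 X x\<^esub>"
    using loop_class_in_pi1[OF d] by blast
qed

lemma pi1_map_loop_class:
  assumes f: "continuous_map X Y f" and a: "pathin X a" "a 0 = x" "a 1 = x"
  shows "pi1_map Y (f x) f (loop_class X x a) = loop_class Y (f x) (f \<circ> a)"
  unfolding pi1_map_def
proof (rule UN_const_on)
  show "loop_class X x a \<noteq> {}"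
    using loop_class_self[OF restrict_in_loops[OF a]] loop_class_restrict[OF a] by auto
  fix c assume "c \<in> loop_class X x a"
  then have c: "path_homotopic X a c"
    using a by (auto simp: loop_class_iff)
  note c' = path_homotopic_imp_pathin(2)[OF c] path_homotopic_endpoints[OF c]
  have "loop_class Y (f x) (restrict (f \<circ> c) {0..1}) = loop_class Y (f x) (f \<circ> c)"
    using c' a by (intro loop_class_restrict pathin_compose[OF _ f]) auto
  also have "\<dots> = loop_class Y (f x) (f \<circ> a)"
    using path_homotopic_map[OF c f] a by (intro loop_class_eq[symmetric]) auto
  finally show "loop_class Y (f x) (restrict (f \<circ> c) {0..1}) = loop_class Y (f x) (f \<circ> a)" .
qed

lemma pi1_map_hom:
  assumes f: "continuous_map X Y f"
  shows "pi1_map Y (f x) f \<in> hom (pi1 X x) (pi1 Y (f x))"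
proof (rule homI)
  fix g assume "g \<in> carrier (pi1 X x)"
  then obtain \<gamma> where g: "\<gamma> \<in> loops X x" "g = loop_class X x \<gamma>"
    by (metis pi1_carrierE)
  then show "pi1_map Y (f x) f g \<in> carrier (pi1 Y (f x))"
    by (auto simp: pi1_map_loop_class[OF f] loops_iff intro!: loop_class_in_pi1 pathin_compose[OF _ f])
next
  fix g h assume "g \<in> carrier (pi1 X x)" "h \<in> carrier (pi1 X x)"
  then obtain \<gamma> \<delta> where *: "\<gamma> \<in> loops X x" "\<delta> \<in> loops X x" "g = loop_class X x \<gamma>" "h = loop_class X x \<delta>"
    by (metis pi1_carrierE)
  have "pathin Y (f \<circ> loop_join \<gamma> \<delta>)"
    using * by (auto simp: loops_iff intro!: pathin_compose[OF _ f] pathin_loop_join)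
  then have "path_homotopic Y (f \<circ> loop_join \<gamma> \<delta>) (loop_join (f \<circ> \<gamma>) (f \<circ> \<delta>))"
    by (rule path_homotopic_eq) (rule comp_loop_join)
  then show "pi1_map Y (f x) f (g \<otimes>\<^bsub>pi1 X x\<^esub> h) =
      pi1_map Y (f x) f g \<otimes>\<^bsub>pi1 Y (f x)\<^esub> pi1_map Y (f x) f h"
    using * loop_class_eq[of Y "f \<circ> loop_join \<gamma> \<delta>" _ "f x"]
    by (simp add: pi1_mult pi1_map_loop_class[OF f] loops_iff pathin_loop_join pathin_compose[OF _ f])
qed

lemma group_hom_pi1_map:
  assumes "continuous_map X Y f" "x \<in> topspace X"
  shows "group_hom (pi1 X x) (pi1 Y (f x)) (pi1_map Y (f x) f)"
proof -
  have "f x \<in> topspace Y"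
    using assms continuous_map_funspace by fastforce
  then show ?thesis
    using assms by (auto simp: group_hom_def group_hom_axioms_def group_pi1 pi1_map_hom)
qed

lemma pi1_map_comp:
  assumes "continuous_map X Y f" "continuous_map Y Z k" "g \<in> carrier (pi1 X x)"
  shows "pi1_map Z (k (f x)) k (pi1_map Y (f x) f g) = pi1_map Z (k (f x)) (k \<circ> f) g"
proof -
  obtain \<gamma> where g: "\<gamma> \<in> loops X x" "g = loop_class X x \<gamma>"
    by (metis pi1_carrierE assms(3))
  have "pi1_map Z ((k \<circ> f) x) (k \<circ> f) (loop_class X x \<gamma>) = loop_class Z ((k \<circ> f) x) (k \<circ> f \<circ> \<gamma>)"
    using g by (intro pi1_map_loop_class continuous_map_compose[OF assms(1,2)]) (auto simp: loops_iff)
  moreover have "pi1_map Z (k (f x)) k (loop_class Y (f x) (f \<circ> \<gamma>)) = loop_class Z (k (f x)) (k \<circ> (f \<circ> \<gamma>))"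
    using g by (intro pi1_map_loop_class assms(2) pathin_compose[OF _ assms(1)]) (auto simp: loops_iff)
  ultimately show ?thesis
    using g pi1_map_loop_class[OF assms(1), of \<gamma> x] by (simp add: loops_iff comp_assoc)
qed

lemma loop_class_eq_one_iff:
  assumes "pathin X a" "a 0 = x" "a 1 = x"
  shows "loop_class X x a = \<one>\<^bsub>pi1 X x\<^esub> \<longleftrightarrow> path_homotopic X a (\<lambda>t. x)"
proof -
  have x: "x \<in> topspace X"
    using assms path_start_in_topspace by fastforce
  have "loop_class X x a = \<one>\<^bsub>pi1 X x\<^esub> \<longleftrightarrow>
      path_homotopic X (restrict a {0..1}) (restrict (\<lambda>t. x) {0..1})"
    using assms x loop_class_eq_iff[OF restrict_in_loops[OF assms] restrict_in_loops[of X "\<lambda>t. x" x]]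
    by (simp add: pi1_one loop_class_restrict del: restrict_apply)
  also have "\<dots> \<longleftrightarrow> path_homotopic X a (\<lambda>t. x)"
  proof -
    have a: "path_homotopic X a (restrict a {0..1})"
      and c: "path_homotopic X (\<lambda>t. x) (restrict (\<lambda>t. x) {0..1})"
      using assms x by (auto intro!: path_homotopic_restrict)
    show ?thesis
      using path_homotopic_trans[OF path_homotopic_trans[OF a] path_homotopic_sym[OF c]]
        path_homotopic_trans[OF path_homotopic_trans[OF path_homotopic_sym[OF a]] c] by blast
  qed
  finally show ?thesis .
qed

section \<open>Functors on paths\<close>

definition subpath_on :: "real \<Rightarrow> real \<Rightarrow> (real \<Rightarrow> 'a) \<Rightarrow> real \<Rightarrow> 'a" where
  "subpath_on u v a = (\<lambda>t. a (u + (v - u) * t))"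

lemma subpath_on_0 [simp]: "subpath_on u v a 0 = a u"
  and subpath_on_1 [simp]: "subpath_on u v a 1 = a v"
  by (simp_all add: subpath_on_def)

lemma subpath_param:
  fixes u v t :: real
  assumes "u \<le> v" "t \<in> {0..1}"
  shows "u + (v - u) * t \<in> {u..v}"
  using assms mult_left_mono[of t 1 "v - u"] by auto

lemma subpath_on_image: "u \<le> v \<Longrightarrow> subpath_on u v a ` {0..1} \<subseteq> a ` {u..v}"
  unfolding subpath_on_def using subpath_param[of u v] by auto

lemma pathin_subpath_on:
  assumes "pathin X a" "0 \<le> u" "u \<le> v" "v \<le> 1"
  shows "pathin X (subpath_on u v a)"
proof -
  have "continuous_map (top_of_set {0..1}) (top_of_set {0..1}) (\<lambda>t. u + (v - u) * t)"
    using subpath_param[of u v] assms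
    by (auto simp: continuous_map_subtopology_eu intro!: continuous_intros) force+
  from continuous_map_compose[OF this] assms(1)
  show ?thesis
    by (auto simp: pathin_def subpath_on_def o_def)
qed

lemma path_homotopic_subpath_on_join:
  assumes "pathin X a" "0 \<le> u" "u \<le> v" "v \<le> w" "w \<le> 1"
  shows "path_homotopic X (loop_join (subpath_on u v a) (subpath_on v w a)) (subpath_on u w a)"
proof -
  let ?l = "\<lambda>u v t :: real. u + (v - u) * t"
  define p where "p = loop_join (?l u v) (?l v w)"
  have l: "pathin euclideanreal (?l u v)" for u v
    unfolding pathin_def by (auto simp: continuous_map_iff_continuous intro!: continuous_intros)
  have "pathin euclideanreal p"
    unfolding p_def using l by (intro pathin_loop_join) auto
  then have p: "continuous_on {0..1} p"
    by (simp add: pathin_def continuous_map_iff_continuous)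
  have p01: "p t \<in> {0..1}" if t: "t \<in> {0..1}" for t
  proof (cases "t \<le> 1/2")
    case True
    then show ?thesis
      using subpath_param[of u v "2 * t"] t assms by (simp add: p_def loop_join_def)
  next
    case False
    then show ?thesis
      using subpath_param[of v w "2 * t - 1"] t assms by (simp add: p_def loop_join_def)
  qed
  have l01: "?l u w t \<in> {0..1}" if "t \<in> {0..1}" for t
    using subpath_param[of u w t] that assms by auto
  have "path_homotopic X (a \<circ> p) (a \<circ> ?l u w)"
  proof (intro path_homotopic_reparam[OF assms(1) p])
    show "continuous_on {0..1} (?l u w)"
      by (intro continuous_intros)
    show "p ` {0..1} \<subseteq> {0..1}" "?l u w ` {0..1} \<subseteq> {0..1}"
      using p01 l01 by blast+
  qed (simp_all add: p_def)
  moreover have "path_homotopic X (a \<circ> p) (loop_join (subpath_on u v a) (subpath_on v w a))"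
    using path_homotopic_imp_pathin[OF calculation]
    by (intro path_homotopic_eq) (auto simp: p_def comp_loop_join subpath_on_def loop_join_def)
  ultimately show ?thesis
    using path_homotopic_trans[OF path_homotopic_sym] unfolding subpath_on_def o_def by blast
qed

text \<open>This is a functor from the fundamental groupoid of X to the group Q, seen as a category
  with one object. In contrast to a homomorphism on loops, it can be evaluated on the pieces of a
  subdivided loop.\<close>

locale path_functor = Q: group Q for Q :: "('q, 'm) monoid_scheme" (structure) +
  fixes X :: "'a topology" and \<theta> :: "(real \<Rightarrow> 'a) \<Rightarrow> 'q"
  assumes closed: "pathin X a \<Longrightarrow> \<theta> a \<in> carrier Q"
    and homotopic: "path_homotopic X a b \<Longrightarrow> \<theta> a = \<theta> b"
    and join: "pathin X a \<Longrightarrow> pathin X b \<Longrightarrow> a 1 = b 0 \<Longrightarrow> \<theta> (loop_join a b) = \<theta> a \<otimes> \<theta> b"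
begin

lemma const: "w \<in> topspace X \<Longrightarrow> (\<And>t. t \<in> {0..1} \<Longrightarrow> a t = w) \<Longrightarrow> \<theta> a = \<one>"
proof -
  assume w: "w \<in> topspace X" and a: "\<And>t. t \<in> {0..1} \<Longrightarrow> a t = w"
  let ?c = "\<lambda>t::real. w"
  have c: "pathin X ?c"
    using w by simp
  have "\<theta> (loop_join ?c ?c) = \<theta> ?c"
    using c by (intro homotopic path_homotopic_const_join) auto
  then have "\<theta> ?c \<otimes> \<theta> ?c = \<theta> ?c"
    using join[OF c c] by simp
  then have "\<theta> ?c = \<one>"
    using closed[OF c] by simp
  moreover have "path_homotopic X ?c a"
    using c a by (intro path_homotopic_eq) auto
  ultimately show "\<theta> a = \<one>"
    using homotopic by auto
qed

lemma reverse: "pathin X a \<Longrightarrow> \<theta> (\<lambda>t. a (1 - t)) = inv (\<theta> a)"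
proof -
  assume a: "pathin X a"
  let ?r = "\<lambda>t. a (1 - t)"
  have r: "pathin X ?r"
    using a by (rule pathin_reverse)
  have "\<theta> a \<otimes> \<theta> ?r = \<theta> (loop_join a ?r)"
    using join[OF a r] by simp
  also have "\<dots> = \<theta> (\<lambda>t. a 0)"
    by (intro homotopic path_homotopic_join_reverse a)
  also have "\<dots> = \<one>"
    using path_start_in_topspace[OF a] by (intro const) auto
  finally show ?thesis
    using closed[OF a] closed[OF r] by (metis Q.inv_comm Q.inv_equality)
qed

lemma subpath:
  assumes "pathin X a" "0 \<le> u" "u \<le> v" "v \<le> w" "w \<le> 1"
  shows "\<theta> (subpath_on u w a) = \<theta> (subpath_on u v a) \<otimes> \<theta> (subpath_on v w a)"
  using homotopic[OF path_homotopic_subpath_on_join[OF assms]] assms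
  by (subst join[symmetric]) (auto intro!: pathin_subpath_on)

text \<open>The two ways from corner (0,0) to corner (1,1) along the boundary are homotopic inside
  the square because it is convex.\<close>

lemma square:
  assumes K: "continuous_map (top_of_set ({0..1} \<times> {0..1})) X K"
  shows "\<theta> (\<lambda>s. K (s, 0)) \<otimes> \<theta> (\<lambda>t. K (1, t)) = \<theta> (\<lambda>t. K (0, t)) \<otimes> \<theta> (\<lambda>s. K (s, 1))"
proof -
  let ?sq = "{0..1} \<times> {0..1} :: (real \<times> real) set"
  define p where "p = loop_join (\<lambda>s::real. (s, 0::real)) (\<lambda>t. (1, t))"
  define q where "q = loop_join (\<lambda>t::real. (0::real, t)) (\<lambda>s. (s, 1))"
  have 1: "pathin (top_of_set ?sq) (\<lambda>s. (s, 0))" "pathin (top_of_set ?sq) (\<lambda>t. (1, t))"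
    "pathin (top_of_set ?sq) (\<lambda>t. (0, t))" "pathin (top_of_set ?sq) (\<lambda>s. (s, 1))"
    unfolding pathin_def continuous_map_subtopology_eu by (auto intro!: continuous_intros)
  then have "pathin (top_of_set ?sq) p" "pathin (top_of_set ?sq) q"
    unfolding p_def q_def by (auto intro!: pathin_loop_join)
  then have "continuous_on {0..1} p" "p ` {0..1} \<subseteq> ?sq" "continuous_on {0..1} q" "q ` {0..1} \<subseteq> ?sq"
    unfolding pathin_def continuous_map_subtopology_eu image_subset_iff_funcset by blast+
  moreover have "p 0 = q 0" "p 1 = q 1"
    by (simp_all add: p_def q_def)
  ultimately have "path_homotopic X (K \<circ> p) (K \<circ> q)"
    by (intro path_homotopic_straight[OF K]) (simp_all add: convex_Times)
  then have eq: "\<theta> (K \<circ> p) = \<theta> (K \<circ> q)"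
    by (rule homotopic)
  have 2: "pathin X (\<lambda>s. K (s, 0))" "pathin X (\<lambda>t. K (1, t))"
    "pathin X (\<lambda>t. K (0, t))" "pathin X (\<lambda>s. K (s, 1))"
    using 1[THEN pathin_compose[OF _ K]] by (auto simp: o_def)
  have *: "\<theta> (K \<circ> loop_join a b) = \<theta> (K \<circ> a) \<otimes> \<theta> (K \<circ> b)"
    if "pathin X (K \<circ> a)" "pathin X (K \<circ> b)" "a 1 = b 0" for a b
  proof -
    have "path_homotopic X (loop_join (K \<circ> a) (K \<circ> b)) (K \<circ> loop_join a b)"
      using that by (intro path_homotopic_eq pathin_loop_join) (auto simp: loop_join_def)
    then have "\<theta> (K \<circ> loop_join a b) = \<theta> (loop_join (K \<circ> a) (K \<circ> b))"
      by (rule homotopic[symmetric])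
    then show ?thesis
      using join[OF that(1,2)] that(3) by simp
  qed
  show ?thesis
    using eq 2 *[of "\<lambda>s. (s, 0)" "\<lambda>t. (1, t)"] *[of "\<lambda>t. (0, t)" "\<lambda>s. (s, 1)"]
    unfolding p_def q_def o_def by simp
qed

end

text \<open>Every point z gets a path \<open>\<alpha> z\<close> from x; an arbitrary path is closed
  up to a loop at x by the paths of its two endpoints, and h is applied to the class of that
  loop.\<close>

lemma path_functor_exists:
  assumes "group_hom (pi1 X x) H h" and conn: "path_connected_space X" and x: "x \<in> topspace X"
  obtains \<theta> where "path_functor H X \<theta>"
    "\<And>a. pathin X a \<Longrightarrow> a 0 = x \<Longrightarrow> a 1 = x \<Longrightarrow> \<theta> a = h (loop_class X x a)"
proof -
  interpret group_hom "pi1 X x" H h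
    by fact
  \<comment> \<open>The path chosen for x itself is constant, so that the functor restricts to h on
    loops at x and not merely to a conjugate of it.\<close>
  have "\<forall>z. \<exists>a. z \<in> topspace X \<longrightarrow> pathin X a \<and> a 0 = x \<and> a 1 = z \<and> (z = x \<longrightarrow> a = (\<lambda>t. x))"
  proof
    fix z
    show "\<exists>a. z \<in> topspace X \<longrightarrow> pathin X a \<and> a 0 = x \<and> a 1 = z \<and> (z = x \<longrightarrow> a = (\<lambda>t. x))"
    proof (cases "z = x")
      case True
      then show ?thesis using x by (intro exI[of _ "\<lambda>t. x"]) auto
    next
      case False
      then show ?thesis using conn x by (auto simp: path_connected_space_def)
    qed
  qed
  then obtain \<alpha> where \<alpha>: "\<And>z. z \<in> topspace X \<Longrightarrow> pathin X (\<alpha> z)"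
      "\<And>z. z \<in> topspace X \<Longrightarrow> \<alpha> z 0 = x" "\<And>z. z \<in> topspace X \<Longrightarrow> \<alpha> z 1 = z"
      "\<alpha> x = (\<lambda>t. x)"
    using x by metis
  define \<beta> where "\<beta> = (\<lambda>z t. \<alpha> z (1 - t))"
  have \<beta>: "\<And>z. z \<in> topspace X \<Longrightarrow> pathin X (\<beta> z)"
      "\<And>z. z \<in> topspace X \<Longrightarrow> \<beta> z 0 = z" "\<And>z. z \<in> topspace X \<Longrightarrow> \<beta> z 1 = x"
    using \<alpha> by (auto simp: \<beta>_def intro: pathin_reverse)
  define L where "L = (\<lambda>a. loop_join (\<alpha> (a 0)) (loop_join a (\<beta> (a 1))))"
  define \<theta> where "\<theta> = (\<lambda>a. h (loop_class X x (L a)))"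
  note top = path_start_in_topspace path_finish_in_topspace
  have L: "pathin X (L a)" "L a 0 = x" "L a 1 = x" if "pathin X a" for a
    unfolding L_def using that \<alpha> \<beta> top[OF that] by (auto intro!: pathin_loop_join)
  have hom: "\<theta> a = \<theta> b" if ab: "path_homotopic X a b" for a b
  proof -
    note pa = path_homotopic_imp_pathin[OF ab]
    have "path_homotopic X (L a) (L b)"
      unfolding L_def path_homotopic_endpoints[OF ab]
      using ab pa \<alpha> \<beta> top[OF pa(1)]
      by (intro path_homotopic_join path_homotopic_refl) (auto simp: path_homotopic_endpoints[OF ab])
    then show ?thesis
      unfolding \<theta>_def using L pa by (subst loop_class_eq) auto
  qed
  have mult: "\<theta> (loop_join a b) = \<theta> a \<otimes>\<^bsub>H\<^esub> \<theta> b"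
    if a: "pathin X a" and b: "pathin X b" and ab: "a 1 = b 0" for a b
  proof -
    let ?A = "\<alpha> (a 0)" and ?B = "\<alpha> (b 0)" and ?B' = "\<beta> (b 0)" and ?C = "\<beta> (b 1)"
    note pts = top[OF a] top[OF b]
    note pin = \<alpha>(1)[OF pts(1)] \<alpha>(1)[OF pts(3)] \<beta>(1)[OF pts(3)] \<beta>(1)[OF pts(4)] a b
    note ends = \<alpha>(2,3) \<beta>(2,3) pts ab
    let ?J = loop_join
    have bC: "pathin X (?J b ?C)" and BbC: "pathin X (?J ?B (?J b ?C))" and aB: "pathin X (?J a ?B')"
      using pin ends by (auto intro!: pathin_loop_join)
    \<comment> \<open>In the product of the two closed-up loops, the return to x from the common
      point and the way out again cancel.\<close>
    have "path_homotopic X (?J ?B' (?J ?B (?J b ?C))) (?J (?J ?B' ?B) (?J b ?C))"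
      using pin ends bC by (intro path_homotopic_sym[OF path_homotopic_assoc]) auto
    also have "path_homotopic X (?J (?J ?B' ?B) (?J b ?C)) (?J (\<lambda>t. b 0) (?J b ?C))"
    proof (rule path_homotopic_join[OF _ path_homotopic_refl[OF bC]])
      show "path_homotopic X (?J ?B' ?B) (\<lambda>t. b 0)"
        using path_homotopic_join_reverse[OF pin(3)] ends by (simp add: \<beta>_def)
    qed (use ends in auto)
    also have "path_homotopic X (?J (\<lambda>t. b 0) (?J b ?C)) (?J b ?C)"
      by (intro path_homotopic_const_join bC) auto
    finally have *: "path_homotopic X (?J ?B' (?J ?B (?J b ?C))) (?J b ?C)" .
    have "path_homotopic X (?J (?J a ?B') (?J ?B (?J b ?C))) (?J a (?J ?B' (?J ?B (?J b ?C))))"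
      using pin ends BbC by (intro path_homotopic_assoc) auto
    also have "path_homotopic X (?J a (?J ?B' (?J ?B (?J b ?C)))) (?J a (?J b ?C))"
      using ends by (intro path_homotopic_join[OF path_homotopic_refl[OF a] *]) auto
    also have "path_homotopic X (?J a (?J b ?C)) (?J (?J a b) ?C)"
      using pin ends by (intro path_homotopic_sym[OF path_homotopic_assoc]) auto
    finally have **: "path_homotopic X (?J (?J a ?B') (?J ?B (?J b ?C))) (?J (?J a b) ?C)" .
    have "path_homotopic X (?J (?J ?A (?J a ?B')) (?J ?B (?J b ?C))) (?J ?A (?J (?J a ?B') (?J ?B (?J b ?C))))"
      using pin ends aB BbC by (intro path_homotopic_assoc) auto
    also have "path_homotopic X (?J ?A (?J (?J a ?B') (?J ?B (?J b ?C)))) (?J ?A (?J (?J a b) ?C))"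
      using ends by (intro path_homotopic_join[OF path_homotopic_refl[OF pin(1)] **]) auto
    finally have "path_homotopic X (?J (L a) (L b)) (L (?J a b))"
      by (simp add: L_def ab)
    then have "loop_class X x (?J (L a) (L b)) = loop_class X x (L (?J a b))"
      using L a b by (intro loop_class_eq) auto
    then have "\<theta> (?J a b) = h (loop_class X x (L a) \<otimes>\<^bsub>pi1 X x\<^esub> loop_class X x (L b))"
      unfolding \<theta>_def using L[OF a] L[OF b] by (simp add: pi1_mult)
    also have "\<dots> = \<theta> a \<otimes>\<^bsub>H\<^esub> \<theta> b"
      unfolding \<theta>_def using L[OF a] L[OF b] by (intro hom_mult) (auto intro!: loop_class_in_pi1)
    finally show ?thesis .
  qed
  have pf: "path_functor H X \<theta>"
  proof
    show "\<theta> a \<in> carrier H" if "pathin X a" for a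
      unfolding \<theta>_def using L[OF that] by (intro hom_closed) (auto intro!: loop_class_in_pi1)
  qed (fact hom mult)+
  have "\<theta> a = h (loop_class X x a)" if a: "pathin X a" "a 0 = x" "a 1 = x" for a
  proof -
    have x': "\<alpha> x = (\<lambda>t. x)" "\<beta> x = (\<lambda>t. x)"
      using \<alpha>(4) by (auto simp: \<beta>_def)
    have one: "loop_class X x (\<lambda>t. x) = \<one>\<^bsub>pi1 X x\<^esub>"
      using pi1_one'[OF x] by simp
    have ac: "pathin X (loop_join a (\<lambda>t. x))"
      using a x by (intro pathin_loop_join) auto
    have "loop_class X x (L a) = \<one>\<^bsub>pi1 X x\<^esub> \<otimes>\<^bsub>pi1 X x\<^esub> (loop_class X x a \<otimes>\<^bsub>pi1 X x\<^esub> \<one>\<^bsub>pi1 X x\<^esub>)"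
      unfolding L_def a x' one[symmetric] using a x ac by (simp add: pi1_mult)
    also have "\<dots> = loop_class X x a"
      using loop_class_in_pi1[OF a] by simp
    finally show ?thesis
      by (simp add: \<theta>_def)
  qed
  then show thesis
    using pf that by blast
qed

text \<open>Local data for a path functor: on each set \<open>S i\<close> the functor is the coboundary of the
  potential \<open>p i\<close>, and the potentials of two overlapping sets differ by a constant.\<close>

locale path_functor_chart = path_functor +
  fixes I :: "'i set" and S :: "'i \<Rightarrow> 'a set" and p :: "'i \<Rightarrow> 'a \<Rightarrow> 'q"
  assumes p_closed: "i \<in> I \<Longrightarrow> w \<in> S i \<Longrightarrow> p i w \<in> carrier Q"
    and p_path: "i \<in> I \<Longrightarrow> pathin X a \<Longrightarrow> a ` {0..1} \<subseteq> S i \<Longrightarrow> \<theta> a = inv (p i (a 0)) \<otimes> p i (a 1)"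
    and p_change: "i \<in> I \<Longrightarrow> j \<in> I \<Longrightarrow> w \<in> S i \<inter> S j \<Longrightarrow> w' \<in> S i \<inter> S j \<Longrightarrow>
      p i w \<otimes> inv (p j w) = p i w' \<otimes> inv (p j w')"
begin

text \<open>The jump of the potential on passing from chart i to chart j, a 1-cocycle in the sense
  of Cech. For disjoint charts the chosen point is arbitrary and the value carries no information;
  every use supplies a common point.\<close>

definition transition :: "'i \<Rightarrow> 'i \<Rightarrow> 'q" where
  "transition i j = (let w = SOME w. w \<in> S i \<inter> S j in p i w \<otimes> inv (p j w))"

lemma transition_eq:
  assumes "i \<in> I" "j \<in> I" "w \<in> S i" "w \<in> S j"
  shows "transition i j = p i w \<otimes> inv (p j w)"
proof -
  have "(SOME w. w \<in> S i \<inter> S j) \<in> S i \<inter> S j"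
    by (rule someI[of _ w]) (use assms in auto)
  then show ?thesis
    unfolding transition_def Let_def using assms by (intro p_change) auto
qed

lemma transition_closed:
  "i \<in> I \<Longrightarrow> j \<in> I \<Longrightarrow> w \<in> S i \<Longrightarrow> w \<in> S j \<Longrightarrow> transition i j \<in> carrier Q"
  by (simp add: transition_eq p_closed)

lemma transition_cocycle:
  assumes "i \<in> I" "j \<in> I" "k \<in> I" "w \<in> S i" "w \<in> S j" "w \<in> S k"
  shows "transition i j \<otimes> transition j k = transition i k"
proof -
  have "p i w \<in> carrier Q" "p j w \<in> carrier Q" "p k w \<in> carrier Q"
    using assms p_closed by auto
  then have "p i w \<otimes> inv (p j w) \<otimes> (p j w \<otimes> inv (p k w)) = p i w \<otimes> inv (p k w)"
    by (metis Q.inv_closed Q.l_inv Q.m_assoc Q.m_closed Q.r_one Q.l_one)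
  then show ?thesis
    using assms by (simp add: transition_eq)
qed

text \<open>The index counts transitions, not charts: a chain of n charts has holonomy
  \<open>holonomy u (n - 1)\<close>.\<close>

primrec holonomy :: "(nat \<Rightarrow> 'i) \<Rightarrow> nat \<Rightarrow> 'q" where
  "holonomy u 0 = \<one>"
| "holonomy u (Suc k) = holonomy u k \<otimes> transition (u k) (u (Suc k))"

lemma holonomy_closed:
  assumes "\<And>l. l \<le> k \<Longrightarrow> u l \<in> I" "\<And>l. l < k \<Longrightarrow> S (u l) \<inter> S (u (Suc l)) \<noteq> {}"
  shows "holonomy u k \<in> carrier Q"
  using assms
proof (induction k)
  case (Suc k)
  then obtain w where "w \<in> S (u k)" "w \<in> S (u (Suc k))"
    by blast
  then show ?case
    using Suc transition_closed[of "u k" "u (Suc k)"] by simp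
qed simp

lemma holonomy_const:
  assumes "\<And>l. l \<le> k \<Longrightarrow> u l = i" "i \<in> I" "S i \<noteq> {}"
  shows "holonomy u k = \<one>"
  using assms(1)
proof (induction k)
  case (Suc k)
  obtain w where "w \<in> S i"
    using assms by blast
  then have "transition i i = \<one>"
    using assms by (simp add: transition_eq p_closed)
  then show ?case
    using Suc.IH Suc.prems[of k] Suc.prems[of "Suc k"] Suc.prems by simp
qed simp

text \<open>A ladder argument. Each rung square commutes by the cocycle identity, because its four
  charts share a point, and the squares are composed one after the other.\<close>

lemma holonomy_rows:
  assumes "\<And>l. l \<le> k \<Longrightarrow> u l \<in> I \<and> v l \<in> I" "S (u 0) \<inter> S (v 0) \<noteq> {}"
    and "\<And>l. l < k \<Longrightarrow> S (u l) \<inter> S (u (Suc l)) \<inter> S (v l) \<inter> S (v (Suc l)) \<noteq> {}"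
  shows "holonomy u k \<otimes> transition (u k) (v k) = transition (u 0) (v 0) \<otimes> holonomy v k"
  using assms(1,3)
proof (induction k)
  case 0
  then show ?case
    using assms(2) transition_closed[of "u 0" "v 0"] by fastforce
next
  case (Suc k)
  obtain w where w: "w \<in> S (u k)" "w \<in> S (u (Suc k))" "w \<in> S (v k)" "w \<in> S (v (Suc k))"
    using Suc.prems(2)[of k] by blast
  have I: "u k \<in> I" "u (Suc k) \<in> I" "v k \<in> I" "v (Suc k) \<in> I" "u 0 \<in> I" "v 0 \<in> I"
    using Suc.prems(1)[of k] Suc.prems(1)[of 0] Suc.prems(1)[of "Suc k"] by auto
  have IH: "holonomy u k \<otimes> transition (u k) (v k) = transition (u 0) (v 0) \<otimes> holonomy v k"
    using Suc.prems by (intro Suc.IH) auto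
  have hu: "holonomy u k \<in> carrier Q" and hv: "holonomy v k \<in> carrier Q"
  proof -
    have "S (u l) \<inter> S (u (Suc l)) \<noteq> {}" "S (v l) \<inter> S (v (Suc l)) \<noteq> {}" if "l < k" for l
      using Suc.prems(2)[of l] that by auto
    then show "holonomy u k \<in> carrier Q" "holonomy v k \<in> carrier Q"
      using Suc.prems(1) by (auto intro!: holonomy_closed)
  qed
  have t0: "transition (u 0) (v 0) \<in> carrier Q"
    using assms(2) I transition_closed[of "u 0" "v 0"] by blast
  note t = transition_closed[OF _ _ w(1,2)] transition_closed[OF _ _ w(2,4)]
    transition_closed[OF _ _ w(1,3)] transition_closed[OF _ _ w(3,4)]
  have "transition (u k) (u (Suc k)) \<otimes> transition (u (Suc k)) (v (Suc k))
      = transition (u k) (v k) \<otimes> transition (v k) (v (Suc k))"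
    using I w by (simp add: transition_cocycle[of _ _ _ w])
  then have "holonomy u (Suc k) \<otimes> transition (u (Suc k)) (v (Suc k))
      = holonomy u k \<otimes> transition (u k) (v k) \<otimes> transition (v k) (v (Suc k))"
    using hu t I by (simp add: Q.m_assoc)
  also have "\<dots> = transition (u 0) (v 0) \<otimes> holonomy v (Suc k)"
    unfolding IH using hv t t0 I by (simp add: Q.m_assoc)
  finally show ?case .
qed

text \<open>The path is cut at the points k/n. On each piece \<theta> is a difference of potentials,
  and at each cut two potentials combine to a transition element. The result depends on the path
  only through its endpoints and the chain of charts; this is what makes it stable under small
  perturbations.\<close>

lemma functor_eq_holonomy:
  assumes a: "pathin X a" and n: "0 < n"
    and u: "\<And>k. k < n \<Longrightarrow> u k \<in> I \<and> a ` {real k / real n .. real (Suc k) / real n} \<subseteq> S (u k)"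
  shows "\<theta> a = inv (p (u 0) (a 0)) \<otimes> holonomy u (n - 1) \<otimes> p (u (n - 1)) (a 1)"
proof -
  let ?t = "\<lambda>k. real k / real n"
  have end_in: "a (?t k) \<in> S (u k)" "a (?t (Suc k)) \<in> S (u k)" if "k < n" for k
  proof -
    have "?t k \<in> {?t k..?t (Suc k)}" "?t (Suc k) \<in> {?t k..?t (Suc k)}"
      by (auto intro: divide_right_mono)
    then show "a (?t k) \<in> S (u k)" "a (?t (Suc k)) \<in> S (u k)"
      using u[OF that] by blast+
  qed
  have piece: "\<theta> (subpath_on (?t k) (?t (Suc k)) a) = inv (p (u k) (a (?t k))) \<otimes> p (u k) (a (?t (Suc k)))"
    if "k < n" for k
  proof -
    have "?t k \<le> ?t (Suc k)"
      by (simp add: divide_right_mono)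
    moreover have "?t (Suc k) \<le> 1"
      using that by simp
    ultimately have "pathin X (subpath_on (?t k) (?t (Suc k)) a)"
      "subpath_on (?t k) (?t (Suc k)) a ` {0..1} \<subseteq> S (u k)"
      using u[OF that] subpath_on_image[of "?t k" "?t (Suc k)" a] by (auto intro!: pathin_subpath_on a)
    from p_path[OF _ this] show ?thesis
      using u[OF that] by simp
  qed
  have "\<theta> (subpath_on 0 (?t (Suc k)) a) = inv (p (u 0) (a 0)) \<otimes> holonomy u k \<otimes> p (u k) (a (?t (Suc k)))"
    if "k < n" for k
    using that
  proof (induction k)
    case 0
    then show ?case
      using piece[of 0] u[of 0] end_in[of 0] p_closed[of "u 0"] n by simp
  next
    case (Suc k)
    let ?w = "a (?t (Suc k))"
    have le: "?t (Suc k) \<le> ?t (Suc (Suc k))" "?t (Suc (Suc k)) \<le> 1"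
      using Suc.prems by (auto intro: divide_right_mono)
    have w: "?w \<in> S (u k)" "?w \<in> S (u (Suc k))" "a (?t (Suc (Suc k))) \<in> S (u (Suc k))" "a 0 \<in> S (u 0)"
      and I: "u k \<in> I" "u (Suc k) \<in> I" "u 0 \<in> I"
      using end_in[of k] end_in[of "Suc k"] end_in[of 0] u[of k] u[of "Suc k"] u[of 0] Suc.prems by auto
    have h: "holonomy u k \<in> carrier Q"
    proof (rule holonomy_closed)
      show "S (u l) \<inter> S (u (Suc l)) \<noteq> {}" if "l < k" for l
        using end_in(2)[of l] end_in(1)[of "Suc l"] that Suc.prems by auto
    qed (use u Suc.prems in auto)
    have "\<theta> (subpath_on 0 (?t (Suc (Suc k))) a)
        = \<theta> (subpath_on 0 (?t (Suc k)) a) \<otimes> \<theta> (subpath_on (?t (Suc k)) (?t (Suc (Suc k))) a)"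
      using le by (intro subpath a) auto
    also have "\<dots> = inv (p (u 0) (a 0)) \<otimes> holonomy u k \<otimes> p (u k) ?w
        \<otimes> (inv (p (u (Suc k)) ?w) \<otimes> p (u (Suc k)) (a (?t (Suc (Suc k)))))"
      using piece[OF Suc.prems] Suc.IH Suc.prems by simp
    also have "\<dots> = inv (p (u 0) (a 0)) \<otimes> holonomy u (Suc k) \<otimes> p (u (Suc k)) (a (?t (Suc (Suc k))))"
      using w I h by (simp add: transition_eq[OF _ _ w(1,2)] p_closed Q.m_assoc)
    finally show ?case .
  qed
  from this[of "n - 1"] n have "\<theta> (subpath_on 0 1 a) = inv (p (u 0) (a 0)) \<otimes> holonomy u (n - 1) \<otimes> p (u (n - 1)) (a 1)"
    by simp
  then show ?thesis
    by (simp add: subpath_on_def)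
qed

end

text \<open>The Lebesgue number of the cover pulled back to the square bounds the mesh. The cover is
  kept as an indexed family, since the grid has to record indices.\<close>

lemma square_grid:
  assumes cover: "\<And>z. z \<in> {0..1} \<times> {0..1} \<Longrightarrow> \<exists>i\<in>I. H z \<in> T i"
    and op: "\<And>i. i \<in> I \<Longrightarrow> openin N (T i)"
    and H: "continuous_map (top_of_set ({0..1} \<times> {0..1})) N H"
  obtains n u where "0 < n"
    "\<And>k l. k < n \<Longrightarrow> l < n \<Longrightarrow> u k l \<in> I \<and>
       H ` ({real k / real n .. real (Suc k) / real n} \<times> {real l / real n .. real (Suc l) / real n}) \<subseteq> T (u k l)"
proof -
  let ?sq = "{0..1} \<times> {0..1} :: (real \<times> real) set"
  have "\<forall>i\<in>I. \<exists>V. open V \<and> {z \<in> ?sq. H z \<in> T i} = ?sq \<inter> V"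
  proof
    fix i assume "i \<in> I"
    then have "openin (top_of_set ?sq) {z \<in> topspace (top_of_set ?sq). H z \<in> T i}"
      using openin_continuous_map_preimage[OF H op] by blast
    then show "\<exists>V. open V \<and> {z \<in> ?sq. H z \<in> T i} = ?sq \<inter> V"
      by (simp add: openin_open)
  qed
  then have "\<exists>V'. \<forall>i\<in>I. open (V' i) \<and> {z \<in> ?sq. H z \<in> T i} = ?sq \<inter> V' i"
    by (rule bchoice)
  then obtain V' where V': "\<And>i. i \<in> I \<Longrightarrow> open (V' i) \<and> {z \<in> ?sq. H z \<in> T i} = ?sq \<inter> V' i"
    by blast
  have "I \<noteq> {}"
    using cover[of "(0,0)"] by auto
  then have ne: "V' ` I \<noteq> {}"
    by blast
  have cpt: "compact ?sq"
    by (intro compact_Times) auto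
  have cov: "?sq \<subseteq> \<Union>(V' ` I)"
  proof
    fix z assume z: "z \<in> ?sq"
    with cover obtain i where i: "i \<in> I" "H z \<in> T i"
      by blast
    then have "z \<in> {z \<in> ?sq. H z \<in> T i}"
      using z by simp
    then have "z \<in> ?sq \<inter> V' i"
      using V'[OF i(1)] by simp
    then show "z \<in> \<Union>(V' ` I)"
      using i(1) by blast
  qed
  have opn: "\<And>B. B \<in> V' ` I \<Longrightarrow> open B"
    using V' by blast
  obtain \<delta> where \<delta>: "0 < \<delta>"
    "\<And>A. A \<subseteq> ?sq \<Longrightarrow> diameter A < \<delta> \<Longrightarrow> \<exists>B\<in>V' ` I. A \<subseteq> B"
    proof (rule Lebesgue_number_lemma[OF cpt ne cov])
    fix d assume "0 < d" "\<And>A. A \<subseteq> ?sq \<Longrightarrow> diameter A < d \<Longrightarrow> \<exists>B\<in>V' ` I. A \<subseteq> B"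
    then show thesis
      by (rule that)
  qed (rule opn)
  \<comment> \<open>The sides of a cell have length 1/n, so its diameter is at most the sum of two
    sides, 2/n.\<close>
  obtain n where n: "0 < n" "2 / real n < \<delta>"
  proof -
    obtain n :: nat where "2 / \<delta> < real n"
      using reals_Archimedean2 by blast
    moreover have "0 < 2 / \<delta>"
      using \<delta>(1) by simp
    ultimately have "0 < real n"
      by linarith
    with \<open>2 / \<delta> < real n\<close> have "0 < n" "2 / real n < \<delta>"
      using \<delta>(1) by (simp_all add: field_simps)
    then show thesis
      using that by blast
  qed
  have "\<exists>i. i \<in> I \<and> H ` ({real k / real n .. real (Suc k) / real n} \<times> {real l / real n .. real (Suc l) / real n}) \<subseteq> T i"
    if kl: "k < n" "l < n" for k l
  proof -
    let ?A = "{real k / real n .. real (Suc k) / real n} \<times> {real l / real n .. real (Suc l) / real n}"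
    have "real (Suc k) / real n \<le> 1" "real (Suc l) / real n \<le> 1"
      using kl by (auto simp: divide_simps)
    moreover have "0 \<le> real k / real n" "0 \<le> real l / real n"
      by auto
    ultimately have sub: "?A \<subseteq> ?sq"
      by (auto; linarith)
    have len: "real (Suc m) / real n = real m / real n + 1 / real n" for m
      by (simp add: add_divide_distrib)
    have "diameter ?A \<le> 2 / real n"
    proof (rule diameter_le)
      fix y z assume "y \<in> ?A" "z \<in> ?A"
      then have "\<bar>fst y - fst z\<bar> \<le> 1 / real n" "\<bar>snd y - snd z\<bar> \<le> 1 / real n"
        unfolding len by (auto simp: abs_le_iff)
      moreover have "norm (y - z) \<le> norm (fst (y - z)) + norm (snd (y - z))"
        by (metis norm_Pair_le prod.collapse)
      ultimately show "norm (y - z) \<le> 2 / real n"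
        by simp
    qed simp
    then obtain i where i: "i \<in> I" "?A \<subseteq> V' i"
      using \<delta>(2)[OF sub] n by force
    then have "H z \<in> T i" if "z \<in> ?A" for z
      using V'[OF i(1)] sub that by blast
    then show ?thesis
      using i(1) by blast
  qed
  then have "\<forall>k l. \<exists>i. k < n \<longrightarrow> l < n \<longrightarrow> i \<in> I \<and>
      H ` ({real k / real n .. real (Suc k) / real n} \<times> {real l / real n .. real (Suc l) / real n}) \<subseteq> T i"
    by blast
  then show thesis
    using that n(1) by metis
qed

context path_functor_chart
begin

text \<open>The transition elements form a cocycle not only for the cover \<open>S\<close> but for any cover \<open>T\<close>
  whose nerve is contained in the nerve of \<open>S\<close>, so a null-homotopy in \<open>N\<close> suffices.\<close>

lemma functor_trivial_if_null:
  assumes a: "pathin X a" "a 0 = x" "a 1 = x"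
    and T: "\<And>i. i \<in> I \<Longrightarrow> openin N (T i)" "topspace N \<subseteq> \<Union>(T ` I)"
    and nerve: "\<And>J y. finite J \<Longrightarrow> J \<subseteq> I \<Longrightarrow> J \<noteq> {} \<Longrightarrow> (\<And>j. j \<in> J \<Longrightarrow> y \<in> T j) \<Longrightarrow> (\<Inter>j\<in>J. S j) \<noteq> {}"
    and f: "\<And>z i. z \<in> topspace X \<Longrightarrow> i \<in> I \<Longrightarrow> f z \<in> T i \<Longrightarrow> z \<in> S i"
    and base: "\<And>i. i \<in> I \<Longrightarrow> f x \<in> T i \<Longrightarrow> i = i0"
    and null: "path_homotopic N (f \<circ> a) (\<lambda>t. f x)"
  shows "\<theta> a = \<one>"
proof -
  obtain H where H: "continuous_map (prod_topology (top_of_set {0..1::real}) (top_of_set {0..1::real})) N H"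
    "\<And>s. H (0, s) = f (a s)" "\<And>s. H (1, s) = f x"
    "\<And>t. t \<in> {0..1} \<Longrightarrow> H (t, 0) = f x \<and> H (t, 1) = f x"
    using null a unfolding path_homotopic_def homotopic_with_def by (auto simp: o_def)
  have H': "continuous_map (top_of_set ({0..1} \<times> {0..1})) N H"
    using H(1) by (simp add: subtopology_Times euclidean_product_topology)
  have "\<exists>i\<in>I. H z \<in> T i" if "z \<in> {0..1} \<times> {0..1}" for z
  proof -
    have "H z \<in> topspace N"
      using continuous_map_funspace[OF H'] that by auto
    then show ?thesis
      using T(2) by blast
  qed
  from square_grid[OF this T(1) H'] obtain n u where n: "0 < n"
    and u: "\<And>k l. k < n \<Longrightarrow> l < n \<Longrightarrow> u k l \<in> I \<and>
       H ` ({real k / real n .. real (Suc k) / real n} \<times> {real l / real n .. real (Suc l) / real n}) \<subseteq> T (u k l)"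
    by blast
  have corner: "H (s, t) \<in> T (u k l)"
    if "k < n" "l < n" "s \<in> {real k / real n .. real (Suc k) / real n}"
      "t \<in> {real l / real n .. real (Suc l) / real n}" for k l s t
    using u[OF that(1,2)] that(3,4) by blast
  have mem: "real k / real n \<in> {real k / real n .. real (Suc k) / real n}"
    "real (Suc k) / real n \<in> {real k / real n .. real (Suc k) / real n}" for k
    by (auto intro: divide_right_mono)
  have unit: "real k / real n \<in> {0..1}" if "k < n" for k
    using that by (auto simp: divide_simps)
  \<comment> \<open>The index k belongs to the homotopy parameter and l to the path parameter. On
    three sides of the square H is constantly \<open>f x\<close>, and by \<open>base\<close> the
    only set T i that can contain this point is the one with index i0.\<close>
  have left: "u k 0 = i0" if "k < n" for k
    using base[of "u k 0"] corner[OF that n mem(1)[of k], of 0] mem(1)[of 0] H(4)[OF unit[OF that]]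
      u[OF that n] by auto
  have right: "u k (n - 1) = i0" if "k < n" for k
  proof -
    have "1 \<in> {real (n - 1) / real n .. real (Suc (n - 1)) / real n}"
      using n by (simp add: divide_simps)
    then show ?thesis
      using base[of "u k (n - 1)"] corner[OF that _ mem(1)[of k], of "n - 1" 1] H(4)[OF unit[OF that]]
        u[OF that, of "n - 1"] n by auto
  qed
  have top: "u (n - 1) l = i0" if "l < n" for l
  proof -
    have "1 \<in> {real (n - 1) / real n .. real (Suc (n - 1)) / real n}"
      using n by (simp add: divide_simps)
    then show ?thesis
      using base[of "u (n - 1) l"] corner[OF _ that _ mem(1)[of l], of "n - 1" 1] H(3)
        u[OF _ that, of "n - 1"] n by auto
  qed
  have i0: "i0 \<in> I"
    using left[OF n] u[OF n n] by auto
  have x: "x \<in> S i0"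
  proof (rule f)
    show "x \<in> topspace X"
      using path_start_in_topspace[OF a(1)] a by simp
    show "f x \<in> T i0"
      using corner[OF n n mem(1)[of 0] mem(1)[of 0]] H(4)[of 0] left[OF n] by simp
  qed (fact i0)
  have row: "holonomy (u k) (n - 1) = holonomy (u (Suc k)) (n - 1)" if k: "Suc k < n" for k
  proof -
    have hk: "holonomy (u m) (n - 1) \<in> carrier Q" if m: "m < n" for m
    proof (rule holonomy_closed)
      show "u m l \<in> I" if "l \<le> n - 1" for l
        using u[OF m, of l] that n by auto
      show "S (u m l) \<inter> S (u m (Suc l)) \<noteq> {}" if "l < n - 1" for l
      proof -
        have l: "l < n" "Suc l < n"
          using that by auto
        have "(\<Inter>j\<in>{u m l, u m (Suc l)}. S j) \<noteq> {}"
          using u[OF m l(1)] u[OF m l(2)] corner[OF m l(1) mem(1) mem(2)] corner[OF m l(2) mem(1) mem(1)]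
          by (intro nerve[of _ "H (real m / real n, real (Suc l) / real n)"]) blast+
        then show ?thesis
          by simp
      qed
    qed
    have "holonomy (u k) (n - 1) \<otimes> transition (u k (n - 1)) (u (Suc k) (n - 1))
        = transition (u k 0) (u (Suc k) 0) \<otimes> holonomy (u (Suc k)) (n - 1)"
    proof (rule holonomy_rows)
      show "u k l \<in> I \<and> u (Suc k) l \<in> I" if "l \<le> n - 1" for l
        using u[of k l] u[of "Suc k" l] k that n by auto
      show "S (u k 0) \<inter> S (u (Suc k) 0) \<noteq> {}"
        using left k x by auto
      fix l assume l: "l < n - 1"
      \<comment> \<open>The four cells that meet at an interior grid point all contain it, so their
        sets T have a common point in N; \<open>nerve\<close> turns this into a common point of the
        four charts in X.\<close>
      let ?y = "H (real (Suc k) / real n, real (Suc l) / real n)"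
      have lt: "k < n" "Suc k < n" "l < n" "Suc l < n"
        using k l by auto
      have "?y \<in> T (u k l)" "?y \<in> T (u k (Suc l))" "?y \<in> T (u (Suc k) l)" "?y \<in> T (u (Suc k) (Suc l))"
        by (intro corner lt mem)+
      then have "(\<Inter>j\<in>{u k l, u k (Suc l), u (Suc k) l, u (Suc k) (Suc l)}. S j) \<noteq> {}"
        using u[OF lt(1,3)] u[OF lt(1,4)] u[OF lt(2,3)] u[OF lt(2,4)]
        by (intro nerve[of _ ?y]) blast+
      then show "S (u k l) \<inter> S (u k (Suc l)) \<inter> S (u (Suc k) l) \<inter> S (u (Suc k) (Suc l)) \<noteq> {}"
        by (simp add: Int_assoc)
    qed
    moreover have "transition i0 i0 = \<one>"
      using x i0 by (simp add: transition_eq p_closed)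
    ultimately show ?thesis
      using left[of k] left[of "Suc k"] right[of k] right[of "Suc k"] k hk by simp
  qed
  have rows: "holonomy (u 0) (n - 1) = holonomy (u k) (n - 1)" if "k < n" for k
    using that by (induction k) (use row in auto)
  \<comment> \<open>The last row borders on the side where the homotopy has become constant, so it
    uses the chart i0 throughout. Equality of consecutive rows carries the trivial holonomy down to
    row 0.\<close>
  have "holonomy (u (n - 1)) (n - 1) = \<one>"
    using top n x i0 by (intro holonomy_const[of _ _ i0]) auto
  then have h: "holonomy (u 0) (n - 1) = \<one>"
    using rows[of "n - 1"] n by simp
  \<comment> \<open>Row 0 contains the side where H is \<open>f \<circ> a\<close>. By the hypothesis
    on f its chain of charts also covers the pieces of \<open>a\<close> itself, so its holonomy
    computes \<open>\<theta> a\<close>.\<close>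
  have "\<theta> a = inv (p (u 0 0) (a 0)) \<otimes> holonomy (u 0) (n - 1) \<otimes> p (u 0 (n - 1)) (a 1)"
  proof (rule functor_eq_holonomy[OF a(1) n])
    fix l assume l: "l < n"
    have "a t \<in> S (u 0 l)" if t: "t \<in> {real l / real n .. real (Suc l) / real n}" for t
    proof (rule f)
      have 0: "0 \<le> real l / real n" and 1: "real (Suc l) / real n \<le> 1"
        using l by (auto simp: divide_simps)
      have "t \<in> {0..1}"
        using t order_trans[OF 0, of t] order_trans[OF _ 1, of t] by simp
      then show "a t \<in> topspace X"
        using path_image_subset_topspace[OF a(1)] by blast
      show "f (a t) \<in> T (u 0 l)"
        using corner[OF n l mem(1)[of 0] t] H(2) by simp
    qed (use u[OF n l] in auto)
    then show "u 0 l \<in> I \<and> a ` {real l / real n..real (Suc l) / real n} \<subseteq> S (u 0 l)"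
      using u[OF n l] by blast
  qed
  then show ?thesis
    using h left[OF n] right[OF n] a x i0 p_closed by simp
qed

end

section \<open>The topology of nerves\<close>

abbreviation nerve_support :: "('a set \<Rightarrow> real) \<Rightarrow> 'a set set" where
  "nerve_support t \<equiv> {U. t U \<noteq> 0}"

lemma nerve_simplices_face:
  assumes "\<sigma> \<in> nerve_simplices \<U>" "\<tau> \<subseteq> \<sigma>" "\<tau> \<noteq> {}"
  shows "\<tau> \<in> nerve_simplices \<U>"
proof -
  note assms
  moreover have "\<Inter>\<sigma> \<subseteq> \<Inter>\<tau>"
    using \<open>\<tau> \<subseteq> \<sigma>\<close> by blast
  ultimately show ?thesis
    unfolding nerve_simplices_def using finite_subset by blast
qed

lemma simplex_pointsI:
  assumes "\<And>U. 0 \<le> t U" "nerve_support t \<subseteq> \<sigma>" "finite \<sigma>" "sum t (nerve_support t) = 1"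
  shows "t \<in> simplex_points \<sigma>"
proof -
  have "sum t (nerve_support t) = sum t \<sigma>"
    by (rule sum.mono_neutral_left) (use assms in blast)+
  then show ?thesis
    using assms(1,2,4) by (auto simp: simplex_points_def)
qed

lemma simplex_points_support:
  assumes "t \<in> simplex_points \<sigma>" "finite \<sigma>"
  shows "nerve_support t \<subseteq> \<sigma>" "sum t (nerve_support t) = 1" "nerve_support t \<noteq> {}"
proof -
  show *: "nerve_support t \<subseteq> \<sigma>"
    using assms by (auto simp: simplex_points_def)
  have "sum t (nerve_support t) = sum t \<sigma>"
    by (rule sum.mono_neutral_left) (use * assms(2) in blast)+
  then show "sum t (nerve_support t) = 1"
    using assms(1) by (simp add: simplex_points_def)
  then show "nerve_support t \<noteq> {}"
    by (metis sum.empty zero_neq_one)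
qed

lemma nerve_points_iff:
  "t \<in> nerve_points \<U> \<longleftrightarrow>
     (\<forall>U. 0 \<le> t U) \<and> nerve_support t \<in> nerve_simplices \<U> \<and> sum t (nerve_support t) = 1"
proof
  assume "t \<in> nerve_points \<U>"
  then obtain \<sigma> where \<sigma>: "\<sigma> \<in> nerve_simplices \<U>" "t \<in> simplex_points \<sigma>"
    by (auto simp: nerve_points_def)
  then have "finite \<sigma>"
    by (simp add: nerve_simplices_def)
  note * = simplex_points_support[OF \<sigma>(2) this]
  then show "(\<forall>U. 0 \<le> t U) \<and> nerve_support t \<in> nerve_simplices \<U> \<and> sum t (nerve_support t) = 1"
    using \<sigma>(2) *(2) nerve_simplices_face[OF \<sigma>(1) *(1,3)] by (simp add: simplex_points_def)
next
  assume t: "(\<forall>U. 0 \<le> t U) \<and> nerve_support t \<in> nerve_simplices \<U> \<and> sum t (nerve_support t) = 1"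
  then have "finite (nerve_support t)"
    by (simp add: nerve_simplices_def)
  with t have "t \<in> simplex_points (nerve_support t)"
    by (intro simplex_pointsI) blast+
  with t show "t \<in> nerve_points \<U>"
    unfolding nerve_points_def by blast
qed

lemma simplex_points_subset: "\<sigma> \<in> nerve_simplices \<U> \<Longrightarrow> simplex_points \<sigma> \<subseteq> nerve_points \<U>"
  by (auto simp: nerve_points_def)

lemma topspace_nerve [simp]: "topspace (nerve \<U>) = nerve_points \<U>"
proof
  have "openin (nerve \<U>) (nerve_points \<U>)"
    unfolding openin_nerve
  proof (intro conjI ballI order_refl)
    fix \<sigma> assume "\<sigma> \<in> nerve_simplices \<U>"
    then have "nerve_points \<U> \<inter> simplex_points \<sigma> = simplex_points \<sigma>"
      using simplex_points_subset by blast
    then show "openin (subtopology (powertop_real UNIV) (simplex_points \<sigma>)) (nerve_points \<U> \<inter> simplex_points \<sigma>)"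
      by (simp add: openin_subtopology_refl)
  qed
  then show "nerve_points \<U> \<subseteq> topspace (nerve \<U>)"
    by (rule openin_subset)
  show "topspace (nerve \<U>) \<subseteq> nerve_points \<U>"
    using openin_topspace[of "nerve \<U>"] unfolding openin_nerve by blast
qed

lemma continuous_map_coordinate: "continuous_map (powertop_real UNIV) euclideanreal (\<lambda>t. t U)"
  by (rule continuous_map_product_projection) simp

text \<open>All conditions are closed conditions on coordinates; finiteness of \<sigma> makes the
  sum condition one of them.\<close>

lemma closedin_simplex_points:
  assumes "finite \<sigma>"
  shows "closedin (powertop_real UNIV) (simplex_points \<sigma>)"
proof -
  have "closedin (powertop_real UNIV) {t \<in> topspace (powertop_real UNIV). t U \<in> C}"
    if "closed C" for U :: "'a set" and C
    using closedin_continuous_map_preimage[OF continuous_map_coordinate] that by simp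
  from this[OF closed_atLeast[of 0]] this[OF closed_singleton[of 0]]
  have 1: "closedin (powertop_real UNIV) (if U \<in> \<sigma> then {t. 0 \<le> t U} else {t. t U = 0})" for U
    by simp
  have "continuous_map (powertop_real UNIV) euclideanreal (\<lambda>t. sum t \<sigma>)"
    using assms by (intro continuous_map_sum continuous_map_coordinate)
  from closedin_continuous_map_preimage[OF this, of "{1}"]
  have 2: "closedin (powertop_real UNIV) {t. sum t \<sigma> = 1}"
    by simp
  have "t \<in> simplex_points \<sigma> \<longleftrightarrow>
      t \<in> (\<Inter>U. if U \<in> \<sigma> then {t. 0 \<le> t U} else {t. t U = 0}) \<inter> {t. sum t \<sigma> = 1}" for t
  proof -
    have "(0 \<le> t U \<and> (U \<notin> \<sigma> \<longrightarrow> t U = 0)) = (t \<in> (if U \<in> \<sigma> then {t. 0 \<le> t U} else {t. t U = 0}))" for U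
      by auto
    then show ?thesis
      unfolding simplex_points_def by blast
  qed
  then have "simplex_points \<sigma> =
      (\<Inter>U. if U \<in> \<sigma> then {t. 0 \<le> t U} else {t. t U = 0}) \<inter> {t. sum t \<sigma> = 1}"
    by blast
  then show ?thesis
    using 1 2 by (simp only:) (intro closedin_Int closedin_INT, auto)
qed

text \<open>The weak topology is at least as fine as that of coordinatewise convergence, so the
  coordinates are continuous on the nerve.\<close>

lemma continuous_map_nerve_id: "continuous_map (nerve \<U>) (powertop_real UNIV) (\<lambda>t. t)"
proof (unfold continuous_map_openin_preimage_eq, intro conjI allI impI)
  fix T assume T: "openin (powertop_real (UNIV :: 'a set set)) T"
  show "openin (nerve \<U>) (topspace (nerve \<U>) \<inter> (\<lambda>t. t) -` T)"
    unfolding openin_nerve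
  proof (intro conjI ballI)
    fix \<sigma> assume "\<sigma> \<in> nerve_simplices \<U>"
    then have "topspace (nerve \<U>) \<inter> (\<lambda>t. t) -` T \<inter> simplex_points \<sigma> = T \<inter> simplex_points \<sigma>"
      using simplex_points_subset by auto
    then show "openin (subtopology (powertop_real UNIV) (simplex_points \<sigma>))
        (topspace (nerve \<U>) \<inter> (\<lambda>t. t) -` T \<inter> simplex_points \<sigma>)"
      using T by (auto simp: openin_subtopology)
  qed auto
qed auto

lemma continuous_map_nerve_coordinate:
  "continuous_map Z (nerve \<U>) f \<Longrightarrow> continuous_map Z euclideanreal (\<lambda>z. f z U)"
  using continuous_map_compose[OF continuous_map_compose[OF _ continuous_map_nerve_id] continuous_map_coordinate]
  by (fastforce simp: o_def)

text \<open>On a finite subcomplex the weak topology agrees with the topology of coordinatewise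
  convergence, as it is a finite union of closed simplices.\<close>

lemma continuous_map_into_nerve:
  assumes f: "\<And>z. z \<in> topspace Z \<Longrightarrow> f z \<in> nerve_points \<U>"
    and coord: "\<And>U. continuous_map Z euclideanreal (\<lambda>z. f z U)"
    and fin: "\<And>z. z \<in> topspace Z \<Longrightarrow>
      \<exists>W F. openin Z W \<and> z \<in> W \<and> finite F \<and> (\<forall>w\<in>W. nerve_support (f w) \<subseteq> F)"
  shows "continuous_map Z (nerve \<U>) f"
proof -
  have fP: "continuous_map Z (powertop_real UNIV) f"
    using coord by (simp add: continuous_map_componentwise_UNIV)
  have "openin Z {z \<in> topspace Z. f z \<in> A}" if A: "openin (nerve \<U>) A" for A
  proof (subst openin_subopen, intro ballI)
    fix z assume z: "z \<in> {z \<in> topspace Z. f z \<in> A}"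
    then have "z \<in> topspace Z"
      by simp
    from fin[OF this] obtain W F
      where W': "openin Z W \<and> z \<in> W \<and> finite F \<and> (\<forall>w\<in>W. nerve_support (f w) \<subseteq> F)"
      by (elim exE)
    then have W: "openin Z W" "z \<in> W" "finite F" "\<And>w. w \<in> W \<Longrightarrow> nerve_support (f w) \<subseteq> F"
      by simp_all
    \<comment> \<open>D collects the points outside A in the simplices spanned by vertices from F.
      There are finitely many such simplices, so D is closed for coordinatewise convergence, and on
      W avoiding D is the same as lying in A.\<close>
    define D where "D = (\<Union>\<sigma>\<in>Pow F \<inter> nerve_simplices \<U>. simplex_points \<sigma> - A)"
    have "closedin (powertop_real UNIV) D"
      unfolding D_def
    proof (rule closedin_Union)
      show "finite ((\<lambda>\<sigma>. simplex_points \<sigma> - A) ` (Pow F \<inter> nerve_simplices \<U>))"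
        using W(3) by simp
      fix B assume "B \<in> (\<lambda>\<sigma>. simplex_points \<sigma> - A) ` (Pow F \<inter> nerve_simplices \<U>)"
      then obtain \<sigma> where \<sigma>: "\<sigma> \<in> nerve_simplices \<U>" "B = simplex_points \<sigma> - A"
        by blast
      then have cl: "closedin (powertop_real UNIV) (simplex_points \<sigma>)"
        by (intro closedin_simplex_points) (simp add: nerve_simplices_def)
      obtain T where T: "openin (powertop_real UNIV) T" "A \<inter> simplex_points \<sigma> = T \<inter> simplex_points \<sigma>"
        using A \<sigma> by (auto simp: openin_nerve openin_subtopology)
      then have "B = simplex_points \<sigma> - T"
        using \<sigma> by blast
      then show "closedin (powertop_real UNIV) B"
        using cl T(1) by (simp add: closedin_diff)
    qed
    then have "openin (powertop_real UNIV) (topspace (powertop_real UNIV) - D)"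
      by blast
    from openin_continuous_map_preimage[OF fP this]
    have op: "openin Z (W \<inter> {w \<in> topspace Z. f w \<in> topspace (powertop_real UNIV) - D})"
      using W(1) by blast
    have eq: "f w \<in> D \<longleftrightarrow> f w \<notin> A" if "w \<in> W" for w
    proof -
      have "w \<in> topspace Z"
        using W(1) that openin_subset by blast
      then have fw: "f w \<in> nerve_points \<U>"
        by (rule f)
      then have "nerve_support (f w) \<in> Pow F \<inter> nerve_simplices \<U>"
        using W(4)[OF that] unfolding nerve_points_iff by blast
      moreover from this have "finite (nerve_support (f w))"
        using W(3) finite_subset by blast
      then have "f w \<in> simplex_points (nerve_support (f w))"
        using fw by (intro simplex_pointsI) (auto simp: nerve_points_iff)
      ultimately show ?thesis
        unfolding D_def by blast
    qed
    show "\<exists>T. openin Z T \<and> z \<in> T \<and> T \<subseteq> {z \<in> topspace Z. f z \<in> A}"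
      using op eq z W(2) by (intro exI[of _ "W \<inter> {w \<in> topspace Z. f w \<in> topspace (powertop_real UNIV) - D}"]) auto
  qed
  then show ?thesis
    using f by (auto simp: continuous_map_def)
qed

text \<open>For each vertex occurring in a support, choose a point of K that has it in its support.
  The set P of chosen points meets every simplex in a finite set, so every subset of P is closed in
  the weak topology. A closed discrete subset of a compact set is finite, and finitely many points
  of the nerve use finitely many vertices.\<close>

lemma finite_support_compactin:
  assumes K: "compactin (nerve \<U>) K"
  shows "finite (\<Union>t\<in>K. nerve_support t)"
proof -
  let ?V = "\<Union>t\<in>K. nerve_support t"
  have "\<forall>U\<in>?V. \<exists>t. t \<in> K \<and> t U \<noteq> 0"
    by blast
  then obtain s where s: "\<And>U. U \<in> ?V \<Longrightarrow> s U \<in> K \<and> s U U \<noteq> 0"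
    by metis
  have KP: "K \<subseteq> nerve_points \<U>"
    using compactin_subset_topspace[OF K] by simp
  define P where "P = s ` ?V"
  have PK: "P \<subseteq> K"
    using s by (auto simp: P_def)
  have closed: "openin (nerve \<U>) (nerve_points \<U> - R)" if R: "R \<subseteq> P" for R
    unfolding openin_nerve
  proof (intro conjI ballI)
    fix \<sigma> assume \<sigma>: "\<sigma> \<in> nerve_simplices \<U>"
    then have fin: "finite \<sigma>"
      by (simp add: nerve_simplices_def)
    have "P \<inter> simplex_points \<sigma> \<subseteq> s ` \<sigma>"
    proof
      fix t assume t: "t \<in> P \<inter> simplex_points \<sigma>"
      then obtain U where "U \<in> ?V" "t = s U"
        by (auto simp: P_def)
      then show "t \<in> s ` \<sigma>"
        using simplex_points_support(1)[of t \<sigma>] fin t s by blast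
    qed
    then have "finite (R \<inter> simplex_points \<sigma>)"
      using R fin by (meson Int_mono finite_imageI finite_subset order_refl)
    moreover have "t1_space (powertop_real (UNIV :: 'a set set))"
      by (simp add: t1_space_product_topology Hausdorff_imp_t1_space)
    ultimately have "openin (powertop_real UNIV) (UNIV - (R \<inter> simplex_points \<sigma>))"
      using t1_space_closedin_finite[of "powertop_real (UNIV :: 'a set set)"] by (auto simp: closedin_def)
    moreover have "(nerve_points \<U> - R) \<inter> simplex_points \<sigma> = (UNIV - (R \<inter> simplex_points \<sigma>)) \<inter> simplex_points \<sigma>"
      using simplex_points_subset[OF \<sigma>] by blast
    ultimately show "openin (subtopology (powertop_real UNIV) (simplex_points \<sigma>)) ((nerve_points \<U> - R) \<inter> simplex_points \<sigma>)"
      by (auto simp: openin_subtopology)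
  qed auto
  \<comment> \<open>The open set \<open>B q\<close> contains no point of P other than q, so a finite
    subcover of K bounds the number of points of P.\<close>
  define B where "B = (\<lambda>q. nerve_points \<U> - (P - {q}))"
  have "finite P"
  proof (cases "P = {}")
    case False
    have "\<exists>\<F>. finite \<F> \<and> \<F> \<subseteq> B ` P \<and> K \<subseteq> \<Union>\<F>"
    proof (rule compactinD[OF K])
      show "openin (nerve \<U>) A" if "A \<in> B ` P" for A
        using that by (auto simp: B_def intro!: closed)
      show "K \<subseteq> \<Union>(B ` P)"
        using KP False by (auto simp: B_def)
    qed
    then obtain Q where Q: "finite Q" "Q \<subseteq> P" "K \<subseteq> \<Union>(B ` Q)"
      by (metis finite_subset_image)
    have "P \<subseteq> Q"
    proof
      fix y assume y: "y \<in> P"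
      then obtain q where "q \<in> Q" "y \<in> B q"
        using Q(3) PK by blast
      then show "y \<in> Q"
        using y by (auto simp: B_def)
    qed
    then show ?thesis
      using Q(1) finite_subset by blast
  qed simp
  moreover have "?V \<subseteq> \<Union>(nerve_support ` P)"
    using s unfolding P_def by blast
  moreover have "finite (nerve_support t)" if "t \<in> P" for t
    using that PK KP by (auto simp: nerve_points_iff nerve_simplices_def)
  ultimately show ?thesis
    by (meson finite_UN_I finite_subset)
qed

section \<open>Open stars, straight segments and cones in the nerve\<close>

definition nerve_star :: "'a set set \<Rightarrow> 'a set \<Rightarrow> ('a set \<Rightarrow> real) set" where
  "nerve_star \<U> U = {t \<in> nerve_points \<U>. 0 < t U}"

lemma nerve_star_eq: "nerve_star \<U> U = {t \<in> nerve_points \<U>. U \<in> nerve_support t}"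
  unfolding nerve_star_def nerve_points_iff by (auto simp: less_le)

lemma openin_nerve_star: "openin (nerve \<U>) (nerve_star \<U> U)"
proof -
  have "continuous_map (nerve \<U>) euclideanreal (\<lambda>t. t U)"
    by (rule continuous_map_nerve_coordinate[of _ \<U>]) simp
  from openin_continuous_map_preimage[OF this, of "{0<..}"] show ?thesis
    by (simp add: nerve_star_def)
qed

lemma nerve_star_cover:
  assumes "t \<in> nerve_points \<U>"
  obtains U where "U \<in> \<U>" "t \<in> nerve_star \<U> U"
  using assms unfolding nerve_star_eq by (auto simp: nerve_points_iff nerve_simplices_def)

lemma nerve_support_vertex [simp]: "nerve_support (nerve_vertex U) = {U}"
  by (auto simp: nerve_vertex_def)

lemma nerve_vertex_in: "U \<in> \<U> \<Longrightarrow> U \<noteq> {} \<Longrightarrow> nerve_vertex U \<in> nerve_points \<U>"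
  unfolding nerve_points_iff nerve_support_vertex by (auto simp: nerve_vertex_def nerve_simplices_def)

definition nerve_line :: "('a set \<Rightarrow> real) \<Rightarrow> ('a set \<Rightarrow> real) \<Rightarrow> real \<Rightarrow> 'a set \<Rightarrow> real" where
  "nerve_line v w t = (\<lambda>U. (1 - t) * v U + t * w U)"

lemma nerve_line_0 [simp]: "nerve_line v w 0 = v"
  and nerve_line_1 [simp]: "nerve_line v w 1 = w"
  by (auto simp: nerve_line_def)

lemma nerve_line_reverse: "nerve_line w v = (\<lambda>t. nerve_line v w (1 - t))"
  by (auto simp: nerve_line_def algebra_simps fun_eq_iff)

lemma nerve_line_support: "nerve_support (nerve_line v w t) \<subseteq> nerve_support v \<union> nerve_support w"
  by (auto simp: nerve_line_def)

lemma nerve_line_in: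
  assumes "v \<in> nerve_points \<U>" "w \<in> nerve_points \<U>"
    "nerve_support v \<union> nerve_support w \<in> nerve_simplices \<U>" "t \<in> {0..1}"
  shows "nerve_line v w t \<in> nerve_points \<U>"
proof -
  let ?\<sigma> = "nerve_support v \<union> nerve_support w"
  have fin: "finite ?\<sigma>"
    using assms(3) by (simp add: nerve_simplices_def)
  have "v \<in> simplex_points ?\<sigma>" "w \<in> simplex_points ?\<sigma>"
    using assms(1,2) fin by (auto simp: nerve_points_iff intro!: simplex_pointsI)
  then have "nerve_line v w t \<in> simplex_points ?\<sigma>"
    using assms(4) unfolding simplex_points_def nerve_line_def
    by (auto simp: sum.distrib simp flip: sum_distrib_left)
  then show ?thesis
    using simplex_points_subset[OF assms(3)] by blast
qed

text \<open>The simplex containing both \<open>a s\<close> and w may vary with s. Since the path has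
  compact image, all supports that occur lie in one finite set of vertices, and on such a set
  continuity can be checked coordinatewise.\<close>

lemma continuous_map_nerve_cone:
  assumes a: "pathin (nerve \<U>) a" and w: "w \<in> nerve_points \<U>"
    and simplex: "\<And>s. s \<in> {0..1} \<Longrightarrow> nerve_support (a s) \<union> nerve_support w \<in> nerve_simplices \<U>"
  shows "continuous_map (top_of_set ({0..1} \<times> {0..1})) (nerve \<U>) (\<lambda>(s, t). nerve_line (a s) w t)"
proof (rule continuous_map_into_nerve)
  fix z :: "real \<times> real" assume z: "z \<in> topspace (top_of_set ({0..1} \<times> {0..1}))"
  then show "(case z of (s, t) \<Rightarrow> nerve_line (a s) w t) \<in> nerve_points \<U>"
    using w simplex path_image_subset_topspace[OF a] by (auto intro!: nerve_line_in)
  have "compactin (nerve \<U>) (a ` {0..1})"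
    using a unfolding pathin_def by (intro image_compactin[of "top_of_set {0..1}"]) (auto simp: compactin_subtopology)
  from finite_support_compactin[OF this]
  have "finite ((\<Union>t\<in>a ` {0..1}. nerve_support t) \<union> nerve_support w)"
    by (rule finite_UnI) (use w in \<open>simp add: nerve_points_iff nerve_simplices_def\<close>)
  moreover have "nerve_support (case z of (s, t) \<Rightarrow> nerve_line (a s) w t)
      \<subseteq> (\<Union>t\<in>a ` {0..1}. nerve_support t) \<union> nerve_support w"
    if "z \<in> {0..1} \<times> {0..1}" for z :: "real \<times> real"
    using that nerve_line_support[of "a (fst z)" w "snd z"] by (auto simp: split_def)
  ultimately show "\<exists>W F. openin (top_of_set ({0..1} \<times> {0..1})) W \<and> z \<in> W \<and> finite F \<and>
      (\<forall>w'\<in>W. nerve_support (case w' of (s, t) \<Rightarrow> nerve_line (a s) w t) \<subseteq> F)"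
    using z by (intro exI[of _ "{0..1} \<times> {0..1}"] exI[of _ "(\<Union>t\<in>a ` {0..1}. nerve_support t) \<union> nerve_support w"]) auto
next
  fix U
  have "continuous_on {0..1} (\<lambda>s. a s U)"
    using continuous_map_nerve_coordinate[OF a[unfolded pathin_def]] by (simp add: continuous_map_iff_continuous)
  then have "continuous_on ({0..1} \<times> {0..1}) (\<lambda>z::real \<times> real. a (fst z) U)"
    by (rule continuous_on_compose2) (auto intro!: continuous_intros)
  then have "continuous_on ({0..1} \<times> {0..1}) (\<lambda>z::real \<times> real. (1 - snd z) * a (fst z) U + snd z * w U)"
    by (intro continuous_intros)
  then show "continuous_map (top_of_set ({0..1} \<times> {0..1})) euclideanreal
      (\<lambda>z. (case z of (s, t) \<Rightarrow> nerve_line (a s) w t) U)"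
    by (simp add: split_def nerve_line_def continuous_map_iff_continuous)
qed

lemma pathin_nerve_line:
  assumes "v \<in> nerve_points \<U>" "w \<in> nerve_points \<U>"
    "nerve_support v \<union> nerve_support w \<in> nerve_simplices \<U>"
  shows "pathin (nerve \<U>) (nerve_line v w)"
proof -
  have "continuous_map (top_of_set ({0..1} \<times> {0..1})) (nerve \<U>) (\<lambda>(s::real, t). nerve_line v w t)"
    using continuous_map_nerve_cone[of \<U> "\<lambda>s. v" w] assms by simp
  moreover have "continuous_map (top_of_set {0..1}) (top_of_set ({0..1} \<times> {0..1})) (\<lambda>t. (0::real, t::real))"
    unfolding continuous_map_subtopology_eu by (auto intro!: continuous_intros)
  ultimately have "continuous_map (top_of_set {0..1}) (nerve \<U>) ((\<lambda>(s::real, t). nerve_line v w t) \<circ> (\<lambda>t. (0, t)))"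
    by (rule continuous_map_compose[rotated])
  then show ?thesis
    by (simp add: pathin_def o_def)
qed

lemma star_union_vertex_simplex:
  "t \<in> nerve_star \<U> U \<Longrightarrow> nerve_support t \<union> nerve_support (nerve_vertex U) \<in> nerve_simplices \<U>"
  unfolding nerve_support_vertex nerve_star_eq by (auto simp: nerve_points_iff insert_absorb)

lemma nerve_star_vertex_in: "t \<in> nerve_star \<U> U \<Longrightarrow> nerve_vertex U \<in> nerve_points \<U>"
  unfolding nerve_star_eq by (auto simp: nerve_points_iff[of t] nerve_simplices_def intro!: nerve_vertex_in)

text \<open>This is the relation between the sides of a square, applied to the cone from the path to
  w; the side at the apex is constant and contributes nothing.\<close>

lemma path_functor_nerve_cone:
  assumes "path_functor Q (nerve \<U>) \<theta>"
    and a: "pathin (nerve \<U>) a" and w: "w \<in> nerve_points \<U>"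
    and simplex: "\<And>s. s \<in> {0..1} \<Longrightarrow> nerve_support (a s) \<union> nerve_support w \<in> nerve_simplices \<U>"
  shows "\<theta> a = \<theta> (nerve_line (a 0) w) \<otimes>\<^bsub>Q\<^esub> inv\<^bsub>Q\<^esub> \<theta> (nerve_line (a 1) w)"
proof -
  interpret path_functor Q "nerve \<U>" \<theta>
    by fact
  have "a 0 \<in> nerve_points \<U>" "a 1 \<in> nerve_points \<U>"
    using path_start_in_topspace[OF a] path_finish_in_topspace[OF a] by auto
  then have l: "pathin (nerve \<U>) (nerve_line (a 0) w)" "pathin (nerve \<U>) (nerve_line (a 1) w)"
    using w simplex by (auto intro!: pathin_nerve_line)
  have "\<theta> (\<lambda>s. a s) \<otimes>\<^bsub>Q\<^esub> \<theta> (nerve_line (a 1) w) = \<theta> (nerve_line (a 0) w) \<otimes>\<^bsub>Q\<^esub> \<theta> (\<lambda>s. w)"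
    using square[OF continuous_map_nerve_cone[OF a w simplex]] by simp
  moreover have "\<theta> (\<lambda>s. w) = \<one>\<^bsub>Q\<^esub>"
    using w by (intro const) auto
  ultimately show ?thesis
    using closed[OF l(1)] closed[OF l(2)] closed[OF a] Q.inv_solve_right by simp
qed

text \<open>The potential of w in the star of U is \<theta> of the segment from the vertex U to w. A
  path in that star is coned to the vertex. For a point w in two stars, coning the edge from U to V
  to the apex w shows that the jump of the potential is \<theta> of the edge, whatever w is.\<close>

lemma path_functor_chart_nerve:
  assumes "path_functor Q (nerve \<U>) \<theta>"
  shows "path_functor_chart Q (nerve \<U>) \<theta> \<U> (nerve_star \<U>) (\<lambda>U w. \<theta> (nerve_line (nerve_vertex U) w))"
proof -
  interpret path_functor Q "nerve \<U>" \<theta>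
    by fact
  note cone = path_functor_nerve_cone[OF assms]
  have line: "pathin (nerve \<U>) (nerve_line (nerve_vertex U) w)" "pathin (nerve \<U>) (nerve_line w (nerve_vertex U))"
    if "w \<in> nerve_star \<U> U" for U w
    using that star_union_vertex_simplex[OF that] nerve_star_vertex_in[OF that]
    by (auto intro!: pathin_nerve_line simp: nerve_star_def Un_commute)
  have rev: "\<theta> (nerve_line w (nerve_vertex U)) = inv\<^bsub>Q\<^esub> \<theta> (nerve_line (nerve_vertex U) w)"
    if "w \<in> nerve_star \<U> U" for U w
    unfolding nerve_line_reverse[of w] by (rule reverse) (rule line[OF that])
  have edge: "\<theta> (nerve_line (nerve_vertex U) w) \<otimes>\<^bsub>Q\<^esub> inv\<^bsub>Q\<^esub> \<theta> (nerve_line (nerve_vertex V) w)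
      = \<theta> (nerve_line (nerve_vertex U) (nerve_vertex V))"
    if "w \<in> nerve_star \<U> U" "w \<in> nerve_star \<U> V" for U V w
  proof -
    have wP: "w \<in> nerve_points \<U>" and sub: "nerve_support w \<in> nerve_simplices \<U>" "U \<in> nerve_support w" "V \<in> nerve_support w"
      using that by (auto simp: nerve_star_eq nerve_points_iff)
    have "{U, V} \<in> nerve_simplices \<U>"
      by (rule nerve_simplices_face[OF sub(1)]) (use sub in auto)
    then have p: "pathin (nerve \<U>) (nerve_line (nerve_vertex U) (nerve_vertex V))"
      using nerve_star_vertex_in that by (intro pathin_nerve_line) (auto simp: insert_commute)
    \<comment> \<open>Both U and V are in the support of w, so the edge and its cone stay in the
      simplex carrying w.\<close>
    have "nerve_support (nerve_line (nerve_vertex U) (nerve_vertex V) s) \<union> nerve_support w = nerve_support w" for s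
      using nerve_line_support[of "nerve_vertex U" "nerve_vertex V" s] sub unfolding nerve_support_vertex by blast
    then show ?thesis
      using cone[OF p wP] sub by simp
  qed
  show ?thesis
  proof
    fix U w assume "U \<in> \<U>" "w \<in> nerve_star \<U> U"
    then show "\<theta> (nerve_line (nerve_vertex U) w) \<in> carrier Q"
      using closed line by blast
  next
    fix U a assume "U \<in> \<U>" and a: "pathin (nerve \<U>) a" "a ` {0..1} \<subseteq> nerve_star \<U> U"
    have s: "a s \<in> nerve_star \<U> U" if "s \<in> {0..1}" for s
      using a(2) that by blast
    have "\<theta> a = \<theta> (nerve_line (a 0) (nerve_vertex U)) \<otimes>\<^bsub>Q\<^esub> inv\<^bsub>Q\<^esub> \<theta> (nerve_line (a 1) (nerve_vertex U))"
      using s by (intro cone a star_union_vertex_simplex nerve_star_vertex_in[of "a 0"]) auto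
    moreover have "a 0 \<in> nerve_star \<U> U" "a 1 \<in> nerve_star \<U> U"
      using s by auto
    ultimately show "\<theta> a = inv\<^bsub>Q\<^esub> \<theta> (nerve_line (nerve_vertex U) (a 0)) \<otimes>\<^bsub>Q\<^esub> \<theta> (nerve_line (nerve_vertex U) (a 1))"
      using rev closed line by simp
  next
    fix U V w w' assume "w \<in> nerve_star \<U> U \<inter> nerve_star \<U> V" "w' \<in> nerve_star \<U> U \<inter> nerve_star \<U> V"
    then show "\<theta> (nerve_line (nerve_vertex U) w) \<otimes>\<^bsub>Q\<^esub> inv\<^bsub>Q\<^esub> \<theta> (nerve_line (nerve_vertex V) w) =
        \<theta> (nerve_line (nerve_vertex U) w') \<otimes>\<^bsub>Q\<^esub> inv\<^bsub>Q\<^esub> \<theta> (nerve_line (nerve_vertex V) w')"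
      using edge by simp
  qed
qed

section \<open>Maps between nerves and into nerves\<close>

text \<open>The weak topology is the final one for the closed simplices, so continuity on each of
  them is enough.\<close>

lemma continuous_map_from_nerve:
  assumes "\<And>\<sigma>. \<sigma> \<in> nerve_simplices \<U> \<Longrightarrow>
    continuous_map (subtopology (powertop_real UNIV) (simplex_points \<sigma>)) Z g"
  shows "continuous_map (nerve \<U>) Z g"
proof -
  have g: "g t \<in> topspace Z" if "t \<in> nerve_points \<U>" for t
  proof -
    obtain \<sigma> where "\<sigma> \<in> nerve_simplices \<U>" "t \<in> simplex_points \<sigma>"
      using \<open>t \<in> nerve_points \<U>\<close> by (auto simp: nerve_points_def)
    then show ?thesis
      using continuous_map_funspace[OF assms] by fastforce
  qed
  have "openin (nerve \<U>) {t \<in> nerve_points \<U>. g t \<in> A}" if A: "openin Z A" for A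
    unfolding openin_nerve
  proof (intro conjI ballI)
    fix \<sigma> assume \<sigma>: "\<sigma> \<in> nerve_simplices \<U>"
    have "{t \<in> nerve_points \<U>. g t \<in> A} \<inter> simplex_points \<sigma> =
        {t \<in> topspace (subtopology (powertop_real UNIV) (simplex_points \<sigma>)). g t \<in> A}"
      using simplex_points_subset[OF \<sigma>] by auto
    then show "openin (subtopology (powertop_real UNIV) (simplex_points \<sigma>))
        ({t \<in> nerve_points \<U>. g t \<in> A} \<inter> simplex_points \<sigma>)"
      using openin_continuous_map_preimage[OF assms[OF \<sigma>] A] by simp
  qed auto
  then show ?thesis
    using g by (auto simp: continuous_map_def)
qed

lemma nerve_map_vertex: "nerve_map \<phi> (nerve_vertex V) = nerve_vertex (\<phi> V)"
proof
  fix U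
  have "{V'. nerve_vertex V V' \<noteq> 0 \<and> \<phi> V' = U} = (if \<phi> V = U then {V} else {})"
    by (auto simp: nerve_vertex_def)
  then show "nerve_map \<phi> (nerve_vertex V) U = nerve_vertex (\<phi> V) U"
    by (auto simp: nerve_map_def nerve_vertex_def)
qed

text \<open>Vertices with the same image have their coordinates added; nonnegativity excludes
  cancellation.\<close>

lemma nerve_support_nerve_map:
  assumes "\<And>U. 0 \<le> t U" "finite (nerve_support t)"
  shows "nerve_support (nerve_map \<phi> t) = \<phi> ` nerve_support t"
proof -
  have "nerve_map \<phi> t U \<noteq> 0 \<longleftrightarrow> (\<exists>V. t V \<noteq> 0 \<and> \<phi> V = U)" for U
  proof -
    have "finite {V. t V \<noteq> 0 \<and> \<phi> V = U}"
      using assms(2) by (rule rev_finite_subset) auto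
    then have "nerve_map \<phi> t U = 0 \<longleftrightarrow> (\<forall>V\<in>{V. t V \<noteq> 0 \<and> \<phi> V = U}. t V = 0)"
      unfolding nerve_map_def using assms(1) by (intro sum_nonneg_eq_0_iff) auto
    then show ?thesis
      by blast
  qed
  then show ?thesis
    by auto
qed

text \<open>As each V is contained in \<open>\<phi> V\<close>, a common point of the members of a
  simplex is also common to their images.\<close>

lemma nerve_map_in:
  assumes t: "t \<in> nerve_points \<V>" and \<phi>: "\<And>V. V \<in> \<V> \<Longrightarrow> \<phi> V \<in> \<U> \<and> V \<subseteq> \<phi> V"
  shows "nerve_map \<phi> t \<in> nerve_points \<U>"
proof -
  let ?S = "nerve_support t"
  have S: "?S \<in> nerve_simplices \<V>" and pos: "\<And>U. 0 \<le> t U" and one: "sum t ?S = 1"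
    using t by (auto simp: nerve_points_iff)
  then have fin: "finite ?S" and sub: "?S \<subseteq> \<V>"
    by (auto simp: nerve_simplices_def)
  note supp = nerve_support_nerve_map[OF pos fin, of \<phi>]
  have "\<Inter>?S \<subseteq> \<Inter>(\<phi> ` ?S)"
    using sub \<phi> by blast
  then have "\<phi> ` ?S \<in> nerve_simplices \<U>"
    using S sub \<phi> fin unfolding nerve_simplices_def by blast
  moreover have "sum (nerve_map \<phi> t) (\<phi> ` ?S) = sum t ?S"
    unfolding nerve_map_def using sum.image_gen[OF fin, of t \<phi>] by (simp add: conj_commute)
  moreover have "0 \<le> nerve_map \<phi> t U" for U
    unfolding nerve_map_def using pos by (intro sum_nonneg) auto
  ultimately show ?thesis
    using one unfolding nerve_points_iff supp by simp
qed

text \<open>On one closed simplex the images have support in the finite set of image vertices, and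
  each coordinate is a fixed finite sum of coordinates.\<close>

lemma continuous_map_nerve_map:
  assumes \<phi>: "\<And>V. V \<in> \<V> \<Longrightarrow> \<phi> V \<in> \<U> \<and> V \<subseteq> \<phi> V"
  shows "continuous_map (nerve \<V>) (nerve \<U>) (nerve_map \<phi>)"
proof (rule continuous_map_from_nerve)
  fix \<sigma> assume \<sigma>: "\<sigma> \<in> nerve_simplices \<V>"
  then have fin: "finite \<sigma>"
    by (simp add: nerve_simplices_def)
  let ?Z = "subtopology (powertop_real UNIV) (simplex_points \<sigma>)"
  have top: "t \<in> simplex_points \<sigma>" if "t \<in> topspace ?Z" for t
    using that by simp
  have eq: "nerve_map \<phi> t U = sum t {V \<in> \<sigma>. \<phi> V = U}" if "t \<in> topspace ?Z" for t U
    unfolding nerve_map_def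
    by (rule sum.mono_neutral_left) (use fin simplex_points_support(1)[OF top[OF that] fin] in auto)
  show "continuous_map ?Z (nerve \<U>) (nerve_map \<phi>)"
  proof (rule continuous_map_into_nerve)
    fix t assume t: "t \<in> topspace ?Z"
    then show "nerve_map \<phi> t \<in> nerve_points \<U>"
      using simplex_points_subset[OF \<sigma>] by (intro nerve_map_in \<phi>) auto
    have "nerve_support (nerve_map \<phi> s) \<subseteq> \<phi> ` \<sigma>" if s: "s \<in> topspace ?Z" for s
    proof -
      have "nerve_support s \<subseteq> \<sigma>"
        using simplex_points_support(1)[OF top[OF s] fin] .
      moreover have "0 \<le> s U" for U
        using top[OF s] by (simp add: simplex_points_def)
      ultimately show ?thesis
        using nerve_support_nerve_map[of s \<phi>] fin finite_subset by (metis image_mono)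
    qed
    then show "\<exists>W F. openin ?Z W \<and> t \<in> W \<and> finite F \<and> (\<forall>w\<in>W. nerve_support (nerve_map \<phi> w) \<subseteq> F)"
      using t fin by (intro exI[of _ "topspace ?Z"] exI[of _ "\<phi> ` \<sigma>"]) blast
  next
    fix U
    have "continuous_map ?Z euclideanreal (\<lambda>t. sum t {V \<in> \<sigma>. \<phi> V = U})"
      using fin by (intro continuous_map_sum continuous_map_from_subtopology continuous_map_coordinate) auto
    then show "continuous_map ?Z euclideanreal (\<lambda>t. nerve_map \<phi> t U)"
      by (rule continuous_map_eq) (simp only: eq)
  qed
qed

lemma barycentric_map_support:
  assumes \<rho>: "partition_of_unity X \<V> \<rho>" and z: "z \<in> topspace X"
  shows "nerve_support (barycentric_map \<V> \<rho> z) = {V \<in> \<V>. \<rho> V z \<noteq> 0}"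
    and "V \<in> \<V> \<Longrightarrow> \<rho> V z \<noteq> 0 \<Longrightarrow> z \<in> V"
proof -
  show "nerve_support (barycentric_map \<V> \<rho> z) = {V \<in> \<V>. \<rho> V z \<noteq> 0}"
    by (auto simp: barycentric_map_def)
  assume V: "V \<in> \<V>" "\<rho> V z \<noteq> 0"
  then have "X closure_of {z \<in> topspace X. \<rho> V z \<noteq> 0} \<subseteq> V"
    using \<rho> by (auto simp: partition_of_unity_def)
  moreover have "z \<in> X closure_of {z \<in> topspace X. \<rho> V z \<noteq> 0}"
    using closure_of_subset[of "{z \<in> topspace X. \<rho> V z \<noteq> 0}" X] z V by blast
  ultimately show "z \<in> V"
    by blast
qed

lemma barycentric_map_in:
  assumes \<rho>: "partition_of_unity X \<V> \<rho>" and z: "z \<in> topspace X"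
  shows "barycentric_map \<V> \<rho> z \<in> nerve_points \<V>"
proof -
  let ?S = "{V \<in> \<V>. \<rho> V z \<noteq> 0}"
  obtain W where W: "z \<in> W" "finite {V \<in> \<V>. \<exists>w\<in>W. \<rho> V w \<noteq> 0}"
    using \<rho> z unfolding partition_of_unity_def by meson
  then have fin: "finite ?S"
    using finite_subset[of ?S "{V \<in> \<V>. \<exists>w\<in>W. \<rho> V w \<noteq> 0}"] by blast
  have one: "(\<Sum>V\<in>?S. \<rho> V z) = 1"
    using \<rho> z by (auto simp: partition_of_unity_def)
  then have "?S \<noteq> {}"
    by (metis sum.empty zero_neq_one)
  moreover have "z \<in> \<Inter>?S"
    using barycentric_map_support(2)[OF \<rho> z] by blast
  ultimately have "?S \<in> nerve_simplices \<V>"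
    using fin by (auto simp: nerve_simplices_def)
  moreover have "sum (barycentric_map \<V> \<rho> z) ?S = 1"
    unfolding one[symmetric] by (rule sum.cong) (auto simp: barycentric_map_def)
  moreover have "0 \<le> barycentric_map \<V> \<rho> z U" for U
    using \<rho> z by (auto simp: partition_of_unity_def barycentric_map_def)
  ultimately show ?thesis
    unfolding nerve_points_iff barycentric_map_support(1)[OF \<rho> z] by blast
qed

lemma continuous_map_barycentric:
  assumes \<rho>: "partition_of_unity X \<V> \<rho>"
  shows "continuous_map X (nerve \<V>) (barycentric_map \<V> \<rho>)"
proof (rule continuous_map_into_nerve)
  show "barycentric_map \<V> \<rho> z \<in> nerve_points \<V>" if "z \<in> topspace X" for z
    by (rule barycentric_map_in[OF \<rho> that])
  show "continuous_map X euclideanreal (\<lambda>z. barycentric_map \<V> \<rho> z U)" for U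
    using \<rho> by (cases "U \<in> \<V>") (auto simp: barycentric_map_def partition_of_unity_def)
  fix z assume "z \<in> topspace X"
  then obtain W where W: "openin X W" "z \<in> W" "finite {V \<in> \<V>. \<exists>w\<in>W. \<rho> V w \<noteq> 0}"
    using \<rho> unfolding partition_of_unity_def by meson
  moreover have "nerve_support (barycentric_map \<V> \<rho> w) \<subseteq> {V \<in> \<V>. \<exists>w\<in>W. \<rho> V w \<noteq> 0}" if "w \<in> W" for w
    using that by (auto simp: barycentric_map_def)
  ultimately show "\<exists>W F. openin X W \<and> z \<in> W \<and> finite F \<and>
      (\<forall>w\<in>W. nerve_support (barycentric_map \<V> \<rho> w) \<subseteq> F)"
    by blast
qed

lemma nerve_points_singleton_support:
  assumes "t \<in> nerve_points \<U>" "nerve_support t \<subseteq> {U}"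
  shows "t = nerve_vertex U"
proof -
  have "nerve_support t = {U}"
    using assms by (auto simp: nerve_points_iff nerve_simplices_def)
  moreover from this have "t U = 1"
    using assms(1) unfolding nerve_points_iff by simp
  ultimately show ?thesis
    by (auto simp: nerve_vertex_def fun_eq_iff)
qed

text \<open>A map into the nerve of \<open>\<U>\<close> of this kind is what the literature calls canonical: the
  preimage of the open star of the vertex \<open>U\<close> is contained in \<open>U\<close>.\<close>

definition canonical_map :: "'a topology \<Rightarrow> 'a set set \<Rightarrow> ('a \<Rightarrow> 'a set \<Rightarrow> real) \<Rightarrow> bool" where
  "canonical_map X \<U> f \<longleftrightarrow> continuous_map X (nerve \<U>) f \<and>
     (\<forall>z\<in>topspace X. \<forall>U\<in>nerve_support (f z). z \<in> U)"

lemma canonical_map_barycentric: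
  "partition_of_unity X \<V> \<rho> \<Longrightarrow> canonical_map X \<V> (barycentric_map \<V> \<rho>)"
  unfolding canonical_map_def
  using continuous_map_barycentric barycentric_map_support by (metis (mono_tags, lifting) mem_Collect_eq)

text \<open>If U is in the support of the image of z, then U is \<open>\<phi> V\<close> for some V
  in the support of \<open>f z\<close>, and z lies in V, hence in U.\<close>

lemma canonical_map_refine:
  assumes f: "canonical_map X \<V> f" and \<phi>: "\<And>V. V \<in> \<V> \<Longrightarrow> \<phi> V \<in> \<U> \<and> V \<subseteq> \<phi> V"
  shows "canonical_map X \<U> (nerve_map \<phi> \<circ> f)"
  unfolding canonical_map_def
proof (intro conjI ballI)
  show "continuous_map X (nerve \<U>) (nerve_map \<phi> \<circ> f)"
    using f continuous_map_nerve_map[OF \<phi>] by (auto simp: canonical_map_def intro: continuous_map_compose)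
  fix z U assume z: "z \<in> topspace X" and U: "U \<in> nerve_support ((nerve_map \<phi> \<circ> f) z)"
  have "f z \<in> nerve_points \<V>"
    using f z continuous_map_funspace[of X "nerve \<V>" f] by (auto simp: canonical_map_def)
  then have fz: "nerve_support (f z) \<in> nerve_simplices \<V>" "\<And>U. 0 \<le> f z U"
    by (auto simp: nerve_points_iff)
  then have "U \<in> \<phi> ` nerve_support (f z)"
    using U nerve_support_nerve_map[of "f z" \<phi>] by (auto simp: nerve_simplices_def)
  then obtain V where "V \<in> nerve_support (f z)" "U = \<phi> V"
    by blast
  then show "z \<in> U"
    using f z fz(1) \<phi>[of V] by (auto simp: canonical_map_def nerve_simplices_def)
qed

text \<open>Every point of the nerve is joined by a segment to some vertex U, and this vertex to
  \<open>f z\<close> for any z in U, since U and the members in the support of \<open>f z\<close>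
  all contain z. So every path component meets the image of the path connected space X.\<close>

lemma path_connected_space_nerve:
  assumes X: "path_connected_space X" and \<U>: "\<Union>\<U> \<subseteq> topspace X" and f: "canonical_map X \<U> f"
  shows "path_connected_space (nerve \<U>)"
proof -
  have cont: "continuous_map X (nerve \<U>) f"
    using f by (simp add: canonical_map_def)
  have fin: "f z \<in> nerve_points \<U>" if "z \<in> topspace X" for z
    using continuous_map_funspace[OF cont] that by auto
  have line: "path_component_of (nerve \<U>) v w"
    if "v \<in> nerve_points \<U>" "w \<in> nerve_points \<U>" "nerve_support v \<union> nerve_support w \<in> nerve_simplices \<U>" for v w
    using pathin_nerve_line[OF that] unfolding path_component_of_def by (intro exI[of _ "nerve_line v w"]) simp
  have to_f: "\<exists>z\<in>topspace X. path_component_of (nerve \<U>) t (f z)" if t: "t \<in> nerve_points \<U>" for t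
  proof -
    obtain U where U: "U \<in> \<U>" "t \<in> nerve_star \<U> U"
      by (rule nerve_star_cover[OF t])
    have v: "nerve_vertex U \<in> nerve_points \<U>"
      by (rule nerve_star_vertex_in[OF U(2)])
    then have "U \<noteq> {}"
      unfolding nerve_points_iff nerve_support_vertex by (auto simp: nerve_simplices_def)
    then obtain z where z: "z \<in> U" "z \<in> topspace X"
      using U(1) \<U> by blast
    have "nerve_support (f z) \<in> nerve_simplices \<U>"
      using fin[OF z(2)] by (simp add: nerve_points_iff)
    moreover have "\<forall>V\<in>nerve_support (f z). z \<in> V"
      using f z(2) by (simp add: canonical_map_def)
    ultimately have "nerve_support (nerve_vertex U) \<union> nerve_support (f z) \<in> nerve_simplices \<U>"
      using U(1) z(1) unfolding nerve_support_vertex by (auto simp: nerve_simplices_def)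
    then have vf: "path_component_of (nerve \<U>) (nerve_vertex U) (f z)"
      using v fin[OF z(2)] by (intro line)
    have "path_component_of (nerve \<U>) t (nerve_vertex U)"
      using t v star_union_vertex_simplex[OF U(2)] by (intro line)
    from path_component_of_trans[OF this vf] show ?thesis
      using z(2) by (intro bexI)
  qed
  have ff: "path_component_of (nerve \<U>) (f z) (f z')" if zz: "z \<in> topspace X" "z' \<in> topspace X" for z z'
  proof -
    obtain g where "pathin X g" "g 0 = z" "g 1 = z'"
      using X zz by (auto simp: path_connected_space_def)
    then show ?thesis
      unfolding path_component_of_def using pathin_compose[OF _ cont] by (intro exI[of _ "f \<circ> g"]) auto
  qed
  show ?thesis
    unfolding path_connected_space_iff_path_component topspace_nerve
  proof (intro ballI)
    fix t t' assume "t \<in> nerve_points \<U>" "t' \<in> nerve_points \<U>"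
    then obtain z z' where z: "z \<in> topspace X" "path_component_of (nerve \<U>) t (f z)"
        "z' \<in> topspace X" "path_component_of (nerve \<U>) t' (f z')"
      using to_f by meson
    then show "path_component_of (nerve \<U>) t t'"
      using path_component_of_trans[OF path_component_of_trans[OF z(2) ff[OF z(1,3)]]]
        path_component_of_sym[of "nerve \<U>" t' "f z'"] by blast
  qed
qed

section \<open>Small loops in the nerve, and close loops mapped into it\<close>

lemma group_hom_id: "group G \<Longrightarrow> group_hom G G (\<lambda>g. g)"
  by (auto simp: group_hom_def group_hom_axioms_def hom_def)

text \<open>Open stars serve as neighborhoods. With the path functor that extends the identity of
  the fundamental group, the class of a loop inside a star is a difference of potentials at one and
  the same point.\<close>

lemma semilocally_simply_connected_nerve:
  assumes conn: "path_connected_space (nerve \<U>)"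
  shows "semilocally_simply_connected (nerve \<U>)"
  unfolding semilocally_simply_connected_def
proof
  fix z assume "z \<in> topspace (nerve \<U>)"
  then have z: "z \<in> nerve_points \<U>"
    by simp
  then obtain U where U: "U \<in> \<U>" "z \<in> nerve_star \<U> U"
    using nerve_star_cover by blast
  have "group_hom (pi1 (nerve \<U>) z) (pi1 (nerve \<U>) z) (\<lambda>g. g)"
    using z by (intro group_hom_id group_pi1) simp
  then obtain \<theta> where \<theta>: "path_functor (pi1 (nerve \<U>) z) (nerve \<U>) \<theta>"
    "\<And>a. pathin (nerve \<U>) a \<Longrightarrow> a 0 = z \<Longrightarrow> a 1 = z \<Longrightarrow> \<theta> a = loop_class (nerve \<U>) z a"
    by (rule path_functor_exists[OF _ conn]) (use z in auto)
  interpret path_functor_chart "pi1 (nerve \<U>) z" "nerve \<U>" \<theta> \<U> "nerve_star \<U>"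
      "\<lambda>U w. \<theta> (nerve_line (nerve_vertex U) w)"
    by (rule path_functor_chart_nerve) fact
  show "\<exists>S\<subseteq>topspace (nerve \<U>). z \<in> nerve \<U> interior_of S \<and>
     (\<forall>a\<in>carrier (pi1 (subtopology (nerve \<U>) S) z). pi1_map (nerve \<U>) z (\<lambda>u. u) a = \<one>\<^bsub>pi1 (nerve \<U>) z\<^esub>)"
  proof (intro exI[of _ "nerve_star \<U> U"] conjI ballI)
    show "nerve_star \<U> U \<subseteq> topspace (nerve \<U>)"
      by (auto simp: nerve_star_def)
    show "z \<in> nerve \<U> interior_of nerve_star \<U> U"
      using U(2) interior_of_openin[OF openin_nerve_star[of \<U> U]] by blast
    fix g assume "g \<in> carrier (pi1 (subtopology (nerve \<U>) (nerve_star \<U> U)) z)"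
    then obtain \<gamma> where \<gamma>: "\<gamma> \<in> loops (subtopology (nerve \<U>) (nerve_star \<U> U)) z"
        "g = loop_class (subtopology (nerve \<U>) (nerve_star \<U> U)) z \<gamma>"
      by (metis pi1_carrierE)
    then have p: "pathin (subtopology (nerve \<U>) (nerve_star \<U> U)) \<gamma>" "\<gamma> 0 = z" "\<gamma> 1 = z"
      by (auto simp: loops_iff)
    then have "pathin (nerve \<U>) \<gamma>" "\<gamma> ` {0..1} \<subseteq> nerve_star \<U> U"
      by (auto simp: pathin_subtopology)
    then have "loop_class (nerve \<U>) z \<gamma> = \<one>\<^bsub>pi1 (nerve \<U>) z\<^esub>"
      using \<theta>(2)[of \<gamma>] p p_path[OF U(1), of \<gamma>] p_closed[OF U] by simp
    moreover have "pi1_map (nerve \<U>) z (\<lambda>u. u) g = loop_class (nerve \<U>) z ((\<lambda>u. u) \<circ> \<gamma>)"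
      unfolding \<gamma>(2)
      by (rule pi1_map_loop_class[where x = z and f = "\<lambda>u. u"])
        (use p continuous_map_from_subtopology[of "nerve \<U>" "nerve \<U>" "\<lambda>u. u"] in auto)
    ultimately show "pi1_map (nerve \<U>) z (\<lambda>u. u) g = \<one>\<^bsub>pi1 (nerve \<U>) z\<^esub>"
      by (simp add: o_def)
  qed
qed

text \<open>For a sufficiently close \<delta> the same subdivision and the same chain of stars work
  as for \<gamma>. The holonomy formula for the functor extending the identity then assigns both
  loops the same class.\<close>

lemma (in Metric_space) nerve_close_loops:
  assumes f: "continuous_map mtopology (nerve \<U>) f" and conn: "path_connected_space (nerve \<U>)"
    and \<gamma>: "pathin mtopology \<gamma>" "\<gamma> 0 = x" "\<gamma> 1 = x"
  obtains \<epsilon> where "0 < \<epsilon>"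
    "\<And>\<delta>. pathin mtopology \<delta> \<Longrightarrow> \<delta> 0 = x \<Longrightarrow> \<delta> 1 = x \<Longrightarrow> (\<And>t. t \<in> {0..1} \<Longrightarrow> d (\<gamma> t) (\<delta> t) < \<epsilon>) \<Longrightarrow>
       loop_class (nerve \<U>) (f x) (f \<circ> \<delta>) = loop_class (nerve \<U>) (f x) (f \<circ> \<gamma>)"
proof -
  let ?N = "nerve \<U>"
  have \<gamma>M: "\<gamma> t \<in> M" if "t \<in> {0..1}" for t
    using path_image_subset_topspace[OF \<gamma>(1)] that by auto
  have x: "x \<in> M"
    using \<gamma>M[of 0] \<gamma>(2) by simp
  then have fx: "f x \<in> topspace ?N"
    using continuous_map_funspace[OF f] by auto
  \<comment> \<open>The balls of radius \<open>fst p\<close> will cover \<gamma>; doubling the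
    radius leaves room for a second loop at distance less than the smallest radius used.\<close>
  have "\<forall>t\<in>{0..1}. \<exists>p. 0 < fst p \<and> snd p \<in> \<U> \<and> (\<forall>y\<in>mball (\<gamma> t) (2 * fst p). f y \<in> nerve_star \<U> (snd p))"
  proof
    fix t :: real assume "t \<in> {0..1}"
    then have g: "\<gamma> t \<in> M"
      by (rule \<gamma>M)
    then have "f (\<gamma> t) \<in> nerve_points \<U>"
      using continuous_map_funspace[OF f] by auto
    then obtain U where U: "U \<in> \<U>" "f (\<gamma> t) \<in> nerve_star \<U> U"
      using nerve_star_cover by blast
    have "openin mtopology {y \<in> topspace mtopology. f y \<in> nerve_star \<U> U}"
      by (rule openin_continuous_map_preimage[OF f openin_nerve_star])
    then obtain r where "0 < r" "mball (\<gamma> t) r \<subseteq> {y \<in> topspace mtopology. f y \<in> nerve_star \<U> U}"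
      using g U(2) unfolding openin_mtopology by auto
    then show "\<exists>p. 0 < fst p \<and> snd p \<in> \<U> \<and> (\<forall>y\<in>mball (\<gamma> t) (2 * fst p). f y \<in> nerve_star \<U> (snd p))"
      using U(1) by (intro exI[of _ "(r / 2, U)"]) auto
  qed
  then obtain p where p: "\<And>t. t \<in> {0..1} \<Longrightarrow> 0 < fst (p t)" "\<And>t. t \<in> {0..1} \<Longrightarrow> snd (p t) \<in> \<U>"
    "\<And>t y. t \<in> {0..1} \<Longrightarrow> y \<in> mball (\<gamma> t) (2 * fst (p t)) \<Longrightarrow> f y \<in> nerve_star \<U> (snd (p t))"
    by (metis (no_types, lifting))
  let ?B = "\<lambda>t. mball (\<gamma> t) (fst (p t))"
  \<comment> \<open>The loop is made a map on the square that ignores the second coordinate, so that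
    the grid lemma also subdivides an interval; only the cells with second index 0 are used.\<close>
  have "continuous_map (top_of_set ({0..1} \<times> {0..1})) (top_of_set {0..1}) (fst :: real \<times> real \<Rightarrow> real)"
    unfolding continuous_map_subtopology_eu by (auto intro!: continuous_intros)
  then have H: "continuous_map (top_of_set ({0..1} \<times> {0..1})) mtopology (\<gamma> \<circ> (fst :: real \<times> real \<Rightarrow> real))"
    by (rule continuous_map_compose) (use \<gamma>(1) in \<open>simp add: pathin_def\<close>)
  have cov: "\<exists>t\<in>{0..1}. (\<gamma> \<circ> fst) z \<in> ?B t" if "z \<in> {0..1} \<times> {0..1}" for z :: "real \<times> real"
    using that p(1) \<gamma>M by (intro bexI[of _ "fst z"]) auto
  obtain n u where n: "0 < n" and u: "\<And>k l. k < n \<Longrightarrow> l < n \<Longrightarrow> u k l \<in> {0..1} \<and>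
       (\<gamma> \<circ> fst) ` ({real k / real n .. real (Suc k) / real n} \<times> {real l / real n .. real (Suc l) / real n}) \<subseteq> ?B (u k l)"
    using square_grid[OF cov openin_mball H] by blast
  define v where "v = (\<lambda>k. u k 0)"
  have v: "v k \<in> {0..1}" "t \<in> {real k / real n .. real (Suc k) / real n} \<Longrightarrow> \<gamma> t \<in> ?B (v k)" if "k < n" for k t
  proof -
    show "v k \<in> {0..1}"
      using u[OF that n] by (simp add: v_def)
    assume t: "t \<in> {real k / real n .. real (Suc k) / real n}"
    have "0 \<in> {real 0 / real n .. real (Suc 0) / real n}"
      by simp
    then have "(t, 0) \<in> {real k / real n .. real (Suc k) / real n} \<times> {real 0 / real n .. real (Suc 0) / real n}"
      using t by (intro SigmaI)
    then have "(\<gamma> \<circ> fst) (t, 0 :: real) \<in> ?B (v k)"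
      unfolding v_def by (rule subsetD[OF conjunct2[OF u[OF that n]] imageI])
    then show "\<gamma> t \<in> ?B (v k)"
      by simp
  qed
  define \<epsilon> where "\<epsilon> = Min ((\<lambda>k. fst (p (v k))) ` {..<n})"
  have eps: "\<epsilon> \<le> fst (p (v k))" if "k < n" for k
    unfolding \<epsilon>_def using that by (intro Min_le) auto
  have "0 < \<epsilon>"
    unfolding \<epsilon>_def using n p(1) v(1) by (subst Min_gr_iff) auto
  have "group_hom (pi1 ?N (f x)) (pi1 ?N (f x)) (\<lambda>g. g)"
    using fx by (intro group_hom_id group_pi1)
  then obtain \<theta> where \<theta>: "path_functor (pi1 ?N (f x)) ?N \<theta>"
    "\<And>a. pathin ?N a \<Longrightarrow> a 0 = f x \<Longrightarrow> a 1 = f x \<Longrightarrow> \<theta> a = loop_class ?N (f x) a"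
    by (rule path_functor_exists[OF _ conn fx]) auto
  interpret path_functor_chart "pi1 ?N (f x)" ?N \<theta> \<U> "nerve_star \<U>"
      "\<lambda>U w. \<theta> (nerve_line (nerve_vertex U) w)"
    by (rule path_functor_chart_nerve) fact
  define w where "w = (\<lambda>k. snd (p (v k)))"
  have hol: "loop_class ?N (f x) (f \<circ> \<delta>) = inv\<^bsub>pi1 ?N (f x)\<^esub> \<theta> (nerve_line (nerve_vertex (w 0)) (f x))
      \<otimes>\<^bsub>pi1 ?N (f x)\<^esub> holonomy w (n - 1) \<otimes>\<^bsub>pi1 ?N (f x)\<^esub> \<theta> (nerve_line (nerve_vertex (w (n - 1))) (f x))"
    if \<delta>: "pathin mtopology \<delta>" "\<delta> 0 = x" "\<delta> 1 = x" and close: "\<And>t. t \<in> {0..1} \<Longrightarrow> d (\<gamma> t) (\<delta> t) < \<epsilon>" for \<delta>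
  proof -
    have f\<delta>: "pathin ?N (f \<circ> \<delta>)"
      by (rule pathin_compose[OF \<delta>(1) f])
    have "w k \<in> \<U> \<and> (f \<circ> \<delta>) ` {real k / real n..real (Suc k) / real n} \<subseteq> nerve_star \<U> (w k)" if k: "k < n" for k
    proof (intro conjI subsetI)
      show "w k \<in> \<U>"
        unfolding w_def using p(2) v(1)[OF k] by blast
      fix y assume "y \<in> (f \<circ> \<delta>) ` {real k / real n..real (Suc k) / real n}"
      then obtain t where t: "t \<in> {real k / real n..real (Suc k) / real n}" "y = f (\<delta> t)"
        by auto
      have 0: "0 \<le> real k / real n" and 1: "real (Suc k) / real n \<le> 1"
        using k by (auto simp: divide_simps)
      have t01: "t \<in> {0..1}"
        using t(1) order_trans[OF 0, of t] order_trans[OF _ 1, of t] by simp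
      have \<delta>M: "\<delta> t \<in> M"
        using path_image_subset_topspace[OF \<delta>(1)] t01 by auto
      have "\<gamma> t \<in> ?B (v k)"
        using v(2)[OF k t(1)] .
      then have "d (\<gamma> (v k)) (\<gamma> t) < fst (p (v k))" "\<gamma> (v k) \<in> M" "\<gamma> t \<in> M"
        by auto
      then have "d (\<gamma> (v k)) (\<delta> t) < 2 * fst (p (v k))"
        using triangle[of "\<gamma> (v k)" "\<gamma> t" "\<delta> t"] \<delta>M close[OF t01] eps[OF k] by linarith
      then show "y \<in> nerve_star \<U> (w k)"
        unfolding t(2) w_def using \<gamma>M[OF v(1)[OF k]] \<delta>M by (intro p(3) v(1)[OF k]) auto
    qed
    from functor_eq_holonomy[OF f\<delta> n this] show ?thesis
      using \<theta>(2)[OF f\<delta>] \<delta> by simp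
  qed
  show thesis
    using that[OF \<open>0 < \<epsilon>\<close>] hol hol[OF \<gamma>] \<open>0 < \<epsilon>\<close> \<gamma>M by simp
qed

section \<open>Partitions of unity on metrizable spaces\<close>

text \<open>The index set of the sum varies with the point, but near any point it can be replaced by
  one finite set, the additional terms being zero.\<close>

lemma continuous_map_locally_finite_sum:
  fixes f :: "'i \<Rightarrow> 'a \<Rightarrow> real"
  assumes cont: "\<And>i. i \<in> I \<Longrightarrow> continuous_map X euclideanreal (f i)"
    and fin: "\<And>z. z \<in> topspace X \<Longrightarrow> \<exists>W. openin X W \<and> z \<in> W \<and> finite {i \<in> I. \<exists>w\<in>W. f i w \<noteq> 0}"
  shows "continuous_map X euclideanreal (\<lambda>z. \<Sum>i\<in>{i \<in> I. f i z \<noteq> 0}. f i z)"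
proof -
  let ?s = "\<lambda>z. \<Sum>i\<in>{i \<in> I. f i z \<noteq> 0}. f i z"
  have "openin X {z \<in> topspace X. ?s z \<in> A}" if A: "open A" for A
  proof (subst openin_subopen, intro ballI)
    fix z assume z: "z \<in> {z \<in> topspace X. ?s z \<in> A}"
    then obtain W where W: "openin X W" "z \<in> W" and F: "finite {i \<in> I. \<exists>w\<in>W. f i w \<noteq> 0}"
      using fin[of z] by auto
    let ?F = "{i \<in> I. \<exists>w\<in>W. f i w \<noteq> 0}"
    have eq: "?s w = (\<Sum>i\<in>?F. f i w)" if "w \<in> W" for w
      by (rule sum.mono_neutral_left[OF F]) (use that in auto)
    have "continuous_map X euclideanreal (\<lambda>w. \<Sum>i\<in>?F. f i w)"
      using F cont by (intro continuous_map_sum) auto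
    from openin_continuous_map_preimage[OF this, of A]
    have "openin X (W \<inter> {w \<in> topspace X. (\<Sum>i\<in>?F. f i w) \<in> A})"
      using A W(1) by (intro openin_Int) auto
    then show "\<exists>T. openin X T \<and> z \<in> T \<and> T \<subseteq> {z \<in> topspace X. ?s z \<in> A}"
      using z W(2) eq by (intro exI[of _ "W \<inter> {w \<in> topspace X. (\<Sum>i\<in>?F. f i w) \<in> A}"]) auto
  qed
  then show ?thesis
    by (auto simp: continuous_map_def)
qed

section \<open>Bump functions from distances, and paracompactness of metric spaces\<close>

context Metric_space
begin

lemma continuous_map_nonexpansive:
  assumes "\<And>z w. z \<in> M \<Longrightarrow> w \<in> M \<Longrightarrow> f z \<le> f w + d z w"
  shows "continuous_map mtopology euclideanreal f"
proof -
  have "openin mtopology {z \<in> M. f z \<in> A}" if A: "open A" for A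
    unfolding openin_mtopology
  proof (intro conjI allI impI)
    fix z assume z: "z \<in> {z \<in> M. f z \<in> A}"
    then obtain e where e: "0 < e" "\<And>y. dist y (f z) < e \<Longrightarrow> y \<in> A"
      using A unfolding open_dist by blast
    have "f w \<in> A" if w: "w \<in> mball z e" for w
      using assms[of z w] assms[of w z] w commute[of z w] by (intro e(2)) (auto simp: dist_real_def)
    then show "\<exists>r>0. mball z r \<subseteq> {z \<in> M. f z \<in> A}"
      using e(1) by (intro exI[of _ e]) auto
  qed auto
  then show ?thesis
    by (auto simp: continuous_map_def)
qed

text \<open>The distance to the complement of U, cut off at 1. The element 1 keeps the infimum
  meaningful when U is the whole space, and it provides a uniform upper bound.\<close>

definition depth :: "'a set \<Rightarrow> 'a \<Rightarrow> real" where
  "depth U z = Inf (insert 1 (d z ` (M - U)))"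

lemma depth_bdd: "bdd_below (insert 1 (d z ` (M - U)))"
  by (rule bdd_belowI[of _ 0]) auto

lemma depth_nonneg: "0 \<le> depth U z"
  unfolding depth_def by (rule cInf_greatest) auto

lemma depth_le_1: "depth U z \<le> 1"
  unfolding depth_def by (rule cInf_lower[OF _ depth_bdd]) auto

lemma depth_le: "y \<in> M - U \<Longrightarrow> depth U z \<le> d z y"
  unfolding depth_def by (rule cInf_lower[OF _ depth_bdd]) auto

lemma depth_nonexpansive:
  assumes "z \<in> M" "w \<in> M"
  shows "depth U z \<le> depth U w + d z w"
proof -
  have "depth U z - d z w \<le> depth U w"
    unfolding depth_def[of U w]
  proof (rule cInf_greatest)
    fix r assume "r \<in> insert 1 (d w ` (M - U))"
    then consider "r = 1" | y where "y \<in> M - U" "r = d w y"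
      by auto
    then show "depth U z - d z w \<le> r"
    proof cases
      case 1
      then show ?thesis
        using depth_le_1[of U z] nonneg[of z w] by linarith
    next
      case 2
      then show ?thesis
        using depth_le[of y U z] triangle[of z w y] assms by auto
    qed
  qed simp
  then show ?thesis
    by linarith
qed

lemma depth_pos_iff:
  assumes "openin mtopology U" "z \<in> M"
  shows "0 < depth U z \<longleftrightarrow> z \<in> U"
proof
  assume "0 < depth U z"
  then show "z \<in> U"
    using depth_le[of z U z] assms by force
next
  assume "z \<in> U"
  then obtain r where r: "0 < r" "mball z r \<subseteq> U"
    using assms(1) unfolding openin_mtopology by blast
  have "min 1 r \<le> depth U z"
    unfolding depth_def
  proof (rule cInf_greatest)
    fix s assume "s \<in> insert 1 (d z ` (M - U))"
    then show "min 1 r \<le> s"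
      using r(2) assms(2) by (force simp: min_le_iff_disj)
  qed simp
  then show "0 < depth U z"
    using r(1) by linarith
qed

text \<open>Rudin's argument in terms of functions. Well-order the cover. For fixed \<open>n\<close>, the points
  that lie deep inside \<open>U\<close> but shallow in all predecessors of \<open>U\<close> form, as \<open>U\<close> varies, a uniformly
  discrete family, and these families together cover the space.\<close>

lemma sigma_discrete_bumps:
  assumes op: "\<And>U. U \<in> \<U> \<Longrightarrow> openin mtopology U" and cover: "\<Union>\<U> = M"
  obtains \<phi> :: "nat \<Rightarrow> 'a set \<Rightarrow> 'a \<Rightarrow> real" where
    "\<And>n U. continuous_map mtopology euclideanreal (\<phi> n U)"
    "\<And>n U z. 0 \<le> \<phi> n U z" "\<And>n U z. \<phi> n U z \<le> 1"
    "\<And>n U z. \<phi> n U z \<noteq> 0 \<Longrightarrow> inverse (real (Suc n)) < depth U z"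
    "\<And>n U V z w. U \<in> \<U> \<Longrightarrow> V \<in> \<U> \<Longrightarrow> z \<in> M \<Longrightarrow> w \<in> M \<Longrightarrow> \<phi> n U z \<noteq> 0 \<Longrightarrow> \<phi> n V w \<noteq> 0 \<Longrightarrow>
       d z w < inverse (real (Suc n)) / 2 \<Longrightarrow> U = V"
    "\<And>z. z \<in> M \<Longrightarrow> \<exists>n. \<exists>U\<in>\<U>. \<phi> n U z \<noteq> 0"
proof -
  obtain r :: "'a set rel" where r: "well_order_on UNIV r"
    using well_order_on by blast
  define lt where "lt = (\<lambda>U V. (U, V) \<in> r - Id)"
  have total: "lt U V \<or> lt V U" if "U \<noteq> V" for U V
    using r that by (auto simp: lt_def well_order_on_def linear_order_on_def total_on_def)
  have wf: "wf (r - Id)"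
    using r by (simp add: well_order_on_def)
  define h where "h = (\<lambda>n. inverse (real (Suc n)))"
  \<comment> \<open>G measures how deep z lies in the predecessors of U; it is 0 if there are none.
    Being a supremum of nonexpansive functions, it is nonexpansive.\<close>
  define G where "G = (\<lambda>U z. Sup (insert 0 ((\<lambda>V. depth V z) ` {V \<in> \<U>. lt V U})))"
  have bdd: "bdd_above (insert 0 ((\<lambda>V. depth V z) ` {V \<in> \<U>. lt V U}))" for U z
    using depth_le_1 by (intro bdd_aboveI[of _ 1]) auto
  have G_ge: "depth V z \<le> G U z" if "V \<in> \<U>" "lt V U" for U V z
    unfolding G_def using that by (intro cSup_upper[OF _ bdd]) auto
  have G_nonneg: "0 \<le> G U z" for U z
    unfolding G_def by (intro cSup_upper[OF _ bdd]) auto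
  have G_nonexp: "G U z \<le> G U w + d z w" if "z \<in> M" "w \<in> M" for U z w
  proof -
    have "s \<le> G U w + d z w" if s: "s \<in> insert 0 ((\<lambda>V. depth V z) ` {V \<in> \<U>. lt V U})" for s
    proof -
      consider "s = 0" | V where "V \<in> \<U>" "lt V U" "s = depth V z"
        using s by auto
      then show ?thesis
      proof cases
        case 1
        then show ?thesis
          using G_nonneg[of U w] nonneg[of z w] by linarith
      next
        case 2
        then show ?thesis
          using G_ge[OF 2(1,2), of w] depth_nonexpansive[OF \<open>z \<in> M\<close> \<open>w \<in> M\<close>, of V] by linarith
      qed
    qed
    then have "Sup (insert 0 ((\<lambda>V. depth V z) ` {V \<in> \<U>. lt V U})) \<le> G U w + d z w"
      by (intro cSup_least) auto
    then show ?thesis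
      by (simp only: G_def)
  qed
  \<comment> \<open>Nonzero exactly where the depth in U exceeds \<open>h n\<close> while the depth
    in every predecessor stays below a common bound under \<open>h n / 2\<close>. The gap between
    the two thresholds separates the bumps of one level.\<close>
  define \<phi> where "\<phi> = (\<lambda>n U z. max 0 (min (depth U z - h n) (h n / 2 - G U z)))"
  have h: "0 < h n" "h n \<le> 1" for n
    by (auto simp: h_def inverse_eq_divide)
  have nz: "\<phi> n U z \<noteq> 0 \<Longrightarrow> h n < depth U z \<and> G U z < h n / 2" for n U z
    by (auto simp: \<phi>_def max_def min_def split: if_splits)
  show thesis
  proof
    fix n U
    have "continuous_map mtopology euclideanreal (depth U)" "continuous_map mtopology euclideanreal (G U)"
      using depth_nonexpansive G_nonexp by (auto intro!: continuous_map_nonexpansive)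
    then show "continuous_map mtopology euclideanreal (\<phi> n U)"
      unfolding \<phi>_def by (intro continuous_map_real_max continuous_map_real_min continuous_map_diff) auto
    fix z
    show "0 \<le> \<phi> n U z"
      by (simp add: \<phi>_def)
    show "\<phi> n U z \<le> 1"
      using depth_le_1[of U z] h[of n] by (auto simp: \<phi>_def max_def min_def)
    show "\<phi> n U z \<noteq> 0 \<Longrightarrow> inverse (real (Suc n)) < depth U z"
      using nz by (simp add: h_def)
  next
    fix n U V z w
    assume *: "U \<in> \<U>" "V \<in> \<U>" "z \<in> M" "w \<in> M" "\<phi> n U z \<noteq> 0" "\<phi> n V w \<noteq> 0" "d z w < inverse (real (Suc n)) / 2"
    \<comment> \<open>If U' came before V', its depth would exceed \<open>h n\<close> at z' and be
      less than \<open>h n / 2\<close> at w', although it changes by less than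
      \<open>h n / 2\<close> between them.\<close>
    have less: "\<not> lt U' V'" if "U' \<in> \<U>" "z' \<in> M" "w' \<in> M" "\<phi> n U' z' \<noteq> 0" "\<phi> n V' w' \<noteq> 0" "d z' w' < h n / 2"
      for U' V' z' w'
    proof
      assume "lt U' V'"
      then show False
        using G_ge[OF that(1), of V' w'] nz[OF that(4)] nz[OF that(5)] depth_nonexpansive[OF that(2,3), of U'] that(6)
        by linarith
    qed
    show "U = V"
      using total[of U V] less[OF *(1,3,4,5,6)] less[OF *(2,4,3,6,5)] *(7) commute[of z w] by (auto simp: h_def)
  next
    fix z assume z: "z \<in> M"
    then have "{U \<in> \<U>. z \<in> U} \<noteq> {}"
      using cover by blast
    \<comment> \<open>U is the first member containing z, so no predecessor has positive depth at z
      and some level has a nonzero bump there.\<close>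
    then obtain U where U: "U \<in> {U \<in> \<U>. z \<in> U}" "\<And>V. (V, U) \<in> r - Id \<Longrightarrow> V \<notin> {U \<in> \<U>. z \<in> U}"
      using wf unfolding wf_eq_minimal by (metis ex_in_conv)
    have "depth V z = 0" if "V \<in> \<U>" "lt V U" for V
      using depth_pos_iff[OF op[OF that(1)] z] depth_nonneg[of V z] U(2)[of V] that by (auto simp: lt_def)
    then have "G U z \<le> 0"
      unfolding G_def by (intro cSup_least) auto
    then have "G U z = 0"
      using G_nonneg[of U z] by linarith
    moreover have "0 < depth U z"
      using depth_pos_iff[OF op z] U(1) by auto
    then obtain n where "h n < depth U z"
      unfolding h_def using reals_Archimedean by blast
    ultimately have "\<phi> n U z \<noteq> 0"
      using h[of n] by (auto simp: \<phi>_def max_def min_def)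
    then show "\<exists>n. \<exists>U\<in>\<U>. \<phi> n U z \<noteq> 0"
      using U(1) by blast
  qed
qed

text \<open>Each level is locally finite, but the levels together need not be. From level n one
  subtracts n times the total of all earlier levels: where the total of a level k is positive, this
  eventually exceeds 1, which bounds every bump, so high levels vanish near the point. At the first
  level that is nonzero at z nothing is subtracted, so z is still covered.\<close>

lemma locally_finite_bumps:
  assumes op: "\<And>U. U \<in> \<U> \<Longrightarrow> openin mtopology U" and cover: "\<Union>\<U> = M"
  obtains \<psi> :: "nat \<Rightarrow> 'a set \<Rightarrow> 'a \<Rightarrow> real" where
    "\<And>n U. continuous_map mtopology euclideanreal (\<psi> n U)"
    "\<And>n U z. 0 \<le> \<psi> n U z"
    "\<And>n U z. \<psi> n U z \<noteq> 0 \<Longrightarrow> inverse (real (Suc n)) < depth U z"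
    "\<And>z. z \<in> M \<Longrightarrow> \<exists>W. openin mtopology W \<and> z \<in> W \<and>
       finite {p \<in> UNIV \<times> \<U>. \<exists>w\<in>W. \<psi> (fst p) (snd p) w \<noteq> 0}"
    "\<And>z. z \<in> M \<Longrightarrow> \<exists>n. \<exists>U\<in>\<U>. \<psi> n U z \<noteq> 0"
proof (rule sigma_discrete_bumps[OF _ cover])
  fix \<phi> :: "nat \<Rightarrow> 'a set \<Rightarrow> 'a \<Rightarrow> real"
  assume cont: "\<And>n U. continuous_map mtopology euclideanreal (\<phi> n U)"
    and nn: "\<And>n U z. 0 \<le> \<phi> n U z" and le1: "\<And>n U z. \<phi> n U z \<le> 1"
    and deep: "\<And>n U z. \<phi> n U z \<noteq> 0 \<Longrightarrow> inverse (real (Suc n)) < depth U z"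
    and sep: "\<And>n U V z w. U \<in> \<U> \<Longrightarrow> V \<in> \<U> \<Longrightarrow> z \<in> M \<Longrightarrow> w \<in> M \<Longrightarrow> \<phi> n U z \<noteq> 0 \<Longrightarrow> \<phi> n V w \<noteq> 0 \<Longrightarrow>
       d z w < inverse (real (Suc n)) / 2 \<Longrightarrow> U = V"
    and ex: "\<And>z. z \<in> M \<Longrightarrow> \<exists>n. \<exists>U\<in>\<U>. \<phi> n U z \<noteq> 0"
  \<comment> \<open>Two points of a ball of radius a quarter are closer than a half, the separation
    of the bumps within one level; so at most one bump of that level meets the ball.\<close>
  have disc: "finite {U \<in> \<U>. \<exists>w\<in>mball z (inverse (real (Suc n)) / 4). \<phi> n U w \<noteq> 0}" (is "finite ?F") for n z
  proof -
    have "U = V" if UV: "U \<in> ?F" "V \<in> ?F" for U V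
    proof -
      obtain w w' where w: "w \<in> mball z (inverse (real (Suc n)) / 4)" "\<phi> n U w \<noteq> 0"
        "w' \<in> mball z (inverse (real (Suc n)) / 4)" "\<phi> n V w' \<noteq> 0"
        using UV by blast
      then have "d w w' < inverse (real (Suc n)) / 2"
        using triangle[of w z w'] commute[of w z] by auto
      then show ?thesis
        using w UV by (intro sep[of U V w w' n]) auto
    qed
    then have "is_singleton ?F \<or> ?F = {}"
      unfolding is_singleton_def by blast
    then show ?thesis
      unfolding is_singleton_def by (elim disjE exE; simp only: finite.intros)
  qed
  define \<Phi> where "\<Phi> = (\<lambda>n z. \<Sum>U\<in>{U \<in> \<U>. \<phi> n U z \<noteq> 0}. \<phi> n U z)"
  have lf: "\<exists>W. openin mtopology W \<and> z \<in> W \<and> finite {U \<in> \<U>. \<exists>w\<in>W. \<phi> n U w \<noteq> 0}" if "z \<in> M" for n z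
    using disc[of z n] that by (intro exI[of _ "mball z (inverse (real (Suc n)) / 4)"]) auto
  have \<Phi>cont: "continuous_map mtopology euclideanreal (\<Phi> n)" for n
    unfolding \<Phi>_def using lf by (intro continuous_map_locally_finite_sum cont) auto
  have fin: "finite {U \<in> \<U>. \<phi> n U z \<noteq> 0}" if "z \<in> M" for n z
    by (rule finite_subset[OF _ disc[of z n]]) (use that in auto)
  have \<Phi>nn: "0 \<le> \<Phi> n z" for n z
    unfolding \<Phi>_def using nn by (intro sum_nonneg) auto
  have \<Phi>ge: "\<phi> n U z \<le> \<Phi> n z" if "z \<in> M" "U \<in> \<U>" "\<phi> n U z \<noteq> 0" for n U z
    unfolding \<Phi>_def using that nn fin by (intro member_le_sum) auto
  define \<psi> where "\<psi> = (\<lambda>n U z. max 0 (\<phi> n U z - real n * (\<Sum>m<n. \<Phi> m z)))"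
  show thesis
  proof
    fix n U
    show "continuous_map mtopology euclideanreal (\<psi> n U)"
      unfolding \<psi>_def
      by (intro continuous_map_real_max continuous_map_diff cont continuous_map_real_mult_left continuous_map_sum \<Phi>cont) auto
    fix z
    show "0 \<le> \<psi> n U z"
      by (simp add: \<psi>_def)
    assume "\<psi> n U z \<noteq> 0"
    moreover have "0 \<le> real n * (\<Sum>m<n. \<Phi> m z)"
      using \<Phi>nn by (intro mult_nonneg_nonneg sum_nonneg) auto
    ultimately have "\<phi> n U z \<noteq> 0"
      by (auto simp: \<psi>_def max_def split: if_splits)
    then show "inverse (real (Suc n)) < depth U z"
      by (rule deep)
  next
    fix z assume z: "z \<in> M"
    define k where "k = (LEAST n. \<exists>U\<in>\<U>. \<phi> n U z \<noteq> 0)"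
    obtain U where U: "U \<in> \<U>" "\<phi> k U z \<noteq> 0"
      using LeastI_ex[OF ex[OF z]] unfolding k_def by blast
    have "\<Phi> m z = 0" if "m < k" for m
      using not_less_Least[OF that[unfolded k_def]] unfolding \<Phi>_def by (intro sum.neutral) blast
    then have "\<psi> k U z = \<phi> k U z"
      using nn[of k U z] by (simp add: \<psi>_def)
    then show "\<exists>n. \<exists>U\<in>\<U>. \<psi> n U z \<noteq> 0"
      using U by (intro exI[of _ k] bexI[of _ U]) auto
    have pos: "0 < \<Phi> k z"
      using \<Phi>ge[OF z U] U(2) nn[of k U z] by linarith
    obtain N where N: "k < N" "1 < real N * \<Phi> k z"
    proof -
      obtain n :: nat where "1 / \<Phi> k z < real n"
        using reals_Archimedean2 by blast
      then have n: "1 < real n * \<Phi> k z"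
        using pos by (simp add: field_simps)
      have "real n * \<Phi> k z \<le> real (max n (Suc k)) * \<Phi> k z"
        using pos by (intro mult_right_mono) auto
      then show thesis
        using n by (intro that[of "max n (Suc k)"]) auto
    qed
    \<comment> \<open>The first condition kills all levels from N on; the balls leave finitely many
      members for each level below N.\<close>
    define W where "W = {w \<in> M. 1 < real N * \<Phi> k w} \<inter> (\<Inter>m<N. mball z (inverse (real (Suc m)) / 4))"
    have "continuous_map mtopology euclideanreal (\<lambda>w. real N * \<Phi> k w)"
      by (intro continuous_map_real_mult_left \<Phi>cont)
    from openin_continuous_map_preimage[OF this, of "{1<..}"]
    have "openin mtopology {w \<in> M. 1 < real N * \<Phi> k w}"
      by simp
    then have W: "openin mtopology W"
      unfolding W_def using N(1) by (intro openin_Int openin_INT2) auto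
    have "{p \<in> UNIV \<times> \<U>. \<exists>w\<in>W. \<psi> (fst p) (snd p) w \<noteq> 0} \<subseteq>
        (SIGMA m:{..<N}. {U \<in> \<U>. \<exists>w\<in>mball z (inverse (real (Suc m)) / 4). \<phi> m U w \<noteq> 0})"
    proof
      fix p assume "p \<in> {p \<in> UNIV \<times> \<U>. \<exists>w\<in>W. \<psi> (fst p) (snd p) w \<noteq> 0}"
      then obtain n V w where p: "p = (n, V)" "V \<in> \<U>" "w \<in> W" "\<psi> n V w \<noteq> 0"
        by (cases p) auto
      have wM: "1 < real N * \<Phi> k w"
        using p(3) by (simp add: W_def)
      have "0 \<le> real n * (\<Sum>m<n. \<Phi> m w)"
        using \<Phi>nn by (intro mult_nonneg_nonneg sum_nonneg) auto
      then have "\<phi> n V w \<noteq> 0"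
        using p(4) by (auto simp: \<psi>_def max_def split: if_splits)
      moreover have "n < N"
      proof (rule ccontr)
        assume "\<not> n < N"
        then have n: "N \<le> n" "k < n"
          using N(1) by auto
        have "\<Phi> k w \<le> (\<Sum>m<n. \<Phi> m w)"
          using n(2) \<Phi>nn by (intro member_le_sum) auto
        then have "real N * \<Phi> k w \<le> real n * (\<Sum>m<n. \<Phi> m w)"
          using n(1) \<Phi>nn by (intro mult_mono) auto
        then have "\<phi> n V w < real n * (\<Sum>m<n. \<Phi> m w)"
          using wM le1[of n V w] by linarith
        then show False
          using p(4) by (simp add: \<psi>_def)
      qed
      moreover have "w \<in> mball z (inverse (real (Suc n)) / 4)"
        using p(3) \<open>n < N\<close> unfolding W_def by blast
      ultimately show "p \<in> (SIGMA m:{..<N}. {U \<in> \<U>. \<exists>w\<in>mball z (inverse (real (Suc m)) / 4). \<phi> m U w \<noteq> 0})"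
        using p(1,2) by blast
    qed
    moreover have "finite (SIGMA m:{..<N}. {U \<in> \<U>. \<exists>w\<in>mball z (inverse (real (Suc m)) / 4). \<phi> m U w \<noteq> 0})"
      using disc by (intro finite_SigmaI) auto
    ultimately have "finite {p \<in> UNIV \<times> \<U>. \<exists>w\<in>W. \<psi> (fst p) (snd p) w \<noteq> 0}"
      by (rule finite_subset)
    moreover have "z \<in> W"
      using z N by (auto simp: W_def)
    ultimately show "\<exists>W. openin mtopology W \<and> z \<in> W \<and>
        finite {p \<in> UNIV \<times> \<U>. \<exists>w\<in>W. \<psi> (fst p) (snd p) w \<noteq> 0}"
      using W by blast
  qed
qed (rule op)

text \<open>For each U the levels are summed, and the sums are divided by their total. The closed
  support stays in U for this reason: near a given point only levels up to some N contribute to U,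
  so nearby points of the support have depth greater than 1/(N+1), and a limit of such points cannot
  have depth 0.\<close>

lemma partition_of_unity_exists:
  assumes op: "\<And>U. U \<in> \<U> \<Longrightarrow> openin mtopology U" and cover: "\<Union>\<U> = M"
  shows "\<exists>\<rho>. partition_of_unity mtopology \<U> \<rho>"
proof (rule locally_finite_bumps[OF _ cover])
  fix \<psi> :: "nat \<Rightarrow> 'a set \<Rightarrow> 'a \<Rightarrow> real"
  assume cont: "\<And>n U. continuous_map mtopology euclideanreal (\<psi> n U)"
    and nn: "\<And>n U z. 0 \<le> \<psi> n U z"
    and deep: "\<And>n U z. \<psi> n U z \<noteq> 0 \<Longrightarrow> inverse (real (Suc n)) < depth U z"
    and lf: "\<And>z. z \<in> M \<Longrightarrow> \<exists>W. openin mtopology W \<and> z \<in> W \<and>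
       finite {p \<in> UNIV \<times> \<U>. \<exists>w\<in>W. \<psi> (fst p) (snd p) w \<noteq> 0}"
    and ex: "\<And>z. z \<in> M \<Longrightarrow> \<exists>n. \<exists>U\<in>\<U>. \<psi> n U z \<noteq> 0"
  define \<Psi> where "\<Psi> = (\<lambda>U z. \<Sum>n\<in>{n \<in> UNIV. \<psi> n U z \<noteq> 0}. \<psi> n U z)"
  define T where "T = (\<lambda>z. \<Sum>U\<in>{U \<in> \<U>. \<Psi> U z \<noteq> 0}. \<Psi> U z)"
  have lf1: "\<exists>W. openin mtopology W \<and> z \<in> W \<and> finite {n \<in> UNIV. \<exists>w\<in>W. \<psi> n U w \<noteq> 0}"
    if z: "z \<in> M" and U: "U \<in> \<U>" for z U
  proof -
    obtain W where W: "openin mtopology W" "z \<in> W"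
      "finite {p \<in> UNIV \<times> \<U>. \<exists>w\<in>W. \<psi> (fst p) (snd p) w \<noteq> 0}"
      using lf[OF z] by blast
    have "{n \<in> UNIV. \<exists>w\<in>W. \<psi> n U w \<noteq> 0} \<subseteq> fst ` {p \<in> UNIV \<times> \<U>. \<exists>w\<in>W. \<psi> (fst p) (snd p) w \<noteq> 0}"
      using U by (force simp: image_iff)
    then show ?thesis
      using W finite_subset finite_imageI by (metis (no_types, lifting))
  qed
  have \<Psi>cont: "continuous_map mtopology euclideanreal (\<Psi> U)" if "U \<in> \<U>" for U
    unfolding \<Psi>_def using lf1[OF _ that] by (intro continuous_map_locally_finite_sum cont) auto
  have \<Psi>nn: "0 \<le> \<Psi> U z" for U z
    unfolding \<Psi>_def using nn by (intro sum_nonneg) auto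
  have \<Psi>nz: "\<exists>n. \<psi> n U z \<noteq> 0" if "\<Psi> U z \<noteq> 0" for U z
    using that unfolding \<Psi>_def by (metis (mono_tags, lifting) mem_Collect_eq sum.neutral)
  have \<Psi>pos: "\<Psi> U z \<noteq> 0" if zU: "z \<in> M" "U \<in> \<U>" and nz: "\<psi> n U z \<noteq> 0" for n U z
  proof -
    obtain W where W: "z \<in> W" "finite {n \<in> UNIV. \<exists>w\<in>W. \<psi> n U w \<noteq> 0}"
      using lf1[OF zU] by blast
    then have "finite {n \<in> UNIV. \<psi> n U z \<noteq> 0}"
      using finite_subset[of "{n \<in> UNIV. \<psi> n U z \<noteq> 0}" "{n \<in> UNIV. \<exists>w\<in>W. \<psi> n U w \<noteq> 0}"] by blast
    then have "\<psi> n U z \<le> \<Psi> U z"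
      unfolding \<Psi>_def using nz nn by (intro member_le_sum) auto
    then show ?thesis
      using nn[of n U z] nz by linarith
  qed
  have lf2: "\<exists>W. openin mtopology W \<and> z \<in> W \<and> finite {U \<in> \<U>. \<exists>w\<in>W. \<Psi> U w \<noteq> 0}" if z: "z \<in> M" for z
  proof -
    obtain W where W: "openin mtopology W" "z \<in> W"
      "finite {p \<in> UNIV \<times> \<U>. \<exists>w\<in>W. \<psi> (fst p) (snd p) w \<noteq> 0}"
      using lf[OF z] by blast
    have "{U \<in> \<U>. \<exists>w\<in>W. \<Psi> U w \<noteq> 0} \<subseteq> snd ` {p \<in> UNIV \<times> \<U>. \<exists>w\<in>W. \<psi> (fst p) (snd p) w \<noteq> 0}"
      using \<Psi>nz by (force simp: image_iff)
    then show ?thesis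
      using W finite_subset finite_imageI by (metis (no_types, lifting))
  qed
  have Tcont: "continuous_map mtopology euclideanreal T"
    unfolding T_def using lf2 by (intro continuous_map_locally_finite_sum \<Psi>cont) auto
  have Tpos: "0 < T z" if z: "z \<in> M" for z
  proof -
    obtain n U where "U \<in> \<U>" "\<psi> n U z \<noteq> 0"
      using ex[OF z] by blast
    then have U: "U \<in> \<U>" "\<Psi> U z \<noteq> 0"
      using \<Psi>pos z by auto
    obtain W where W: "z \<in> W" "finite {U \<in> \<U>. \<exists>w\<in>W. \<Psi> U w \<noteq> 0}"
      using lf2[OF z] by blast
    then have "finite {U \<in> \<U>. \<Psi> U z \<noteq> 0}"
      using finite_subset[of "{U \<in> \<U>. \<Psi> U z \<noteq> 0}" "{U \<in> \<U>. \<exists>w\<in>W. \<Psi> U w \<noteq> 0}"] by blast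
    then have "\<Psi> U z \<le> T z"
      unfolding T_def using U \<Psi>nn by (intro member_le_sum) auto
    then show ?thesis
      using U(2) \<Psi>nn[of U z] by linarith
  qed
  define \<rho> where "\<rho> = (\<lambda>U z. \<Psi> U z / T z)"
  have \<rho>nz: "\<rho> U z \<noteq> 0 \<longleftrightarrow> \<Psi> U z \<noteq> 0" if "z \<in> M" for U z
    using Tpos[OF that] by (simp add: \<rho>_def)
  have "partition_of_unity mtopology \<U> \<rho>"
    unfolding partition_of_unity_def topspace_mtopology
  proof (intro conjI ballI)
    fix U assume U: "U \<in> \<U>"
    have "T z \<noteq> 0" if "z \<in> M" for z
      using Tpos[OF that] by simp
    then show "continuous_map mtopology euclideanreal (\<rho> U)"
      unfolding \<rho>_def by (intro continuous_map_real_divide \<Psi>cont U Tcont) auto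
    show "0 \<le> \<rho> U z" if "z \<in> M" for z
      using Tpos[OF that] \<Psi>nn[of U z] by (simp add: \<rho>_def)
    show "mtopology closure_of {z \<in> M. \<rho> U z \<noteq> 0} \<subseteq> U"
    proof
      fix z assume z: "z \<in> mtopology closure_of {z \<in> M. \<rho> U z \<noteq> 0}"
      then have zM: "z \<in> M"
        by (simp add: in_closure_of)
      obtain W where W: "openin mtopology W" "z \<in> W" "finite {n \<in> UNIV. \<exists>w\<in>W. \<psi> n U w \<noteq> 0}"
        using lf1[OF zM U] by blast
      then obtain N where N: "\<And>n w. w \<in> W \<Longrightarrow> \<psi> n U w \<noteq> 0 \<Longrightarrow> n \<le> N"
        unfolding finite_nat_set_iff_bounded_le by blast
      have "continuous_map mtopology euclideanreal (depth U)"
        using depth_nonexpansive by (rule continuous_map_nonexpansive)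
      from openin_continuous_map_preimage[OF this, of "{..<inverse (real (Suc N))}"]
      have op': "openin mtopology (W \<inter> {w \<in> M. depth U w < inverse (real (Suc N))})"
        using W(1) by (simp add: openin_Int)
      show "z \<in> U"
      proof (rule ccontr)
        assume "z \<notin> U"
        then have "depth U z = 0"
          using depth_pos_iff[OF op[OF U] zM] depth_nonneg[of U z] by linarith
        then have "z \<in> W \<inter> {w \<in> M. depth U w < inverse (real (Suc N))}"
          using W(2) zM by simp
        with z op' have "\<exists>w\<in>{z \<in> M. \<rho> U z \<noteq> 0}. w \<in> W \<inter> {w \<in> M. depth U w < inverse (real (Suc N))}"
          unfolding in_closure_of by meson
        then obtain w where w: "w \<in> M" "\<rho> U w \<noteq> 0" "w \<in> W" "depth U w < inverse (real (Suc N))"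
          by auto
        then obtain n where n: "\<psi> n U w \<noteq> 0"
          using \<rho>nz \<Psi>nz by blast
        then have "inverse (real (Suc N)) \<le> inverse (real (Suc n))"
          using N[OF w(3)] by (intro le_imp_inverse_le) auto
        then show False
          using deep[OF n] w(4) by linarith
      qed
    qed
  next
    fix z assume z: "z \<in> M"
    obtain W where W: "openin mtopology W" "z \<in> W" "finite {U \<in> \<U>. \<exists>w\<in>W. \<Psi> U w \<noteq> 0}"
      using lf2[OF z] by blast
    then have "W \<subseteq> M"
      using openin_subset by fastforce
    then have "{U \<in> \<U>. \<exists>w\<in>W. \<rho> U w \<noteq> 0} = {U \<in> \<U>. \<exists>w\<in>W. \<Psi> U w \<noteq> 0}"
      using \<rho>nz by blast
    then show "\<exists>W. openin mtopology W \<and> z \<in> W \<and> finite {V \<in> \<U>. \<exists>w\<in>W. \<rho> V w \<noteq> 0}"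
      using W by (intro exI[of _ W]) simp
    have "(\<Sum>V\<in>{V \<in> \<U>. \<rho> V z \<noteq> 0}. \<rho> V z) = (\<Sum>V\<in>{V \<in> \<U>. \<Psi> V z \<noteq> 0}. \<Psi> V z / T z)"
      using \<rho>nz[OF z] by (simp add: \<rho>_def)
    also have "\<dots> = 1"
      using Tpos[OF z] by (simp add: T_def flip: sum_divide_distrib)
    finally show "(\<Sum>V\<in>{V \<in> \<U>. \<rho> V z \<noteq> 0}. \<rho> V z) = 1" .
  qed
  then show ?thesis
    by blast
qed (rule op)

end

section \<open>The shape kernel as an intersection of kernels\<close>

text \<open>Delete x from every member and put U back. Deletion preserves openness because points
  are closed, and afterwards U is the only member that contains x.\<close>

lemma special_refinement_exists:
  assumes X: "t1_space X" and p: "p \<in> pointed_covers X x"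
  shows "\<exists>q. q \<in> special_covers X x \<and> cover_refines q p"
proof -
  obtain \<U> U where p_eq: "p = (\<U>, U)" and \<U>: "\<And>W. W \<in> \<U> \<Longrightarrow> openin X W" "\<Union>\<U> = topspace X" "U \<in> \<U>" "x \<in> U"
    using p by (auto simp: pointed_covers_def)
  let ?\<V> = "insert U ((\<lambda>W. W - {x}) ` \<U>)"
  have "x \<in> topspace X"
    using \<U> by blast
  then have "closedin X {x}"
    using X by (simp add: t1_space_closedin_singleton)
  then have "openin X (W - {x})" if "W \<in> \<U>" for W
    using \<U>(1)[OF that] by (rule openin_diff[rotated])
  moreover have "\<Union>?\<V> = topspace X"
    using \<U>(2-4) by blast
  ultimately have "(?\<V>, U) \<in> special_covers X x"
    using \<U> by (auto simp: special_covers_def pointed_covers_def)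
  moreover have "cover_refines (?\<V>, U) p"
    using \<U>(3) by (auto simp: cover_refines_def p_eq)
  ultimately show ?thesis
    by blast
qed

lemma vertex_assignment_exists:
  assumes "cover_refines q p" "p \<in> pointed_covers X x"
  shows "\<exists>\<phi>. vertex_assignment q p \<phi>"
proof -
  obtain \<V> V \<U> U where eq: "q = (\<V>, V)" "p = (\<U>, U)"
    by (cases q, cases p) auto
  have r: "\<forall>V'\<in>\<V>. \<exists>U'. U' \<in> \<U> \<and> V' \<subseteq> U'" "V \<subseteq> U" "U \<in> \<U>"
    using assms by (auto simp: eq cover_refines_def pointed_covers_def)
  obtain \<phi> where "\<And>V'. V' \<in> \<V> \<Longrightarrow> \<phi> V' \<in> \<U> \<and> V' \<subseteq> \<phi> V'"
    using bchoice[OF r(1)] by blast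
  then have "vertex_assignment q p (\<phi>(V := U))"
    using r by (auto simp: eq vertex_assignment_def)
  then show ?thesis
    by blast
qed

text \<open>With the choices in \<open>shape_hom\<close> fixed, functoriality merges the bonding map
  and the barycentric homomorphism into the map induced by a single f. This f sends x to the
  distinguished vertex even when x lies in several members of the cover, because it passes through a
  special refinement.\<close>

lemma shape_hom_component:
  assumes X: "metrizable_space X" and x: "x \<in> topspace X" and p: "p \<in> pointed_covers X x"
  shows "\<exists>f. canonical_map X (fst p) f \<and> f x = nerve_vertex (snd p) \<and>
    (\<forall>g\<in>carrier (pi1 X x). shape_hom X x g p = pi1_map (nerve (fst p)) (nerve_vertex (snd p)) f g)"
proof -
  define q where "q = (SOME q. q \<in> special_covers X x \<and> cover_refines q p)"
  have "t1_space X"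
    using X by (simp add: metrizable_imp_Hausdorff_space Hausdorff_imp_t1_space)
  then have q: "q \<in> special_covers X x" "cover_refines q p"
    unfolding q_def using someI_ex[OF special_refinement_exists[OF _ p]] by blast+
  obtain \<V> V where q_eq: "q = (\<V>, V)"
    by (cases q)
  have \<V>: "\<And>W. W \<in> \<V> \<Longrightarrow> openin X W" "\<Union>\<V> = topspace X" "V \<in> \<V>" "x \<in> V"
    "\<And>W. W \<in> \<V> \<Longrightarrow> x \<in> W \<Longrightarrow> W = V"
    using q(1) by (auto simp: q_eq special_covers_def pointed_covers_def)
  define \<rho> where "\<rho> = (SOME \<rho>. partition_of_unity X \<V> \<rho>)"
  have \<rho>: "partition_of_unity X \<V> \<rho>"
  proof -
    obtain M d where Md: "Metric_space M d" "X = Metric_space.mtopology M d"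
      using X by (auto simp: metrizable_space_def)
    interpret Metric_space M d
      by fact
    have "\<exists>\<rho>. partition_of_unity X \<V> \<rho>"
      unfolding Md(2) by (rule partition_of_unity_exists) (use \<V>(1,2) Md(2) in simp_all)
    then show ?thesis
      unfolding \<rho>_def by (rule someI_ex)
  qed
  define \<phi> where "\<phi> = (SOME \<phi>. vertex_assignment q p \<phi>)"
  have "vertex_assignment q p \<phi>"
    unfolding \<phi>_def by (rule someI_ex[OF vertex_assignment_exists[OF q(2) p]])
  then have \<phi>: "\<And>V'. V' \<in> \<V> \<Longrightarrow> \<phi> V' \<in> fst p \<and> V' \<subseteq> \<phi> V'" "\<phi> V = snd p"
    by (auto simp: q_eq vertex_assignment_def split_def)
  let ?b = "barycentric_map \<V> \<rho>"
  have b: "canonical_map X \<V> ?b"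
    by (rule canonical_map_barycentric[OF \<rho>])
  then have bc: "continuous_map X (nerve \<V>) ?b"
    by (simp add: canonical_map_def)
  have bx: "?b x = nerve_vertex V"
  proof (rule nerve_points_singleton_support)
    show "?b x \<in> nerve_points \<V>"
      by (rule barycentric_map_in[OF \<rho> x])
    show "nerve_support (?b x) \<subseteq> {V}"
      using barycentric_map_support[OF \<rho> x] \<V>(5) by auto
  qed
  have "shape_hom X x g p = pi1_map (nerve (fst p)) (nerve_vertex (snd p)) (nerve_map \<phi> \<circ> ?b) g"
    if g: "g \<in> carrier (pi1 X x)" for g
  proof -
    have "shape_hom X x g p = bonding q p (barycentric_pi1 X q g)"
      using p by (simp add: shape_hom_def q_def Let_def)
    also have "\<dots> = pi1_map (nerve (fst p)) (nerve_vertex (snd p)) (nerve_map \<phi>)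
        (pi1_map (nerve \<V>) (nerve_vertex V) ?b g)"
      by (simp add: bonding_def barycentric_pi1_def q_eq \<phi>_def \<rho>_def)
    also have "\<dots> = pi1_map (nerve (fst p)) (nerve_vertex (snd p)) (nerve_map \<phi> \<circ> ?b) g"
      using pi1_map_comp[OF bc continuous_map_nerve_map[OF \<phi>(1)] g] by (simp add: bx nerve_map_vertex \<phi>(2))
    finally show ?thesis .
  qed
  then show ?thesis
    using canonical_map_refine[OF b \<phi>(1)] bx
    by (intro exI[of _ "nerve_map \<phi> \<circ> ?b"]) (auto simp: nerve_map_vertex \<phi>(2))
qed

lemma shape_kernel_eq_Inter:
  assumes X: "metrizable_space X" and x: "x \<in> topspace X"
  shows "\<exists>F. (\<forall>p\<in>pointed_covers X x. canonical_map X (fst p) (F p) \<and> F p x = nerve_vertex (snd p)) \<and>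
    shape_kernel X x = (\<Inter>p\<in>pointed_covers X x.
      kernel (pi1 X x) (pi1 (nerve (fst p)) (F p x)) (pi1_map (nerve (fst p)) (F p x) (F p)))"
proof -
  have "\<exists>F. \<forall>p\<in>pointed_covers X x. canonical_map X (fst p) (F p) \<and> F p x = nerve_vertex (snd p) \<and>
    (\<forall>g\<in>carrier (pi1 X x). shape_hom X x g p = pi1_map (nerve (fst p)) (nerve_vertex (snd p)) (F p) g)"
    by (rule bchoice) (rule ballI[OF shape_hom_component[OF X x]])
  then obtain F where F: "\<forall>p\<in>pointed_covers X x. canonical_map X (fst p) (F p) \<and> F p x = nerve_vertex (snd p) \<and>
    (\<forall>g\<in>carrier (pi1 X x). shape_hom X x g p = pi1_map (nerve (fst p)) (nerve_vertex (snd p)) (F p) g)"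
    by (elim exE)
  \<comment> \<open>The one-element cover makes the family nonempty, so that the intersection of the
    kernels stays inside the carrier.\<close>
  have ne: "({topspace X}, topspace X) \<in> pointed_covers X x"
    using x by (simp add: pointed_covers_def)
  have one: "\<one>\<^bsub>shape_group X x\<^esub> = (\<lambda>p\<in>pointed_covers X x. \<one>\<^bsub>nerve_pi1 p\<^esub>)"
    by (simp add: shape_group_def product_group_def)
  have nerve: "nerve_pi1 p = pi1 (nerve (fst p)) (nerve_vertex (snd p))" for p :: "'a set set \<times> 'a set"
    by (simp add: nerve_pi1_def split_def)
  have "shape_hom X x g = \<one>\<^bsub>shape_group X x\<^esub> \<longleftrightarrow>
      (\<forall>p\<in>pointed_covers X x. shape_hom X x g p = \<one>\<^bsub>nerve_pi1 p\<^esub>)" for g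
    unfolding one by (auto simp: shape_hom_def fun_eq_iff restrict_def)
  then have "shape_kernel X x =
      {g \<in> carrier (pi1 X x). \<forall>p\<in>pointed_covers X x. shape_hom X x g p = \<one>\<^bsub>nerve_pi1 p\<^esub>}"
    by (auto simp: shape_kernel_def kernel_def)
  also have "\<dots> = (\<Inter>p\<in>pointed_covers X x.
      kernel (pi1 X x) (pi1 (nerve (fst p)) (F p x)) (pi1_map (nerve (fst p)) (F p x) (F p)))"
    (is "_ = (\<Inter>p\<in>_. ?K p)")
  proof -
    have eq: "shape_hom X x g p = \<one>\<^bsub>nerve_pi1 p\<^esub> \<longleftrightarrow> g \<in> ?K p"
      if "p \<in> pointed_covers X x" "g \<in> carrier (pi1 X x)" for p g
      using bspec[OF F that(1)] that(2) by (simp add: kernel_def nerve)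
    have "g \<in> carrier (pi1 X x)" if "g \<in> (\<Inter>p\<in>pointed_covers X x. ?K p)" for g
      using INT_D[OF that ne] by (simp add: kernel_def)
    then show ?thesis
      using eq by blast
  qed
  finally show ?thesis
    using F by (intro exI[of _ F]) blast
qed

lemma (in group) normal_Inter:
  assumes "\<And>N. N \<in> A \<Longrightarrow> N \<lhd> G" "A \<noteq> {}"
  shows "\<Inter>A \<lhd> G"
  unfolding normal_inv_iff
proof (intro conjI ballI)
  show "subgroup (\<Inter>A) G"
    using assms by (intro subgroups_Inter) (auto simp: normal_inv_iff)
  show "g \<otimes> h \<otimes> inv g \<in> \<Inter>A" if "g \<in> carrier G" "h \<in> \<Inter>A" for g h
    using assms(1) that by (auto simp: normal_inv_iff)
qed

section \<open>The topology of the loop space\<close>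

text \<open>The sup metric lives on bounded maps, and loops are bounded as images of a compact
  interval. Hence cutting down to the loops loses none of them.\<close>

lemma loops_subset_cfunspace:
  assumes "mtopology_of m = X"
  shows "loops X x \<subseteq> mspace (cfunspace (top_of_set {0..1}) m)"
proof
  fix \<gamma> assume \<gamma>: "\<gamma> \<in> loops X x"
  then have cont: "continuous_map (top_of_set {0..1}) X \<gamma>" and ext: "\<gamma> \<in> extensional {0..1}"
    by (auto simp: loops_def pathin_def)
  interpret Metric_space "mspace m" "mdist m"
    by (rule Metric_space_mspace_mdist)
  have "compactin X (\<gamma> ` {0..1})"
    by (rule image_compactin[OF _ cont]) (simp add: compactin_subtopology)
  then have "mbounded (\<gamma> ` {0..1})"
    using assms by (intro compactin_imp_mbounded) (simp add: mtopology_of_def)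
  then show "\<gamma> \<in> mspace (cfunspace (top_of_set {0..1}) m)"
    using cont ext continuous_map_funspace[OF cont] assms by auto
qed

text \<open>The metric chosen inside \<open>loop_space\<close> is exposed here, and open sets are
  described by pointwise inequalities, so that later arguments can estimate loops parameter by
  parameter.\<close>

lemma loop_space_open:
  assumes "metrizable_space X"
  obtains m where "mtopology_of m = X"
    "\<And>S. S \<subseteq> loops X x \<Longrightarrow> openin (loop_space X x) S \<longleftrightarrow>
      (\<forall>\<gamma>\<in>S. \<exists>\<epsilon>>0. \<forall>\<delta>\<in>loops X x. (\<forall>t\<in>{0..1}. mdist m (\<gamma> t) (\<delta> t) < \<epsilon>) \<longrightarrow> \<delta> \<in> S)"
    "topspace (loop_space X x) = loops X x"
proof -
  define m where "m = (SOME m. mtopology_of m = X)"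
  have "\<exists>m. mtopology_of m = X"
    using assms unfolding metrizable_space_def by (metis Metric_space.mtopology_of)
  then have m: "mtopology_of m = X"
    unfolding m_def by (rule someI_ex)
  let ?C = "cfunspace (top_of_set {0..1}) m"
  let ?L = "submetric ?C (loops X x)"
  have space: "loop_space X x = mtopology_of ?L"
    by (simp add: loop_space_def m_def)
  note sub = loops_subset_cfunspace[OF m, of x]
  have mL: "mspace ?L = loops X x"
    using sub by auto
  interpret L: Metric_space "mspace ?L" "mdist ?L"
    by (rule Metric_space_mspace_mdist)
  show thesis
  proof
    show "mtopology_of m = X"
      by (rule m)
    show "topspace (loop_space X x) = loops X x"
      unfolding space topspace_mtopology_of mL ..
    fix S assume S: "S \<subseteq> loops X x"
    have "openin (loop_space X x) S \<longleftrightarrow> (\<forall>\<gamma>\<in>S. \<exists>r>0. L.mball \<gamma> r \<subseteq> S)"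
      unfolding space mtopology_of_def L.openin_mtopology using S unfolding mL by (simp add: Ball_def)
    also have "\<dots> \<longleftrightarrow> (\<forall>\<gamma>\<in>S. \<exists>\<epsilon>>0. \<forall>\<delta>\<in>loops X x. (\<forall>t\<in>{0..1}. mdist m (\<gamma> t) (\<delta> t) < \<epsilon>) \<longrightarrow> \<delta> \<in> S)"
    proof (intro ball_cong refl iffI)
      fix \<gamma> assume \<gamma>: "\<gamma> \<in> S"
      {
        assume "\<exists>r>0. L.mball \<gamma> r \<subseteq> S"
        then obtain r where r: "0 < r" "L.mball \<gamma> r \<subseteq> S"
          by blast
        show "\<exists>\<epsilon>>0. \<forall>\<delta>\<in>loops X x. (\<forall>t\<in>{0..1}. mdist m (\<gamma> t) (\<delta> t) < \<epsilon>) \<longrightarrow> \<delta> \<in> S"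
        proof (intro exI[of _ "r / 2"] conjI ballI impI)
          fix \<delta> assume \<delta>: "\<delta> \<in> loops X x" "\<forall>t\<in>{0..1}. mdist m (\<gamma> t) (\<delta> t) < r / 2"
          \<comment> \<open>Strict pointwise bounds give only a weak bound on the supremum, hence
            the halved radius.\<close>
          have "mdist ?C \<gamma> \<delta> \<le> r / 2"
            using r(1) \<delta>(2) by (intro mdist_cfunspace_le) (auto simp: less_imp_le)
          then have "\<delta> \<in> L.mball \<gamma> r"
            using r(1) S \<gamma> \<delta>(1) unfolding L.in_mball unfolding mL by auto
          then show "\<delta> \<in> S"
            using r(2) by blast
        qed (use r(1) in simp)
      next
        assume "\<exists>\<epsilon>>0. \<forall>\<delta>\<in>loops X x. (\<forall>t\<in>{0..1}. mdist m (\<gamma> t) (\<delta> t) < \<epsilon>) \<longrightarrow> \<delta> \<in> S"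
        then obtain \<epsilon> where \<epsilon>: "0 < \<epsilon>"
          "\<And>\<delta>. \<delta> \<in> loops X x \<Longrightarrow> (\<And>t. t \<in> {0..1} \<Longrightarrow> mdist m (\<gamma> t) (\<delta> t) < \<epsilon>) \<Longrightarrow> \<delta> \<in> S"
          by metis
        have "L.mball \<gamma> \<epsilon> \<subseteq> S"
        proof
          fix \<delta> assume "\<delta> \<in> L.mball \<gamma> \<epsilon>"
          then have \<delta>: "\<gamma> \<in> loops X x" "\<delta> \<in> loops X x" "mdist ?C \<gamma> \<delta> < \<epsilon>"
            unfolding L.in_mball unfolding mL by auto
          have "mdist m (\<gamma> t) (\<delta> t) < \<epsilon>" if "t \<in> {0..1}" for t
          proof (rule cfunspace_mdist_lt[of "top_of_set {0..1}" \<gamma> m \<delta> \<epsilon> t])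
            show "compactin (top_of_set {0..1::real}) (topspace (top_of_set {0..1}))"
              by (simp add: compactin_subtopology)
            show "\<gamma> \<in> mspace ?C" "\<delta> \<in> mspace ?C"
              using \<delta>(1,2) sub by blast+
          qed (use \<delta>(3) that in simp_all)
          then show "\<delta> \<in> S"
            using \<delta>(2) by (intro \<epsilon>(2))
        qed
        then show "\<exists>r>0. L.mball \<gamma> r \<subseteq> S"
          using \<epsilon>(1) by blast
      }
    qed
    finally show "openin (loop_space X x) S \<longleftrightarrow>
      (\<forall>\<gamma>\<in>S. \<exists>\<epsilon>>0. \<forall>\<delta>\<in>loops X x. (\<forall>t\<in>{0..1}. mdist m (\<gamma> t) (\<delta> t) < \<epsilon>) \<longrightarrow> \<delta> \<in> S)" .
  qed
qed

lemma in_Union_pi1_iff: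
  assumes "G \<subseteq> carrier (pi1 X x)"
  shows "\<gamma> \<in> \<Union>G \<longleftrightarrow> \<gamma> \<in> loops X x \<and> loop_class X x \<gamma> \<in> G"
proof
  assume "\<gamma> \<in> \<Union>G"
  then obtain g where g: "g \<in> G" "\<gamma> \<in> g"
    by blast
  then obtain \<delta> where \<delta>: "\<delta> \<in> loops X x" "g = loop_class X x \<delta>"
    using assms by (meson pi1_carrierE subsetD)
  then have "\<gamma> \<in> loops X x" "path_homotopic X \<delta> \<gamma>"
    using g(2) by (auto simp: loop_class_def loops_iff loop_homotopic_iff)
  then show "\<gamma> \<in> loops X x \<and> loop_class X x \<gamma> \<in> G"
    using g(1) \<delta> loop_class_eq_iff by metis
next
  assume "\<gamma> \<in> loops X x \<and> loop_class X x \<gamma> \<in> G"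
  then show "\<gamma> \<in> \<Union>G"
    by (intro UnionI[of "loop_class X x \<gamma>"]) (auto intro: loop_class_self)
qed

lemma canonical_kernel_clopen:
  assumes X: "path_connected_space X" "metrizable_space X" and x: "x \<in> topspace X"
    and \<U>: "\<Union>\<U> \<subseteq> topspace X" and f: "canonical_map X \<U> f"
  defines "K \<equiv> kernel (pi1 X x) (pi1 (nerve \<U>) (f x)) (pi1_map (nerve \<U>) (f x) f)"
  shows "pi1_open X x K" and "pi1_closed X x K"
proof -
  have conn: "path_connected_space (nerve \<U>)"
    by (rule path_connected_space_nerve[OF X(1) \<U> f])
  have cont: "continuous_map X (nerve \<U>) f"
    using f by (simp add: canonical_map_def)
  obtain m where m: "mtopology_of m = X"
    "\<And>S. S \<subseteq> loops X x \<Longrightarrow> openin (loop_space X x) S \<longleftrightarrow>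
      (\<forall>\<gamma>\<in>S. \<exists>\<epsilon>>0. \<forall>\<delta>\<in>loops X x. (\<forall>t\<in>{0..1}. mdist m (\<gamma> t) (\<delta> t) < \<epsilon>) \<longrightarrow> \<delta> \<in> S)"
    "topspace (loop_space X x) = loops X x"
    using loop_space_open[OF X(2), of x] by metis
  interpret Metric_space "mspace m" "mdist m"
    by (rule Metric_space_mspace_mdist)
  have mtop: "mtopology = X"
    using m(1) by (simp add: mtopology_of_def)
  have mem: "\<gamma> \<in> \<Union>K \<longleftrightarrow> loop_class (nerve \<U>) (f x) (f \<circ> \<gamma>) = \<one>\<^bsub>pi1 (nerve \<U>) (f x)\<^esub>"
    if "\<gamma> \<in> loops X x" for \<gamma>
    using that in_Union_pi1_iff[of K X x \<gamma>] pi1_map_loop_class[OF cont, of \<gamma> x] loop_class_in_pi1[of X \<gamma> x]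
    by (auto simp: K_def kernel_def loops_iff)
  \<comment> \<open>Membership is locally constant on the loop space; the equivalence yields
    openness of the union and of its complement at once.\<close>
  have close: "\<exists>\<epsilon>>0. \<forall>\<delta>\<in>loops X x. (\<forall>t\<in>{0..1}. mdist m (\<gamma> t) (\<delta> t) < \<epsilon>) \<longrightarrow> (\<delta> \<in> \<Union>K \<longleftrightarrow> \<gamma> \<in> \<Union>K)"
    if \<gamma>: "\<gamma> \<in> loops X x" for \<gamma>
  proof -
    obtain \<epsilon> where \<epsilon>: "0 < \<epsilon>" "\<And>\<delta>. pathin mtopology \<delta> \<Longrightarrow> \<delta> 0 = x \<Longrightarrow> \<delta> 1 = x \<Longrightarrow>
        (\<And>t. t \<in> {0..1} \<Longrightarrow> mdist m (\<gamma> t) (\<delta> t) < \<epsilon>) \<Longrightarrow>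
       loop_class (nerve \<U>) (f x) (f \<circ> \<delta>) = loop_class (nerve \<U>) (f x) (f \<circ> \<gamma>)"
      using nerve_close_loops[of \<U> f \<gamma> x] cont conn \<gamma> mtop by (auto simp: loops_iff)
    show ?thesis
    proof (intro exI[of _ \<epsilon>] conjI ballI impI \<epsilon>(1))
      fix \<delta> assume \<delta>: "\<delta> \<in> loops X x" "\<forall>t\<in>{0..1}. mdist m (\<gamma> t) (\<delta> t) < \<epsilon>"
      then have "loop_class (nerve \<U>) (f x) (f \<circ> \<delta>) = loop_class (nerve \<U>) (f x) (f \<circ> \<gamma>)"
        using mtop by (intro \<epsilon>(2)) (auto simp: loops_iff)
      then show "\<delta> \<in> \<Union>K \<longleftrightarrow> \<gamma> \<in> \<Union>K"
        using mem \<delta>(1) \<gamma> by simp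
    qed
  qed
  have sub: "\<Union>K \<subseteq> loops X x"
    using in_Union_pi1_iff[of K X x] by (auto simp: K_def kernel_def)
  have "openin (loop_space X x) (\<Union>K)"
    unfolding m(2)[OF sub] using close sub by (meson subsetD)
  then show "pi1_open X x K"
    by (simp add: pi1_open_def)
  have "openin (loop_space X x) (loops X x - \<Union>K)"
    unfolding m(2)[OF Diff_subset] using close by (metis Diff_iff)
  then show "pi1_closed X x K"
    using sub by (simp add: pi1_closed_def closedin_def m(3))
qed

lemma shape_kernel_normal_closed:
  assumes X: "path_connected_space X" "metrizable_space X" and x: "x \<in> topspace X"
  shows "shape_kernel X x \<lhd> pi1 X x" and "pi1_closed X x (shape_kernel X x)"
proof -
  let ?K = "\<lambda>F p. kernel (pi1 X x) (pi1 (nerve (fst p)) (F p x)) (pi1_map (nerve (fst p)) (F p x) (F p))"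
  obtain F where F: "\<And>p. p \<in> pointed_covers X x \<Longrightarrow> canonical_map X (fst p) (F p)"
    and SK: "shape_kernel X x = (\<Inter>p\<in>pointed_covers X x. ?K F p)"
    using shape_kernel_eq_Inter[OF X(2) x] by blast
  have ne: "pointed_covers X x \<noteq> {}"
    using x by (auto simp: pointed_covers_def)
  have "?K F p \<lhd> pi1 X x" if "p \<in> pointed_covers X x" for p
    using F[OF that] x by (intro group_hom.normal_kernel group_hom_pi1_map) (auto simp: canonical_map_def)
  then show "shape_kernel X x \<lhd> pi1 X x"
    unfolding SK using ne by (intro group.normal_Inter group_pi1 x) auto
  \<comment> \<open>Taking unions commutes with this intersection because distinct classes are
    disjoint: whether a loop belongs is decided by its class alone.\<close>
  have "\<gamma> \<in> \<Union>(shape_kernel X x) \<longleftrightarrow> (\<forall>p\<in>pointed_covers X x. \<gamma> \<in> \<Union>(?K F p))" for \<gamma>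
  proof -
    have "shape_kernel X x \<subseteq> carrier (pi1 X x)"
      by (auto simp: shape_kernel_def kernel_def)
    moreover have "?K F p \<subseteq> carrier (pi1 X x)" for p
      by (auto simp: kernel_def)
    ultimately show ?thesis
      unfolding in_Union_pi1_iff[OF \<open>shape_kernel X x \<subseteq> _\<close>] in_Union_pi1_iff[OF \<open>\<And>p. ?K F p \<subseteq> _\<close>]
      using ne by (auto simp: SK)
  qed
  then have "\<Union>(shape_kernel X x) = (\<Inter>p\<in>pointed_covers X x. \<Union>(?K F p))"
    by blast
  moreover have "closedin (loop_space X x) (\<Union>(?K F p))" if "p \<in> pointed_covers X x" for p
    using canonical_kernel_clopen(2)[OF X x _ F[OF that]] that
    by (auto simp: pi1_closed_def pointed_covers_def)
  ultimately show "pi1_closed X x (shape_kernel X x)"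
    unfolding pi1_closed_def using ne by (simp only:) (intro closedin_INT)
qed

section \<open>Locally path connected spaces\<close>

lemma path_connectedin_pathE:
  assumes "path_connectedin X S" "v \<in> S" "w \<in> S"
  obtains a where "pathin X a" "a ` {0..1} \<subseteq> S" "a 0 = v" "a 1 = w"
  using assms unfolding path_connectedin by (metis image_subset_iff_funcset)

text \<open>As h only sees loops at x, the local condition is expressed by lassos: go to z along
  \<alpha>, run through a small loop, return. One choice of \<alpha> for each z is enough, because
  the lasso value is a conjugate of the value of the small loop.\<close>

lemma shape_kernel_subset_kernel:
  assumes X: "path_connected_space X" "locally_path_connected_space X" "metrizable_space X"
    and x: "x \<in> topspace X" and h: "group_hom (pi1 X x) Q h"
    and local: "\<And>z. z \<in> topspace X \<Longrightarrow> \<exists>A \<alpha>. openin X A \<and> z \<in> A \<and> pathin X \<alpha> \<and> \<alpha> 0 = x \<and> \<alpha> 1 = z \<and>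
      (\<forall>a. pathin X a \<and> a ` {0..1} \<subseteq> A \<and> a 0 = z \<and> a 1 = z \<longrightarrow>
        h (loop_class X x (loop_join \<alpha> (loop_join a (\<lambda>t. \<alpha> (1 - t))))) = \<one>\<^bsub>Q\<^esub>)"
  shows "shape_kernel X x \<subseteq> kernel (pi1 X x) Q h"
proof -
  obtain \<theta> where pf: "path_functor Q X \<theta>"
    and \<theta>h: "\<And>a. pathin X a \<Longrightarrow> a 0 = x \<Longrightarrow> a 1 = x \<Longrightarrow> \<theta> a = h (loop_class X x a)"
    by (rule path_functor_exists[OF h X(1) x]) auto
  interpret path_functor Q X \<theta>
    by (rule pf)
  \<comment> \<open>On a good set \<theta> depends only on the endpoints of a path. In contrast to
    triviality on loops at one point, this passes to arbitrary subsets.\<close>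
  define good where "good = (\<lambda>D. \<forall>a b. pathin X a \<and> pathin X b \<and> a ` {0..1} \<subseteq> D \<and> b ` {0..1} \<subseteq> D \<and>
    a 0 = b 0 \<and> a 1 = b 1 \<longrightarrow> \<theta> a = \<theta> b)"
  have good_mono: "good E" if "good D" "E \<subseteq> D" for D E
    using that unfolding good_def by (meson order_trans)
  have good_nbhd: "\<exists>D. openin X D \<and> z \<in> D \<and> good D" if z: "z \<in> topspace X" for z
  proof -
    obtain A \<alpha> where A: "openin X A" "z \<in> A" and \<alpha>: "pathin X \<alpha>" "\<alpha> 0 = x" "\<alpha> 1 = z"
      and triv: "\<And>a. pathin X a \<Longrightarrow> a ` {0..1} \<subseteq> A \<Longrightarrow> a 0 = z \<Longrightarrow> a 1 = z \<Longrightarrow>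
        h (loop_class X x (loop_join \<alpha> (loop_join a (\<lambda>t. \<alpha> (1 - t))))) = \<one>\<^bsub>Q\<^esub>"
      using local[OF z] by metis
    have one: "\<theta> a = \<one>\<^bsub>Q\<^esub>" if a: "pathin X a" "a ` {0..1} \<subseteq> A" "a 0 = z" "a 1 = z" for a
    proof -
      let ?\<beta> = "\<lambda>t. \<alpha> (1 - t)"
      have \<beta>: "pathin X ?\<beta>"
        by (rule pathin_reverse[OF \<alpha>(1)])
      have ab: "pathin X (loop_join a ?\<beta>)"
        using a \<alpha> \<beta> by (intro pathin_loop_join) auto
      then have "pathin X (loop_join \<alpha> (loop_join a ?\<beta>))"
        using a \<alpha> by (intro pathin_loop_join[OF \<alpha>(1) ab]) auto
      then have "\<theta> (loop_join \<alpha> (loop_join a ?\<beta>)) = \<one>\<^bsub>Q\<^esub>"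
        using \<theta>h triv[OF a] \<alpha>(2) by simp
      then have "\<theta> \<alpha> \<otimes>\<^bsub>Q\<^esub> (\<theta> a \<otimes>\<^bsub>Q\<^esub> inv\<^bsub>Q\<^esub> \<theta> \<alpha>) = \<one>\<^bsub>Q\<^esub>"
        using join[OF \<alpha>(1) ab] join[OF a(1) \<beta>] reverse[OF \<alpha>(1)] a \<alpha> by simp
      then have "\<theta> a \<otimes>\<^bsub>Q\<^esub> inv\<^bsub>Q\<^esub> \<theta> \<alpha> = inv\<^bsub>Q\<^esub> \<theta> \<alpha>"
        using closed[OF a(1)] closed[OF \<alpha>(1)] by (metis Q.inv_closed Q.inv_equality Q.inv_inv Q.m_closed)
      then show ?thesis
        using closed[OF a(1)] closed[OF \<alpha>(1)] by simp
    qed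
    obtain D where D: "openin X D" "path_connectedin X D" "z \<in> D" "D \<subseteq> A"
      using X(2) A unfolding locally_path_connected_space by meson
    have "good D"
      unfolding good_def
    proof (intro allI impI, elim conjE)
      fix a b assume a: "pathin X a" "a ` {0..1} \<subseteq> D" and b: "pathin X b" "b ` {0..1} \<subseteq> D"
        and ab: "a 0 = b 0" "a 1 = b 1"
      have "a 0 \<in> D"
        using a(2) by auto
      then obtain c where c: "pathin X c" "c ` {0..1} \<subseteq> D" "c 0 = z" "c 1 = a 0"
        by (rule path_connectedin_pathE[OF D(2,3)])
      let ?b = "\<lambda>t. b (1 - t)" and ?c = "\<lambda>t. c (1 - t)"
      \<comment> \<open>Out along c, along a, back along b and back along c: a loop at z inside D,
        whose triviality forces \<open>\<theta> a = \<theta> b\<close>.\<close>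
      let ?l = "loop_join (loop_join c a) (loop_join ?b ?c)"
      have r: "pathin X ?b" "pathin X ?c"
        using b c pathin_reverse by auto
      have p: "pathin X (loop_join c a)" "pathin X (loop_join ?b ?c)"
        using a b c ab r by (auto intro!: pathin_loop_join)
      have D': "u t \<in> D" if "u = a \<or> u = b \<or> u = c" "0 \<le> t" "t \<le> 1" for u and t :: real
        using that a(2) b(2) c(2) by auto
      have "?l ` {0..1} \<subseteq> D"
        unfolding loop_join_def by (auto intro!: D')
      moreover have "pathin X ?l"
        using ab by (intro pathin_loop_join[OF p]) simp
      ultimately have "\<theta> ?l = \<one>\<^bsub>Q\<^esub>"
        using c D(4) by (intro one) auto
      moreover have "\<theta> ?l = \<theta> c \<otimes>\<^bsub>Q\<^esub> \<theta> a \<otimes>\<^bsub>Q\<^esub> (inv\<^bsub>Q\<^esub> \<theta> b \<otimes>\<^bsub>Q\<^esub> inv\<^bsub>Q\<^esub> \<theta> c)"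
        using p r a b c ab by (simp add: join reverse)
      moreover have "inv\<^bsub>Q\<^esub> \<theta> b \<otimes>\<^bsub>Q\<^esub> inv\<^bsub>Q\<^esub> \<theta> c = inv\<^bsub>Q\<^esub> (\<theta> c \<otimes>\<^bsub>Q\<^esub> \<theta> b)"
        using closed b c by (simp add: Q.inv_mult_group)
      ultimately have "\<theta> c \<otimes>\<^bsub>Q\<^esub> \<theta> a = \<theta> c \<otimes>\<^bsub>Q\<^esub> \<theta> b"
        using closed[OF a(1)] closed[OF b(1)] closed[OF c(1)]
        by (metis Q.inv_closed Q.inv_equality Q.inv_inv Q.m_closed)
      then show "\<theta> a = \<theta> b"
        using closed[OF a(1)] closed[OF b(1)] closed[OF c(1)] by simp
    qed
    then show ?thesis
      using D by blast
  qed
  obtain M d where Md: "Metric_space M d" and XM: "X = Metric_space.mtopology M d"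
    using X(3) unfolding metrizable_space_def by metis
  interpret Metric_space M d
    by (rule Md)
  have top: "topspace X = M"
    by (simp add: XM)
  \<comment> \<open>The factor 1/4 makes unions small: if two such sets meet, every point of either
    is within three quarters of the larger radius from the center belonging to that radius, so the
    union lies in a good ball.\<close>
  have "\<exists>e W. 0 < e \<and> good (mball z e) \<and> openin X W \<and> path_connectedin X W \<and> z \<in> W \<and> W \<subseteq> mball z (e / 4)"
    if z: "z \<in> M" for z
  proof -
    obtain D where D: "openin X D" "z \<in> D" "good D"
      using good_nbhd z top by blast
    then obtain e where e: "0 < e" "mball z e \<subseteq> D"
      unfolding XM openin_mtopology by blast
    have "openin X (mball z (e / 4))" "z \<in> mball z (e / 4)"
      using z e(1) by (auto simp: XM)
    then obtain W where "openin X W" "path_connectedin X W" "z \<in> W" "W \<subseteq> mball z (e / 4)"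
      using X(2) unfolding locally_path_connected_space by meson
    then show ?thesis
      using e(1) good_mono[OF D(3) e(2)] by blast
  qed
  then have "\<forall>z\<in>M. \<exists>s. 0 < fst s \<and> good (mball z (fst s)) \<and> openin X (snd s) \<and> path_connectedin X (snd s) \<and>
      z \<in> snd s \<and> snd s \<subseteq> mball z (fst s / 4)"
    by (metis fst_conv snd_conv)
  from bchoice[OF this] obtain s where s: "\<And>z. z \<in> M \<Longrightarrow> 0 < fst (s z) \<and> good (mball z (fst (s z))) \<and>
      openin X (snd (s z)) \<and> path_connectedin X (snd (s z)) \<and>
      z \<in> snd (s z) \<and> snd (s z) \<subseteq> mball z (fst (s z) / 4)"
    by blast
  define \<W> where "\<W> = (snd \<circ> s) ` M"
  have good_union: "good (U \<union> V)" if U: "U \<in> \<W>" and V: "V \<in> \<W>" and ne: "U \<inter> V \<noteq> {}" for U V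
  proof -
    have *: "good (snd (s y) \<union> snd (s z))"
      if yz: "y \<in> M" "z \<in> M" "snd (s y) \<inter> snd (s z) \<noteq> {}" "fst (s z) \<le> fst (s y)" for y z
    proof -
      obtain w where w: "w \<in> snd (s y)" "w \<in> snd (s z)"
        using yz(3) by blast
      then have dw: "d y w < fst (s y) / 4" "d z w < fst (s z) / 4" "w \<in> M"
        using s[OF yz(1)] s[OF yz(2)] by auto
      have "snd (s y) \<union> snd (s z) \<subseteq> mball y (fst (s y))"
      proof
        fix v assume "v \<in> snd (s y) \<union> snd (s z)"
        then show "v \<in> mball y (fst (s y))"
        proof
          assume "v \<in> snd (s y)"
          then show ?thesis
            using s[OF yz(1)] by auto
        next
          assume "v \<in> snd (s z)"
          then have v: "d z v < fst (s z) / 4" "v \<in> M"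
            using s[OF yz(2)] by auto
          have "d y v \<le> d y w + (d w z + d z v)"
            using triangle[of y w v] triangle[of w z v] v(2) dw(3) yz(1,2) by linarith
          then show ?thesis
            using v dw commute[of w z] yz(1,4) s[OF yz(1)] by auto
        qed
      qed
      then show ?thesis
        using s[OF yz(1)] good_mono by blast
    qed
    obtain y z where yz: "y \<in> M" "U = snd (s y)" "z \<in> M" "V = snd (s z)"
      using U V by (auto simp: \<W>_def)
    then show ?thesis
      using *[of y z] *[of z y] ne by (cases "fst (s z) \<le> fst (s y)") (auto simp: Un_commute Int_commute)
  qed
  have W: "openin X U" "path_connectedin X U" "U \<noteq> {}" if "U \<in> \<W>" for U
    using that s by (auto simp: \<W>_def)
  define \<zeta> where "\<zeta> = (\<lambda>U. SOME z. z \<in> (U :: 'a set))"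
  have \<zeta>: "\<zeta> U \<in> U" if "U \<in> \<W>" for U
    unfolding \<zeta>_def using W(3)[OF that] by (simp add: some_in_eq)
  \<comment> \<open>The potential of w in U will be \<theta> of a path inside U from the base point
    \<open>\<zeta> U\<close> to w. Since U is good, another choice of path would give the same
    value.\<close>
  define q where "q = (\<lambda>U w. SOME a. pathin X a \<and> a ` {0..1} \<subseteq> U \<and> a 0 = \<zeta> U \<and> a 1 = w)"
  have q: "pathin X (q U w)" "q U w ` {0..1} \<subseteq> U" "q U w 0 = \<zeta> U" "q U w 1 = w"
    if U: "U \<in> \<W>" "w \<in> U" for U w
  proof -
    obtain a where "pathin X a \<and> a ` {0..1} \<subseteq> U \<and> a 0 = \<zeta> U \<and> a 1 = w"
      using path_connectedin_pathE[OF W(2)[OF U(1)] \<zeta>[OF U(1)] U(2)] by metis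
    from someI[where P = "\<lambda>a. pathin X a \<and> a ` {0..1} \<subseteq> U \<and> a 0 = \<zeta> U \<and> a 1 = w", OF this]
    show "pathin X (q U w)" "q U w ` {0..1} \<subseteq> U" "q U w 0 = \<zeta> U" "q U w 1 = w"
      unfolding q_def by blast+
  qed
  have join_image: "loop_join a b ` {0..1} \<subseteq> A \<union> B" if "a ` {0..1} \<subseteq> A" "b ` {0..1} \<subseteq> B" for a b A B
  proof -
    have "a t \<in> A" "b t \<in> B" if "0 \<le> t" "t \<le> 1" for t
      using \<open>a ` {0..1} \<subseteq> A\<close> \<open>b ` {0..1} \<subseteq> B\<close> that by auto
    then show ?thesis
      unfolding loop_join_def by auto
  qed
  interpret path_functor_chart Q X \<theta> \<W> "\<lambda>U. U" "\<lambda>U w. \<theta> (q U w)"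
  proof
    show "\<theta> (q U w) \<in> carrier Q" if "U \<in> \<W>" "w \<in> U" for U w
      using q(1)[OF that] by (rule closed)
  next
    fix U a assume U: "U \<in> \<W>" and a: "pathin X a" "a ` {0..1} \<subseteq> U"
    then have e: "a 0 \<in> U" "a 1 \<in> U"
      by auto
    have "\<theta> (loop_join (q U (a 0)) a) = \<theta> (q U (a 1))"
    proof -
      have "good U"
        using good_union[OF U U] W(3)[OF U] by simp
      moreover have "pathin X (loop_join (q U (a 0)) a)" "loop_join (q U (a 0)) a ` {0..1} \<subseteq> U"
        using q U e a join_image[of "q U (a 0)" U a U] by (auto intro!: pathin_loop_join)
      ultimately show ?thesis
        using q[OF U e(1)] q[OF U e(2)] unfolding good_def by simp
    qed
    then have "\<theta> (q U (a 0)) \<otimes>\<^bsub>Q\<^esub> \<theta> a = \<theta> (q U (a 1))"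
      using join[of "q U (a 0)" a] q[OF U e(1)] a by simp
    then show "\<theta> a = inv\<^bsub>Q\<^esub> \<theta> (q U (a 0)) \<otimes>\<^bsub>Q\<^esub> \<theta> (q U (a 1))"
      using closed[OF a(1)] closed[OF q(1)[OF U e(1)]] closed[OF q(1)[OF U e(2)]] Q.inv_solve_left by metis
  next
    fix U V w w' assume UV: "U \<in> \<W>" "V \<in> \<W>" and w: "w \<in> U \<inter> V" "w' \<in> U \<inter> V"
    \<comment> \<open>This path leads from \<open>\<zeta> U\<close> through w to
      \<open>\<zeta> V\<close> inside the union, and its value is the jump of the potential at w.
      The union is good and the endpoints do not involve w, so the jump is constant on the
      overlap.\<close>
    let ?l = "\<lambda>w. loop_join (q U w) (\<lambda>t. q V w (1 - t))"
    have l: "pathin X (?l w)" "?l w ` {0..1} \<subseteq> U \<union> V" "?l w 0 = \<zeta> U" "?l w 1 = \<zeta> V"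
      "\<theta> (?l w) = \<theta> (q U w) \<otimes>\<^bsub>Q\<^esub> inv\<^bsub>Q\<^esub> \<theta> (q V w)" if "w \<in> U \<inter> V" for w
    proof -
      have wU: "w \<in> U" and wV: "w \<in> V"
        using that by auto
      note qU = q[OF UV(1) wU] and qV = q[OF UV(2) wV]
      have r: "pathin X (\<lambda>t. q V w (1 - t))"
        by (rule pathin_reverse[OF qV(1)])
      show "pathin X (?l w)"
        using qU qV r by (intro pathin_loop_join) auto
      have "(\<lambda>t. q V w (1 - t)) ` {0..1} \<subseteq> V"
        using qV(2) by auto
      with qU(2) show "?l w ` {0..1} \<subseteq> U \<union> V"
        by (rule join_image)
      show "?l w 0 = \<zeta> U" "?l w 1 = \<zeta> V"
        using qU qV by auto
      show "\<theta> (?l w) = \<theta> (q U w) \<otimes>\<^bsub>Q\<^esub> inv\<^bsub>Q\<^esub> \<theta> (q V w)"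
        using join[OF qU(1) r] reverse[OF qV(1)] qU qV by simp
    qed
    have "good (U \<union> V)"
      using w by (intro good_union UV) blast
    then have *: "\<theta> a = \<theta> b" if "pathin X a" "pathin X b" "a ` {0..1} \<subseteq> U \<union> V" "b ` {0..1} \<subseteq> U \<union> V"
      "a 0 = b 0" "a 1 = b 1" for a b
      using that unfolding good_def by blast
    have "\<theta> (?l w) = \<theta> (?l w')"
      by (rule *[OF l(1)[OF w(1)] l(1)[OF w(2)] l(2)[OF w(1)] l(2)[OF w(2)]])
        (simp_all only: l(3,4)[OF w(1)] l(3,4)[OF w(2)])
    then show "\<theta> (q U w) \<otimes>\<^bsub>Q\<^esub> inv\<^bsub>Q\<^esub> \<theta> (q V w) = \<theta> (q U w') \<otimes>\<^bsub>Q\<^esub> inv\<^bsub>Q\<^esub> \<theta> (q V w')"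
      using l(5)[OF w(1)] l(5)[OF w(2)] by simp
  qed
  obtain F where F: "\<forall>p\<in>pointed_covers X x. canonical_map X (fst p) (F p) \<and> F p x = nerve_vertex (snd p)"
    and SK: "shape_kernel X x = (\<Inter>p\<in>pointed_covers X x.
      kernel (pi1 X x) (pi1 (nerve (fst p)) (F p x)) (pi1_map (nerve (fst p)) (F p x) (F p)))"
    using shape_kernel_eq_Inter[OF X(3) x] by (elim exE conjE) (rule that)
  let ?W = "snd (s x)"
  let ?f = "F (\<W>, ?W)"
  have xM: "x \<in> M"
    using x top by simp
  have "(\<W>, ?W) \<in> pointed_covers X x"
  proof -
    have "\<Union>\<W> \<subseteq> topspace X"
      using W(1) openin_subset by blast
    moreover have "M \<subseteq> \<Union>\<W>"
      using s by (force simp: \<W>_def)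
    ultimately show ?thesis
      using W(1) s[OF xM] xM top by (auto simp: pointed_covers_def \<W>_def)
  qed
  note p = this bspec[OF F this]
  have f: "continuous_map X (nerve \<W>) ?f" "\<And>z U. z \<in> topspace X \<Longrightarrow> ?f z U \<noteq> 0 \<Longrightarrow> z \<in> U"
    and fx: "?f x = nerve_vertex ?W"
    using p(2) by (auto simp: canonical_map_def)
  show ?thesis
  proof
    fix g assume g: "g \<in> shape_kernel X x"
    have "g \<in> kernel (pi1 X x) (pi1 (nerve \<W>) (?f x)) (pi1_map (nerve \<W>) (?f x) ?f)"
      using INT_D[OF g[unfolded SK] p(1)] by simp
    then have gc: "g \<in> carrier (pi1 X x)" and g1: "pi1_map (nerve \<W>) (?f x) ?f g = \<one>\<^bsub>pi1 (nerve \<W>) (?f x)\<^esub>"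
      by (auto simp: kernel_def)
    obtain \<gamma> where \<gamma>: "\<gamma> \<in> loops X x" "g = loop_class X x \<gamma>"
      using gc by (rule pi1_carrierE)
    then have \<gamma>p: "pathin X \<gamma>" "\<gamma> 0 = x" "\<gamma> 1 = x"
      by (auto simp: loops_iff)
    have null: "path_homotopic (nerve \<W>) (?f \<circ> \<gamma>) (\<lambda>t. ?f x)"
      using g1 loop_class_eq_one_iff[of "nerve \<W>" "?f \<circ> \<gamma>" "?f x"] pathin_compose[OF \<gamma>p(1) f(1)] \<gamma>p
        pi1_map_loop_class[OF f(1) \<gamma>p] \<gamma>(2) by simp
    have "\<theta> \<gamma> = \<one>\<^bsub>Q\<^esub>"
    \<comment> \<open>The charts are the members of the cover in X, while the open sets in the
      target are the stars of the corresponding vertices. The base point is mapped to a vertex,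
      which lies in no star but its own.\<close>
    proof (rule functor_trivial_if_null[OF \<gamma>p openin_nerve_star _ _ _ _ null])
      show "topspace (nerve \<W>) \<subseteq> \<Union>(nerve_star \<W> ` \<W>)"
      proof
        fix t assume "t \<in> topspace (nerve \<W>)"
        then obtain U where "U \<in> \<W>" "t \<in> nerve_star \<W> U"
          using nerve_star_cover[of t \<W>] by auto
        then show "t \<in> \<Union>(nerve_star \<W> ` \<W>)"
          by blast
      qed
      show "(\<Inter>U\<in>J. U) \<noteq> {}" if J: "finite J" "J \<subseteq> \<W>" "J \<noteq> {}" "\<And>U. U \<in> J \<Longrightarrow> y \<in> nerve_star \<W> U" for J y
      proof -
        obtain U where "U \<in> J"
          using J(3) by blast
        then have "nerve_support y \<in> nerve_simplices \<W>"
          using J(4) by (auto simp: nerve_star_eq nerve_points_iff)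
        moreover have "J \<subseteq> nerve_support y"
          using J(4) by (auto simp: nerve_star_eq)
        ultimately have "J \<in> nerve_simplices \<W>"
          using J(3) nerve_simplices_face by blast
        then show ?thesis
          by (simp add: nerve_simplices_def)
      qed
      show "z \<in> U" if "z \<in> topspace X" "?f z \<in> nerve_star \<W> U" for z U
        using that f(2) by (auto simp: nerve_star_def)
      show "U = ?W" if "?f x \<in> nerve_star \<W> U" for U
        using that by (auto simp: fx nerve_star_def nerve_vertex_def split: if_splits)
    qed
    then show "g \<in> kernel (pi1 X x) Q h"
      using \<theta>h[OF \<gamma>p] gc \<gamma>(2) by (simp add: kernel_def)
  qed
qed

section \<open>Semilocally simply connected targets and open normal subgroups\<close>

lemma semilocally_simply_connected_iff:
  "semilocally_simply_connected Z \<longleftrightarrow> (\<forall>z\<in>topspace Z. \<exists>V. openin Z V \<and> z \<in> V \<and>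
     (\<forall>a. pathin Z a \<and> a ` {0..1} \<subseteq> V \<and> a 0 = z \<and> a 1 = z \<longrightarrow> path_homotopic Z a (\<lambda>t. z)))"
proof -
  have *: "pi1_map Z z (\<lambda>u. u) (loop_class (subtopology Z U) z a) = \<one>\<^bsub>pi1 Z z\<^esub> \<longleftrightarrow> path_homotopic Z a (\<lambda>t. z)"
    if "pathin (subtopology Z U) a" "a 0 = z" "a 1 = z" for U z a
  proof -
    have "continuous_map (subtopology Z U) Z (\<lambda>u. u)"
      by (simp add: continuous_map_from_subtopology)
    from pi1_map_loop_class[OF this that]
    have "pi1_map Z z (\<lambda>u. u) (loop_class (subtopology Z U) z a) = loop_class Z z a"
      by (simp add: o_def)
    then show ?thesis
      using loop_class_eq_one_iff[of Z a z] that by (simp add: pathin_subtopology)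
  qed
  show ?thesis
    unfolding semilocally_simply_connected_def
  proof (intro ball_cong refl iffI)
    fix z assume "\<exists>U\<subseteq>topspace Z. z \<in> Z interior_of U \<and>
      (\<forall>a\<in>carrier (pi1 (subtopology Z U) z). pi1_map Z z (\<lambda>u. u) a = \<one>\<^bsub>pi1 Z z\<^esub>)"
    then obtain U where U: "z \<in> Z interior_of U"
      "\<And>a. a \<in> carrier (pi1 (subtopology Z U) z) \<Longrightarrow> pi1_map Z z (\<lambda>u. u) a = \<one>\<^bsub>pi1 Z z\<^esub>"
      by blast
    show "\<exists>V. openin Z V \<and> z \<in> V \<and>
     (\<forall>a. pathin Z a \<and> a ` {0..1} \<subseteq> V \<and> a 0 = z \<and> a 1 = z \<longrightarrow> path_homotopic Z a (\<lambda>t. z))"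
    \<comment> \<open>Loops in the interior are in particular loops in U, so the neighborhood may be
      replaced by an open one.\<close>
    proof (intro exI[of _ "Z interior_of U"] conjI allI impI)
      fix a assume a: "pathin Z a \<and> a ` {0..1} \<subseteq> Z interior_of U \<and> a 0 = z \<and> a 1 = z"
      then have "pathin (subtopology Z U) a"
        using interior_of_subset[of Z U] by (auto simp: pathin_subtopology)
      then show "path_homotopic Z a (\<lambda>t. z)"
        using a * U(2)[OF loop_class_in_pi1] by blast
    qed (use U in auto)
  next
    fix z assume "\<exists>V. openin Z V \<and> z \<in> V \<and>
     (\<forall>a. pathin Z a \<and> a ` {0..1} \<subseteq> V \<and> a 0 = z \<and> a 1 = z \<longrightarrow> path_homotopic Z a (\<lambda>t. z))"
    then obtain V where V: "openin Z V" "z \<in> V"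
      "\<And>a. pathin Z a \<Longrightarrow> a ` {0..1} \<subseteq> V \<Longrightarrow> a 0 = z \<Longrightarrow> a 1 = z \<Longrightarrow> path_homotopic Z a (\<lambda>t. z)"
      by blast
    have "pi1_map Z z (\<lambda>u. u) g = \<one>\<^bsub>pi1 Z z\<^esub>" if g: "g \<in> carrier (pi1 (subtopology Z V) z)" for g
    proof -
      obtain a where a: "a \<in> loops (subtopology Z V) z" "g = loop_class (subtopology Z V) z a"
        using g by (rule pi1_carrierE)
      then have a': "pathin (subtopology Z V) a" "a 0 = z" "a 1 = z"
        by (auto simp: loops_iff)
      then have "path_homotopic Z a (\<lambda>t. z)"
        by (intro V(3)) (auto simp: pathin_subtopology)
      then show ?thesis
        using *[OF a'] a(2) by simp
    qed
    then show "\<exists>U\<subseteq>topspace Z. z \<in> Z interior_of U \<and>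
      (\<forall>a\<in>carrier (pi1 (subtopology Z U) z). pi1_map Z z (\<lambda>u. u) a = \<one>\<^bsub>pi1 Z z\<^esub>)"
      using V(1,2) openin_subset[OF V(1)] by (intro exI[of _ V]) (auto simp: interior_of_openin)
  qed
qed

text \<open>The neighborhood of z is the preimage of one in which loops at \<open>f z\<close> are
  null-homotopic. The image of a lasso then collapses to the image of \<alpha> followed by its
  reverse.\<close>

lemma shape_kernel_subset_induced_kernel:
  assumes X: "path_connected_space X" "locally_path_connected_space X" "metrizable_space X"
    and x: "x \<in> topspace X" and Y: "semilocally_simply_connected Y" and f: "continuous_map X Y f"
  shows "shape_kernel X x \<subseteq> kernel (pi1 X x) (pi1 Y (f x)) (pi1_map Y (f x) f)"
proof (rule shape_kernel_subset_kernel[OF X x group_hom_pi1_map[OF f x]])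
  fix z assume z: "z \<in> topspace X"
  then have "f z \<in> topspace Y"
    using continuous_map_funspace[OF f] by blast
  then obtain V where V: "openin Y V" "f z \<in> V"
    "\<And>a. pathin Y a \<Longrightarrow> a ` {0..1} \<subseteq> V \<Longrightarrow> a 0 = f z \<Longrightarrow> a 1 = f z \<Longrightarrow> path_homotopic Y a (\<lambda>t. f z)"
    using Y unfolding semilocally_simply_connected_iff by metis
  obtain \<alpha> where \<alpha>: "pathin X \<alpha>" "\<alpha> 0 = x" "\<alpha> 1 = z"
    using X(1) x z unfolding path_connected_space_def by blast
  let ?\<beta> = "\<lambda>t. \<alpha> (1 - t)"
  have \<beta>: "pathin X ?\<beta>"
    by (rule pathin_reverse[OF \<alpha>(1)])
  note f\<alpha> = pathin_compose[OF \<alpha>(1) f] and f\<beta> = pathin_compose[OF \<beta> f]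
  have triv: "pi1_map Y (f x) f (loop_class X x (loop_join \<alpha> (loop_join a ?\<beta>))) = \<one>\<^bsub>pi1 Y (f x)\<^esub>"
    if a: "pathin X a" "a ` {0..1} \<subseteq> {y \<in> topspace X. f y \<in> V}" "a 0 = z" "a 1 = z" for a
  proof -
    have fa: "pathin Y (f \<circ> a)"
      by (rule pathin_compose[OF a(1) f])
    then have null: "path_homotopic Y (f \<circ> a) (\<lambda>t. f z)"
      using a by (intro V(3)) auto
    let ?l = "loop_join \<alpha> (loop_join a ?\<beta>)"
    have l: "pathin X ?l"
      using a \<alpha> \<beta> by (intro pathin_loop_join) auto
    have "path_homotopic Y (f \<circ> ?l) (loop_join (f \<circ> \<alpha>) (loop_join (f \<circ> a) (f \<circ> ?\<beta>)))"
      by (rule path_homotopic_eq[OF pathin_compose[OF l f]]) (auto simp: loop_join_def)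
    also have "path_homotopic Y \<dots> (loop_join (f \<circ> \<alpha>) (loop_join (\<lambda>t. f z) (f \<circ> ?\<beta>)))"
      using a \<alpha> by (intro path_homotopic_join[OF path_homotopic_refl[OF f\<alpha>]]
          path_homotopic_join[OF null path_homotopic_refl[OF f\<beta>]]) auto
    also have "path_homotopic Y \<dots> (loop_join (f \<circ> \<alpha>) (f \<circ> ?\<beta>))"
      using a \<alpha> by (intro path_homotopic_join[OF path_homotopic_refl[OF f\<alpha>]]
          path_homotopic_const_join[OF f\<beta>]) auto
    also have "path_homotopic Y \<dots> (\<lambda>t. f x)"
      using path_homotopic_join_reverse[OF f\<alpha>] \<alpha> by (simp add: o_def)
    finally show ?thesis
      using pi1_map_loop_class[OF f l] loop_class_eq_one_iff[OF pathin_compose[OF l f], of "f x"] \<alpha> by simp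
  qed
  show "\<exists>A \<alpha>. openin X A \<and> z \<in> A \<and> pathin X \<alpha> \<and> \<alpha> 0 = x \<and> \<alpha> 1 = z \<and>
      (\<forall>a. pathin X a \<and> a ` {0..1} \<subseteq> A \<and> a 0 = z \<and> a 1 = z \<longrightarrow>
        pi1_map Y (f x) f (loop_class X x (loop_join \<alpha> (loop_join a (\<lambda>t. \<alpha> (1 - t))))) = \<one>\<^bsub>pi1 Y (f x)\<^esub>)"
    using openin_continuous_map_preimage[OF f V(1)] z V(2) \<alpha> triv
    by (intro exI[of _ "{y \<in> topspace X. f y \<in> V}"] exI[of _ \<alpha>]) simp
qed

text \<open>Applied to the quotient by G. The lasso around a constant loop at z is null-homotopic,
  hence belongs to the open set \<open>\<Union>G\<close>; exchanging the constant for a loop in a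
  small ball around z moves the lasso by little in the sup metric, so its class remains in
  G.\<close>

lemma shape_kernel_subset_open_normal:
  assumes X: "path_connected_space X" "locally_path_connected_space X" "metrizable_space X"
    and x: "x \<in> topspace X" and G: "G \<lhd> pi1 X x" "pi1_open X x G"
  shows "shape_kernel X x \<subseteq> G"
proof -
  interpret normal G "pi1 X x"
    by (rule G(1))
  have GC: "G \<subseteq> carrier (pi1 X x)"
    by (rule subset)
  have hom: "group_hom (pi1 X x) (pi1 X x Mod G) (\<lambda>g. G #>\<^bsub>pi1 X x\<^esub> g)"
    using factorgroup_is_group r_coset_hom_Mod by (simp add: group_hom_def group_hom_axioms_def is_group)
  obtain m where m: "mtopology_of m = X"
    "\<And>S. S \<subseteq> loops X x \<Longrightarrow> openin (loop_space X x) S \<longleftrightarrow>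
      (\<forall>\<gamma>\<in>S. \<exists>\<epsilon>>0. \<forall>\<delta>\<in>loops X x. (\<forall>t\<in>{0..1}. mdist m (\<gamma> t) (\<delta> t) < \<epsilon>) \<longrightarrow> \<delta> \<in> S)"
    using loop_space_open[OF X(3), of x] by metis
  interpret Metric_space "mspace m" "mdist m"
    by (rule Metric_space_mspace_mdist)
  have mtop: "mtopology = X"
    using m(1) by (simp add: mtopology_of_def)
  have GL: "\<Union>G \<subseteq> loops X x"
    using in_Union_pi1_iff[OF GC] by blast
  have "shape_kernel X x \<subseteq> kernel (pi1 X x) (pi1 X x Mod G) (\<lambda>g. G #>\<^bsub>pi1 X x\<^esub> g)"
  proof (rule shape_kernel_subset_kernel[OF X x hom])
    fix z assume z: "z \<in> topspace X"
    then obtain \<alpha> where \<alpha>: "pathin X \<alpha>" "\<alpha> 0 = x" "\<alpha> 1 = z"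
      using X(1) x unfolding path_connected_space_def by blast
    let ?\<beta> = "\<lambda>t. \<alpha> (1 - t)"
    let ?l = "\<lambda>a. loop_join \<alpha> (loop_join a ?\<beta>)"
    have \<beta>: "pathin X ?\<beta>"
      by (rule pathin_reverse[OF \<alpha>(1)])
    have l: "pathin X (?l a)" "?l a 0 = x" "?l a 1 = x" "?l a \<in> loops X x"
      if "pathin X a" "a 0 = z" "a 1 = z" for a
    proof -
      show "pathin X (?l a)"
        using that \<alpha> \<beta> by (intro pathin_loop_join) auto
      then show "?l a \<in> loops X x"
        using \<alpha> by (simp add: loops_iff loop_join_extensional)
    qed (use \<alpha> in auto)
    let ?c = "\<lambda>t::real. z"
    have c: "pathin X ?c"
      using z by simp
    have "path_homotopic X (?l ?c) (loop_join \<alpha> ?\<beta>)"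
      using \<alpha> by (intro path_homotopic_join[OF path_homotopic_refl[OF \<alpha>(1)]]
          path_homotopic_const_join[OF \<beta>]) auto
    also have "path_homotopic X \<dots> (\<lambda>t. x)"
      using path_homotopic_join_reverse[OF \<alpha>(1)] \<alpha>(2) by simp
    finally have "loop_class X x (?l ?c) = \<one>\<^bsub>pi1 X x\<^esub>"
      using l[OF c] by (subst loop_class_eq_one_iff) auto
    then have "?l ?c \<in> \<Union>G"
      using l(4)[OF c] in_Union_pi1_iff[OF GC] one_closed by simp
    then obtain \<epsilon> where \<epsilon>: "0 < \<epsilon>"
      "\<And>\<delta>. \<delta> \<in> loops X x \<Longrightarrow> (\<And>t. t \<in> {0..1} \<Longrightarrow> mdist m (?l ?c t) (\<delta> t) < \<epsilon>) \<Longrightarrow> \<delta> \<in> \<Union>G"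
      using G(2)[unfolded pi1_open_def m(2)[OF GL]] by (metis (no_types, lifting))
    have triv: "G #>\<^bsub>pi1 X x\<^esub> loop_class X x (?l a) = \<one>\<^bsub>pi1 X x Mod G\<^esub>"
      if a: "pathin X a" "a ` {0..1} \<subseteq> mball z \<epsilon>" "a 0 = z" "a 1 = z" for a
    proof -
      have "?l a \<in> \<Union>G"
      proof (rule \<epsilon>(2)[OF l(4)[OF a(1,3,4)]])
        fix t :: real assume t: "t \<in> {0..1}"
        have "?l ?c t \<in> topspace X"
          using path_image_subset_topspace[OF l(1)[OF c]] t by auto
        then have "?l ?c t \<in> mspace m"
          using m(1) by auto
        then have zero: "mdist m (?l ?c t) (?l ?c t) < \<epsilon>"
          using \<epsilon>(1) mdist_zero by metis
        have near: "mdist m z (a s) < \<epsilon>" if "0 \<le> s" "s \<le> 1" for s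
          using subsetD[OF a(2), of "a s"] that by auto
        \<comment> \<open>The two lassos agree on [0,1/2] and on (3/4,1]; between these ranges one
          runs through a and the other rests at z.\<close>
        consider "t \<le> 1/2" | "1/2 < t" "2 * t - 1 \<le> 1/2" | "1/2 < 2 * t - 1"
          by linarith
        then show "mdist m (?l ?c t) (?l a t) < \<epsilon>"
        proof cases
          case 1
          then have "?l a t = ?l ?c t"
            by (simp add: loop_join_def)
          then show ?thesis
            using zero by simp
        next
          case 2
          then have "?l a t = a (2 * (2 * t - 1))" "?l ?c t = z"
            using t by (simp_all add: loop_join_def)
          moreover have "0 \<le> 2 * (2 * t - 1)" "2 * (2 * t - 1) \<le> 1"
            using 2 by auto
          ultimately show ?thesis
            using near by simp
        next
          case 3
          then have "?l a t = ?l ?c t"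
            using t by (simp add: loop_join_def)
          then show ?thesis
            using zero by simp
        qed
      qed
      then have "loop_class X x (?l a) \<in> G"
        using in_Union_pi1_iff[OF GC] by blast
      then show ?thesis
        using GC by (simp add: coset_join2 is_subgroup subsetD)
    qed
    have "openin X (mball z \<epsilon>)" "z \<in> mball z \<epsilon>"
      using z \<epsilon>(1) mtop by (metis openin_mball) (use z \<epsilon>(1) mtop in auto)
    then show "\<exists>A \<alpha>. openin X A \<and> z \<in> A \<and> pathin X \<alpha> \<and> \<alpha> 0 = x \<and> \<alpha> 1 = z \<and>
      (\<forall>a. pathin X a \<and> a ` {0..1} \<subseteq> A \<and> a 0 = z \<and> a 1 = z \<longrightarrow>
        G #>\<^bsub>pi1 X x\<^esub> loop_class X x (loop_join \<alpha> (loop_join a (\<lambda>t. \<alpha> (1 - t)))) = \<one>\<^bsub>pi1 X x Mod G\<^esub>)"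
      using \<alpha> triv by blast
  qed
  also have "\<dots> \<subseteq> G"
    using coset_join1 is_subgroup by (auto simp: kernel_def)
  finally show ?thesis .
qed

text \<open>The nerve carried over to the type of targets available in the theorem.\<close>

lemma canonical_kernel_as_target:
  fixes X :: "'a topology"
  assumes X: "path_connected_space X" and x: "x \<in> topspace X"
    and \<U>: "\<Union>\<U> \<subseteq> topspace X" and f: "canonical_map X \<U> f"
  obtains Y :: "(('a set \<Rightarrow> real) + 'b) topology" and k
  where "path_connected_space Y" "semilocally_simply_connected Y" "continuous_map X Y k"
    "kernel (pi1 X x) (pi1 Y (k x)) (pi1_map Y (k x) k) \<subseteq>
     kernel (pi1 X x) (pi1 (nerve \<U>) (f x)) (pi1_map (nerve \<U>) (f x) f)"
proof -
  let ?N = "nerve \<U>"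
  let ?A = "Inl ` nerve_points \<U> :: (('a set \<Rightarrow> real) + 'b) set"
  let ?k = "Inl \<circ> f :: 'a \<Rightarrow> ('a set \<Rightarrow> real) + 'b"
  \<comment> \<open>The topology is transported along \<open>projl\<close>, which makes
    \<open>Inl\<close> and \<open>projl\<close> mutually inverse homeomorphisms between the nerve
    and its copy.\<close>
  define Y where "Y = pullback_topology ?A projl ?N"
  have conn: "path_connected_space ?N"
    by (rule path_connected_space_nerve[OF X \<U> f])
  have cont: "continuous_map X ?N f"
    using f by (simp add: canonical_map_def)
  have topY: "topspace Y = ?A"
    unfolding Y_def topspace_pullback_topology by auto
  have r: "continuous_map Y ?N projl"
    unfolding Y_def using continuous_map_pullback[OF continuous_map_id, of ?A projl ?N] by simp
  have i: "continuous_map ?N Y Inl"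
    unfolding Y_def by (rule continuous_map_pullback') (auto simp: o_def)
  have ri: "Inl (projl y) = y" if "y \<in> topspace Y" for y
    using that by (auto simp: topY)
  have "path_connected_space Y"
  proof -
    have "path_connectedin Y (Inl ` topspace ?N)"
      using conn path_connectedin_topspace[of ?N]
      by (intro path_connectedin_continuous_map_image[OF i]) simp
    then show ?thesis
      using path_connectedin_topspace[of Y] by (simp add: topY)
  qed
  moreover have "semilocally_simply_connected Y"
    unfolding semilocally_simply_connected_iff
  proof
    fix y assume y: "y \<in> topspace Y"
    then have "projl y \<in> topspace ?N"
      by (auto simp: topY)
    then obtain V where V: "openin ?N V" "projl y \<in> V"
      "\<And>a. pathin ?N a \<Longrightarrow> a ` {0..1} \<subseteq> V \<Longrightarrow> a 0 = projl y \<Longrightarrow> a 1 = projl y \<Longrightarrow> path_homotopic ?N a (\<lambda>t. projl y)"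
      using semilocally_simply_connected_nerve[OF conn] unfolding semilocally_simply_connected_iff by metis
    show "\<exists>V. openin Y V \<and> y \<in> V \<and>
      (\<forall>a. pathin Y a \<and> a ` {0..1} \<subseteq> V \<and> a 0 = y \<and> a 1 = y \<longrightarrow> path_homotopic Y a (\<lambda>t. y))"
    proof (intro exI[of _ "{y \<in> topspace Y. projl y \<in> V}"] conjI allI impI)
      show "openin Y {y \<in> topspace Y. projl y \<in> V}"
        by (rule openin_continuous_map_preimage[OF r V(1)])
      fix a assume a: "pathin Y a \<and> a ` {0..1} \<subseteq> {y \<in> topspace Y. projl y \<in> V} \<and> a 0 = y \<and> a 1 = y"
      have "path_homotopic ?N (projl \<circ> a) (\<lambda>t. projl y)"
        using a pathin_compose[OF _ r] by (intro V(3)) auto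
      from path_homotopic_map[OF this i]
      have "path_homotopic Y (Inl \<circ> (projl \<circ> a)) (\<lambda>t. y)"
        using ri[OF y] by (simp add: o_def)
      moreover have "path_homotopic Y a (Inl \<circ> (projl \<circ> a))"
      proof (rule path_homotopic_eq)
        show "a t = (Inl \<circ> (projl \<circ> a)) t" if "t \<in> {0..1}" for t
        proof -
          have "a t \<in> topspace Y"
            using a that by blast
          then show ?thesis
            using ri[of "a t"] by simp
        qed
      qed (use a in blast)
      ultimately show "path_homotopic Y a (\<lambda>t. y)"
        by (rule path_homotopic_trans[rotated])
    qed (use y V(2) in simp_all)
  qed
  moreover have k: "continuous_map X Y ?k"
    by (rule continuous_map_compose[OF cont i])
  moreover have "kernel (pi1 X x) (pi1 Y (?k x)) (pi1_map Y (?k x) ?k) \<subseteq>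
     kernel (pi1 X x) (pi1 ?N (f x)) (pi1_map ?N (f x) f)"
  proof
    fix g assume g: "g \<in> kernel (pi1 X x) (pi1 Y (?k x)) (pi1_map Y (?k x) ?k)"
    then have gc: "g \<in> carrier (pi1 X x)"
      by (simp add: kernel_def)
    have Yx: "?k x \<in> topspace Y"
      using continuous_map_funspace[OF k] x by blast
    \<comment> \<open>Since \<open>projl \<circ> ?k\<close> is f, whatever dies in the copy also
      dies in the nerve.\<close>
    have "pi1_map ?N (projl (?k x)) (projl \<circ> ?k) g
        = pi1_map ?N (projl (?k x)) projl (pi1_map Y (?k x) ?k g)"
      by (rule pi1_map_comp[OF k r gc, symmetric])
    also have "\<dots> = pi1_map ?N (projl (?k x)) projl \<one>\<^bsub>pi1 Y (?k x)\<^esub>"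
      using g by (simp add: kernel_def)
    also have "\<dots> = \<one>\<^bsub>pi1 ?N (projl (?k x))\<^esub>"
      by (rule group_hom.hom_one[OF group_hom_pi1_map[OF r Yx]])
    finally show "g \<in> kernel (pi1 X x) (pi1 ?N (f x)) (pi1_map ?N (f x) f)"
      using gc by (simp add: kernel_def o_def)
  qed
  ultimately show thesis
    by (rule that)
qed

theorem theorem5p1:
  fixes X :: "'a topology" and x :: 'a
  assumes "path_connected_space X" and "metrizable_space X" and "x \<in> topspace X"
  shows "shape_kernel X x \<lhd> pi1 X x \<and> pi1_closed X x (shape_kernel X x) \<and>
    (locally_path_connected_space X \<longrightarrow>
       shape_kernel X x =
         \<Inter> {kernel (pi1 X x) (pi1 Y (f x)) (pi1_map Y (f x) f)
             | (Y :: (('a set \<Rightarrow> real) + 'b) topology) f.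
               path_connected_space Y \<and> semilocally_simply_connected Y \<and> continuous_map X Y f} \<and>
       shape_kernel X x =
         \<Inter> {G. G \<lhd> pi1 X x \<and> pi1_open X x G})"
proof (intro conjI impI)
  show "shape_kernel X x \<lhd> pi1 X x" "pi1_closed X x (shape_kernel X x)"
    by (rule shape_kernel_normal_closed[OF assms])+
  assume lpc: "locally_path_connected_space X"
  let ?K = "\<lambda>F p. kernel (pi1 X x) (pi1 (nerve (fst p)) (F p x)) (pi1_map (nerve (fst p)) (F p x) (F p))"
  obtain F where F: "\<And>p. p \<in> pointed_covers X x \<Longrightarrow> canonical_map X (fst p) (F p)"
    and SK: "shape_kernel X x = (\<Inter>p\<in>pointed_covers X x. ?K F p)"
    using shape_kernel_eq_Inter[OF assms(2,3)] by blast
  have cov: "\<Union>(fst p) \<subseteq> topspace X" if "p \<in> pointed_covers X x" for p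
    using that by (auto simp: pointed_covers_def)
  show "shape_kernel X x =
         \<Inter> {kernel (pi1 X x) (pi1 Y (f x)) (pi1_map Y (f x) f)
             | (Y :: (('a set \<Rightarrow> real) + 'b) topology) f.
               path_connected_space Y \<and> semilocally_simply_connected Y \<and> continuous_map X Y f}"
    (is "_ = \<Inter>?\<K>")
  proof (rule subset_antisym)
    show "shape_kernel X x \<subseteq> \<Inter>?\<K>"
      using shape_kernel_subset_induced_kernel[OF assms(1) lpc assms(2,3)] by blast
    have "\<Inter>?\<K> \<subseteq> ?K F p" if p: "p \<in> pointed_covers X x" for p
    proof -
      obtain Y :: "(('a set \<Rightarrow> real) + 'b) topology" and k
        where Y: "path_connected_space Y" "semilocally_simply_connected Y" "continuous_map X Y k"
          and k: "kernel (pi1 X x) (pi1 Y (k x)) (pi1_map Y (k x) k) \<subseteq> ?K F p"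
        by (rule canonical_kernel_as_target[OF assms(1,3) cov[OF p] F[OF p]])
      have "kernel (pi1 X x) (pi1 Y (k x)) (pi1_map Y (k x) k) \<in> ?\<K>"
        using Y by blast
      then show ?thesis
        using k by blast
    qed
    then show "\<Inter>?\<K> \<subseteq> shape_kernel X x"
      unfolding SK by blast
  qed
  show "shape_kernel X x = \<Inter> {G. G \<lhd> pi1 X x \<and> pi1_open X x G}"
  proof (rule subset_antisym)
    show "shape_kernel X x \<subseteq> \<Inter> {G. G \<lhd> pi1 X x \<and> pi1_open X x G}"
      using shape_kernel_subset_open_normal[OF assms(1) lpc assms(2,3)] by blast
    \<comment> \<open>The kernels whose intersection is the shape kernel are themselves open and
      normal, so they take part in the intersection on the right.\<close>
    have "?K F p \<lhd> pi1 X x \<and> pi1_open X x (?K F p)" if p: "p \<in> pointed_covers X x" for p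
      using group_hom.normal_kernel[OF group_hom_pi1_map[of X "nerve (fst p)" "F p" x]] assms(3)
        canonical_kernel_clopen(1)[OF assms cov[OF p] F[OF p]] F[OF p]
      by (simp add: canonical_map_def)
    then show "\<Inter> {G. G \<lhd> pi1 X x \<and> pi1_open X x G} \<subseteq> shape_kernel X x"
      unfolding SK by blast
  qed
qed

end
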